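(* Let $\mathcal{F}_1$ be an infinite periodic frieze and let $\mathcal{F}_1^s$ be its reduced frieze, which is assumed to be a skeletal frieze. Then: (1) $\mathcal{F}_1^s$ uniquely determines a skeletal infinite periodic frieze $\mathcal{F}_2^s$ such that $(\mathcal{F}_1^s,\mathcal{F}_2^s)$ is the pair of infinite periodic friezes associated to a triangulation of an annulus; (2) $\mathcal{F}_1^s$ gives rise to an infinite family of infinite periodic friezes $\mathcal{F}_2$ such that, for each of them, $(\mathcal{F}_1^s,\mathcal{F}_2)$ is the pair of infinite periodic friezes associated to a triangulation of an annulus.
   Context: Friezes. Given a sequence $(a_i)_{i\in\mathbb{Z}}$ of positive integers (the quiddity row), define numbers $a_{i,j}$ for $j\ge i-2$ by $a_{i,i-2}=0$, $a_{i,i-1}=1$, $a_{i,i}=a_i$ and the diamond rule $a_{i,j}a_{i+1,j+1}-a_{i,j+1}a_{i+1,j}=1$. This array (rows of $0$'s, of $1$'s, the quiddity row, then the rows $\{a_{i,i+k}\}_i$, $k\ge1$) is an infinite frieze if all $a_{i,j}$ with $j\ge i$ are positive integers. It is periodic of period $n$ if $a_{i+n}=a_i$ for all $i$; then $(a_1,\dots,a_n)$ is a quiddity sequence of the frieze, and quiddity sequences are considered up to cyclic rotation. A frieze is determined by its quiddity sequence. Reduction: if $q=(a_1,\dots,a_r)$ is a quiddity sequence with some $a_i=1$, a reduction at $a_i$ is: if $r\ge3$ and $a_{i-1},a_{i+1}\ge2$ (indices cyclic), delete $a_i$ and decrease $a_{i-1}$ and $a_{i+1}$ by $1$; if $q=(1,k)$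 with $k\ge3$, replace $q$ by $(k-2)$. The reduced quiddity sequence $q^s$ is obtained from $q$ by applying reductions successively until no entry equals $1$ (the result is independent of the choices). The reduced frieze $\mathcal{F}^s$ of a frieze $\mathcal{F}$ with quiddity sequence $q$ is the frieze with quiddity sequence $q^s$. A quiddity sequence $q$ is skeletal if $q=q^s$ (no entry equals $1$) and $q\neq(2,2,\dots,2)$; a skeletal frieze is one with a skeletal quiddity sequence. Triangulations. $C_{m,n}$ is an annulus with $m\ge1$ marked points on one boundary component $B_1$ and $n\ge1$ marked points on the other $B_2$. An arc is a homotopy class of curves with endpoints at marked points having a representative without self-intersections, meeting the boundary only at its endpoints, and not contractible into the boundary. A triangulation is a maximal collection of pairwise compatible (non-crossing) arcs; only such finite arcs are allowed. For a triangulation $\mathcal{T}$ of $C_{m,n}$, let $q_1$ (resp. $q_2$) be the sequence of numbers of triangles of $\mathcal{T}$ incident to the marked points of $B_1$ (resp. $B_2$) in cyclic order; these are quiddity sequences of infinite periodic friezes $\mathcal{F}_1,\mathcal{F}_2$, called the pair of friezes associated to $\mathcal{T}$. *)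

theory Defs
  imports "HOL-Analysis.Analysis"
begin

text \<open>
  A frieze is stored by rows: \<open>F i k\<close> is the entry $a_{i,i+k-2}$.  Thus \<open>k = 0\<close> is the row
  of zeros, \<open>k = 1\<close> the row of ones, and \<open>k = 2\<close> the quiddity row.
\<close>

type_synonym frieze = "int \<Rightarrow> nat \<Rightarrow> int"

definition infinite_frieze :: "frieze \<Rightarrow> bool" where
  "infinite_frieze F \<longleftrightarrow>
     (\<forall>i. F i 0 = 0) \<and> (\<forall>i. F i 1 = 1) \<and> (\<forall>i. \<forall>k\<ge>2. F i k > 0) \<and>
     (\<forall>i k. F i (k + 1) * F (i + 1) (k + 1) - F i (k + 2) * F (i + 1) k = 1)"

definition periodic_frieze :: "frieze \<Rightarrow> bool" where
  "periodic_frieze F \<longleftrightarrow> (\<exists>n>0. \<forall>i. F (i + n) 2 = F i 2)"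

text \<open>Quiddity sequences are taken up to cyclic rotation, which is the role of the offset \<open>t\<close>.
  The length of \<open>q\<close> is a period, not necessarily the minimal one.\<close>

definition has_quiddity :: "frieze \<Rightarrow> int list \<Rightarrow> bool" where
  "has_quiddity F q \<longleftrightarrow>
     q \<noteq> [] \<and> (\<exists>t. \<forall>i. F i 2 = q ! nat ((i + t) mod int (length q)))"

text \<open>All friezes obtained from \<open>F\<close> by a horizontal translation; accordingly, this is the frieze
  \<open>F\<close> with its quiddity sequences regarded up to rotation.\<close>

definition translates :: "frieze \<Rightarrow> frieze set" where
  "translates F = {G. \<exists>t. \<forall>i k. G i k = F (i + t) k}"

inductive reduction :: "int list \<Rightarrow> int list \<Rightarrow> bool" where
  delete: "\<lbrakk>x \<ge> 2; y \<ge> 2\<rbrakk> \<Longrightarrow> reduction (x # 1 # y # zs) ((x - 1) # (y - 1) # zs)"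
| collapse: "k \<ge> 3 \<Longrightarrow> reduction [1, k] [k - 2]"
| cyclic: "reduction p q \<Longrightarrow> reduction (rotate i p) (rotate j q)"

definition reduced_sequence :: "int list \<Rightarrow> int list \<Rightarrow> bool" where
  "reduced_sequence q s \<longleftrightarrow> reduction\<^sup>*\<^sup>* q s \<and> 1 \<notin> set s"

definition reduced_frieze :: "frieze \<Rightarrow> frieze \<Rightarrow> bool" where
  "reduced_frieze F G \<longleftrightarrow>
     infinite_frieze G \<and>
     (\<exists>q s. has_quiddity F q \<and> reduced_sequence q s \<and> has_quiddity G s)"

definition skeletal_sequence :: "int list \<Rightarrow> bool" where
  "skeletal_sequence q \<longleftrightarrow> reduced_sequence q q \<and> q \<noteq> replicate (length q) 2"

definition skeletal_frieze :: "frieze \<Rightarrow> bool" where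
  "skeletal_frieze F \<longleftrightarrow> infinite_frieze F \<and> (\<exists>q. has_quiddity F q \<and> skeletal_sequence q)"

text \<open>$C_{m,n}$ is realised as the round annulus below, with \<open>m\<close> equally spaced marked points on
  the outer circle ($B_1$) and \<open>n\<close> on the inner circle ($B_2$), both numbered counterclockwise.\<close>

definition annulus :: "complex set" where
  "annulus = {z. 1 \<le> cmod z \<and> cmod z \<le> 2}"

definition annulus_boundary :: "complex set" where
  "annulus_boundary = sphere 0 1 \<union> sphere 0 2"

definition outer_point :: "nat \<Rightarrow> nat \<Rightarrow> complex" where
  "outer_point m k = 2 * cis (2 * pi * real k / real m)"

definition inner_point :: "nat \<Rightarrow> nat \<Rightarrow> complex" where
  "inner_point n k = cis (2 * pi * real k / real n)"

definition marked_points :: "nat \<Rightarrow> nat \<Rightarrow> complex set" where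
  "marked_points m n = outer_point m ` {..<m} \<union> inner_point n ` {..<n}"

text \<open>\<^const>\<open>simple_path\<close> allows both ends to be the same marked point, so loops are included.\<close>

definition simple_curve :: "nat \<Rightarrow> nat \<Rightarrow> (real \<Rightarrow> complex) \<Rightarrow> bool" where
  "simple_curve m n g \<longleftrightarrow>
     simple_path g \<and> path_image g \<subseteq> annulus \<and>
     pathstart g \<in> marked_points m n \<and> pathfinish g \<in> marked_points m n \<and>
     g ` {0<..<1} \<inter> annulus_boundary = {}"

text \<open>The curve can be pushed into a part of the boundary containing no marked points apart from
  its endpoints.  (Without the condition on marked points, every curve between two points of the
  same boundary component would qualify.)\<close>

definition contractible_into_boundary :: "nat \<Rightarrow> nat \<Rightarrow> (real \<Rightarrow> complex) \<Rightarrow> bool" where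
  "contractible_into_boundary m n g \<longleftrightarrow>
     (\<exists>h. homotopic_paths annulus g h \<and> path_image h \<subseteq> annulus_boundary \<and>
          path_image h \<inter> marked_points m n \<subseteq> {pathstart g, pathfinish g})"

definition homotopy_class :: "(real \<Rightarrow> complex) \<Rightarrow> (real \<Rightarrow> complex) set" where
  "homotopy_class g = {h. homotopic_paths annulus g h}"

text \<open>Arcs are unoriented, so an arc is a homotopy class (relative to the endpoints) together with
  the class of the reversed curves.\<close>

definition arcs :: "nat \<Rightarrow> nat \<Rightarrow> (real \<Rightarrow> complex) set set" where
  "arcs m n = {homotopy_class g \<union> homotopy_class (reversepath g) | g.
                 simple_curve m n g \<and> \<not> contractible_into_boundary m n g}"

definition compatible ::
    "nat \<Rightarrow> nat \<Rightarrow> (real \<Rightarrow> complex) set \<Rightarrow> (real \<Rightarrow> complex) set \<Rightarrow> bool" where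
  "compatible m n \<alpha> \<beta> \<longleftrightarrow>
     (\<exists>g\<in>\<alpha>. \<exists>h\<in>\<beta>. simple_curve m n g \<and> simple_curve m n h \<and>
        g ` {0<..<1} \<inter> h ` {0<..<1} = {})"

definition triangulation :: "nat \<Rightarrow> nat \<Rightarrow> (real \<Rightarrow> complex) set set \<Rightarrow> bool" where
  "triangulation m n T \<longleftrightarrow>
     m \<ge> 1 \<and> n \<ge> 1 \<and> T \<subseteq> arcs m n \<and> pairwise (compatible m n) T \<and>
     (\<forall>T'. T \<subseteq> T' \<and> T' \<subseteq> arcs m n \<and> pairwise (compatible m n) T' \<longrightarrow> T' = T)"

definition boundary_segment :: "nat \<Rightarrow> nat \<Rightarrow> (real \<Rightarrow> complex) \<Rightarrow> bool" where
  "boundary_segment m n g \<longleftrightarrow>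
     simple_path g \<and> path_image g \<subseteq> annulus_boundary \<and>
     path_image g \<inter> marked_points m n = {pathstart g, pathfinish g}"

text \<open>The possible sides of triangles: curves representing an arc of \<open>T\<close> or a boundary segment.\<close>

definition side :: "nat \<Rightarrow> nat \<Rightarrow> (real \<Rightarrow> complex) set set \<Rightarrow> (real \<Rightarrow> complex) \<Rightarrow> bool" where
  "side m n T g \<longleftrightarrow>
     g \<in> \<Union>T \<or> (\<exists>h. boundary_segment m n h \<and> homotopic_paths annulus g h)"

text \<open>
  A triangle is bounded by three sides which together form a null-homotopic loop; conversely,
  three such sides bound a triangle, because in the universal cover (a strip whose marked points
  all lie on its boundary) no other arc of \<open>T\<close> can enter the region they enclose.  A corner of a
  triangle at \<open>p\<close> is given by the unordered pair of the two sides (as oriented homotopy classes)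
  leaving \<open>p\<close>, the third side being the class of \<open>reversepath g +++ h\<close>.  Counting corners counts
  the triangles incident to \<open>p\<close> with multiplicity: a triangle having several of its vertices at
  \<open>p\<close> counts once for each of them.  For instance the unique triangulation type of $C_{1,1}$,
  consisting of two arcs and two triangles, has quiddity sequence (3) on each component.
\<close>

definition corners ::
    "nat \<Rightarrow> nat \<Rightarrow> (real \<Rightarrow> complex) set set \<Rightarrow> complex \<Rightarrow> (real \<Rightarrow> complex) set set set" where
  "corners m n T p =
     {{homotopy_class g, homotopy_class h} | g h.
        side m n T g \<and> side m n T h \<and> pathstart g = p \<and> pathstart h = p \<and>
        side m n T (reversepath g +++ h)}"

definition outer_quiddity :: "nat \<Rightarrow> nat \<Rightarrow> (real \<Rightarrow> complex) set set \<Rightarrow> int list" where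
  "outer_quiddity m n T = map (\<lambda>k. int (card (corners m n T (outer_point m k)))) [0..<m]"

definition inner_quiddity :: "nat \<Rightarrow> nat \<Rightarrow> (real \<Rightarrow> complex) set set \<Rightarrow> int list" where
  "inner_quiddity m n T = map (\<lambda>k. int (card (corners m n T (inner_point n k)))) [0..<n]"

definition annulus_pair :: "frieze \<Rightarrow> frieze \<Rightarrow> bool" where
  "annulus_pair F G \<longleftrightarrow>
     infinite_frieze F \<and> infinite_frieze G \<and>
     (\<exists>m n T. triangulation m n T \<and>
        has_quiddity F (outer_quiddity m n T) \<and> has_quiddity G (inner_quiddity m n T))"

end

theory Submission
  imports Defs
begin

text \<open>
  The annulus is lifted by the exponential to a strip, where a homotopy class of curves between marked
  points is a pair of vertices up to deck translations and where two classes have disjoint simple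
  representatives iff no two of their lifts interlace.  Triangulations of the annulus thus become
  maximal periodic noncrossing relations on the vertices of the strip, and quiddities become vertex
  degrees.

  If all quiddities are at least 2, no arc has both ends on one component, because a shortest one would
  cut off a vertex of quiddity at most 1.  The triangulation is then a zigzag in which the outer vertex
  \<open>i\<close> is joined to the inner vertices \<open>L i, \<dots>, L (i + 1)\<close> with \<open>L (i + 1) - L i = a\<^sub>i - 2\<close>, so it is
  determined by the outer quiddities up to translation, and it exists for all of them.  Gluing ears to
  the inner component changes only the inner quiddities and makes one of them arbitrarily large.
\<close>

text \<open>Counting triangles only yields a quiddity row, whereas every entry of an infinite frieze
  must be positive. Positivity is certified by a \<open>supersolution\<close>, a positive function x
  with x (j - 1) + x (j + 1) \<le> b j * x j: the constant 1 serves when all quiddities are at least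
  2, and an ear extends x by giving its new vertex the sum of the values at the two neighbours.

  The number of inner marked points is the sum of a_i - 2 over an outer period; some a_i exceeding 2
  is exactly what makes it positive.

  The passage to the strip has two unequal halves. Interlacing chords meet whatever curves represent
  them, which is Fashoda's theorem. Chords that do not interlace are made disjoint by explicit
  curves; only two classes have to be separated at a time, so the shape of the curves may depend on
  the pair.

  The family in (2) is counted up to translation. A periodic frieze has finitely many quiddity
  values, so finitely many translation classes would bound them all; it is enough to make one
  quiddity arbitrarily large.\<close>

section \<open>Chords of the strip\<close>

text \<open>
  The marked points of the universal cover of the annulus, a strip.  The order \<open>\<lhd>\<close> is that of the
  boundary of the strip seen as a half-plane, so the outer indices run backwards, and two chords cross
  iff their ends interlace.
\<close>

datatype vertex = Outer int | Inner int

fun precedes :: "vertex \<Rightarrow> vertex \<Rightarrow> bool" (infix "\<lhd>" 50) where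
  "Outer i \<lhd> Outer j \<longleftrightarrow> j < i"
| "Outer i \<lhd> Inner j \<longleftrightarrow> True"
| "Inner i \<lhd> Outer j \<longleftrightarrow> False"
| "Inner i \<lhd> Inner j \<longleftrightarrow> i < j"

definition between :: "vertex \<Rightarrow> vertex \<Rightarrow> vertex \<Rightarrow> bool" where
  "between u v x \<longleftrightarrow> u \<lhd> x \<and> x \<lhd> v \<or> v \<lhd> x \<and> x \<lhd> u"

definition beyond :: "vertex \<Rightarrow> vertex \<Rightarrow> vertex \<Rightarrow> bool" where
  "beyond u v x \<longleftrightarrow> x \<lhd> u \<and> x \<lhd> v \<or> u \<lhd> x \<and> v \<lhd> x"

text \<open>All comparisons are strict, so chords with a common end do not cross and no chord
  crosses itself.\<close>

definition crosses :: "vertex \<Rightarrow> vertex \<Rightarrow> vertex \<Rightarrow> vertex \<Rightarrow> bool" where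
  "crosses u v x y \<longleftrightarrow> between u v x \<and> beyond u v y \<or> beyond u v x \<and> between u v y"

lemmas crosses_defs = crosses_def between_def beyond_def

lemma precedes_irrefl: "\<not> u \<lhd> u"
  by (cases u) auto

lemma precedes_trans: "u \<lhd> v \<Longrightarrow> v \<lhd> w \<Longrightarrow> u \<lhd> w"
  by (cases u; cases v; cases w) auto

lemma crosses_commute: "crosses u v x y \<longleftrightarrow> crosses v u x y" "crosses u v x y \<longleftrightarrow> crosses u v y x"
  unfolding crosses_defs by blast+

lemma crosses_sym: "crosses u v x y \<Longrightarrow> crosses x y u v"
  unfolding crosses_defs by (blast intro: precedes_trans)

fun neighbours :: "vertex \<Rightarrow> vertex \<Rightarrow> bool" where
  "neighbours (Outer i) (Outer j) \<longleftrightarrow> \<bar>i - j\<bar> = 1"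
| "neighbours (Inner i) (Inner j) \<longleftrightarrow> \<bar>i - j\<bar> = 1"
| "neighbours _ _ \<longleftrightarrow> False"

text \<open>The upper bounds are what simplicity in the annulus demands of a chord of the strip: a longer one
  crosses its own translates.\<close>

fun chord :: "nat \<Rightarrow> nat \<Rightarrow> vertex \<Rightarrow> vertex \<Rightarrow> bool" where
  "chord m n (Outer i) (Outer j) \<longleftrightarrow> 2 \<le> \<bar>i - j\<bar> \<and> \<bar>i - j\<bar> \<le> int m"
| "chord m n (Inner i) (Inner j) \<longleftrightarrow> 2 \<le> \<bar>i - j\<bar> \<and> \<bar>i - j\<bar> \<le> int n"
| "chord m n _ _ \<longleftrightarrow> True"

section \<open>Triangulations of the strip and their symmetries\<close>

fun shift :: "nat \<Rightarrow> nat \<Rightarrow> int \<Rightarrow> vertex \<Rightarrow> vertex" where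
  "shift m n k (Outer i) = Outer (i + k * int m)"
| "shift m n k (Inner j) = Inner (j + k * int n)"

fun flip :: "vertex \<Rightarrow> vertex" where
  "flip (Outer i) = Inner i"
| "flip (Inner i) = Outer i"

text \<open>Maximality is asked of one chord at a time. This agrees with maximality of arc sets
  because a chord never crosses its own translates, so its whole orbit can be added at once.\<close>

definition cover_triangulation :: "nat \<Rightarrow> nat \<Rightarrow> (vertex \<Rightarrow> vertex \<Rightarrow> bool) \<Rightarrow> bool" where
  "cover_triangulation m n E \<longleftrightarrow> m > 0 \<and> n > 0 \<and> (\<forall>u v. E u v \<longrightarrow> E v u) \<and>
     (\<forall>u v k. E u v \<longrightarrow> E (shift m n k u) (shift m n k v)) \<and>
     (\<forall>u v. E u v \<longrightarrow> chord m n u v) \<and>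
     (\<forall>u v x y. E u v \<and> E x y \<longrightarrow> \<not> crosses u v x y) \<and>
     (\<forall>u v. chord m n u v \<and> (\<forall>x y. E x y \<longrightarrow> \<not> crosses u v x y) \<longrightarrow> E u v)"

definition sides :: "(vertex \<Rightarrow> vertex \<Rightarrow> bool) \<Rightarrow> vertex \<Rightarrow> vertex \<Rightarrow> bool" where
  "sides E u v \<longleftrightarrow> E u v \<or> neighbours u v"

text \<open>A corner at \<open>u\<close> is recorded by the ends of the side opposite to
  \<open>u\<close>. In the strip these tell corners apart even when their images in the annulus have
  the same vertices.\<close>

definition corner_pairs :: "(vertex \<Rightarrow> vertex \<Rightarrow> bool) \<Rightarrow> vertex \<Rightarrow> vertex set set" where
  "corner_pairs E u = {{x, y} | x y. sides E u x \<and> sides E u y \<and> sides E x y}"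

definition valency :: "(vertex \<Rightarrow> vertex \<Rightarrow> bool) \<Rightarrow> vertex \<Rightarrow> nat" where
  "valency E u = card (corner_pairs E u)"

lemma flip_flip [simp]: "flip (flip u) = u"
  by (cases u) auto

lemma flip_precedes: "flip u \<lhd> flip v \<longleftrightarrow> v \<lhd> u"
  by (cases u; cases v) auto

lemma flip_crosses: "crosses (flip u) (flip v) (flip x) (flip y) \<longleftrightarrow> crosses u v x y"
  unfolding crosses_defs flip_precedes by blast

lemma flip_neighbours: "neighbours (flip u) (flip v) \<longleftrightarrow> neighbours u v"
  by (cases u; cases v) auto

lemma flip_chord: "chord m n (flip u) (flip v) \<longleftrightarrow> chord n m u v"
  by (cases u; cases v) auto

lemma flip_shift: "shift m n k (flip u) = flip (shift n m k u)"
  by (cases u) auto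

lemma cover_triangulationD:
  assumes "cover_triangulation m n E"
  shows "m > 0" "n > 0" "\<And>u v. E u v \<Longrightarrow> E v u"
    "\<And>u v k. E u v \<Longrightarrow> E (shift m n k u) (shift m n k v)"
    "\<And>u v. E u v \<Longrightarrow> chord m n u v"
    "\<And>u v x y. E u v \<Longrightarrow> E x y \<Longrightarrow> \<not> crosses u v x y"
    "\<And>u v. chord m n u v \<Longrightarrow> (\<And>x y. E x y \<Longrightarrow> \<not> crosses u v x y) \<Longrightarrow> E u v"
  using assms unfolding cover_triangulation_def by blast+

lemma cover_triangulationI:
  assumes "m > 0" "n > 0" "\<And>u v. E u v \<Longrightarrow> E v u"
    "\<And>u v k. E u v \<Longrightarrow> E (shift m n k u) (shift m n k v)"
    "\<And>u v. E u v \<Longrightarrow> chord m n u v"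
    "\<And>u v x y. E u v \<Longrightarrow> E x y \<Longrightarrow> \<not> crosses u v x y"
    "\<And>u v. chord m n u v \<Longrightarrow> (\<And>x y. E x y \<Longrightarrow> \<not> crosses u v x y) \<Longrightarrow> E u v"
  shows "cover_triangulation m n E"
  unfolding cover_triangulation_def
proof (intro conjI allI impI; (elim conjE)?)
  show "E u v" if "chord m n u v" "\<forall>x y. E x y \<longrightarrow> \<not> crosses u v x y" for u v
    using that by (intro assms(7)) blast+
qed (fact assms | erule assms | erule (1) assms)+

text \<open>Exchanging the two components reverses \<open>\<lhd>\<close>, and interlacing is
  insensitive to that. Facts about outer vertices thereby transfer to inner ones.\<close>

lemma cover_triangulation_flip:
  assumes "cover_triangulation m n E"
  shows "cover_triangulation n m (\<lambda>u v. E (flip u) (flip v))"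
proof (rule cover_triangulationI)
  note ct = cover_triangulationD[OF assms]
  show "n > 0" "m > 0" by fact+
  show "E (flip v) (flip u)" if "E (flip u) (flip v)" for u v
    using ct(3) that .
  show "E (flip (shift n m k u)) (flip (shift n m k v))" if "E (flip u) (flip v)" for u v k
    using ct(4)[OF that] by (simp add: flip_shift)
  show "chord n m u v" if "E (flip u) (flip v)" for u v
    using ct(5)[OF that] by (simp add: flip_chord)
  show "\<not> crosses u v x y" if "E (flip u) (flip v)" "E (flip x) (flip y)" for u v x y
    using ct(6)[OF that] by (simp add: flip_crosses)
  show "E (flip u) (flip v)"
    if "chord n m u v" and nc: "\<And>x y. E (flip x) (flip y) \<Longrightarrow> \<not> crosses u v x y" for u v
  proof (rule ct(7))
    show "chord m n (flip u) (flip v)"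
      by (simp add: flip_chord that)
    show "\<not> crosses (flip u) (flip v) x y" if "E x y" for x y
      using nc[of "flip x" "flip y"] that flip_crosses[of u v "flip x" "flip y"] by simp
  qed
qed

lemma valency_bij:
  assumes "bij \<pi>" and nb: "\<And>u v. neighbours (\<pi> u) (\<pi> v) \<longleftrightarrow> neighbours u v"
  shows "valency (\<lambda>u v. E (\<pi> u) (\<pi> v)) u = valency E (\<pi> u)"
proof -
  let ?E = "\<lambda>u v. E (\<pi> u) (\<pi> v)"
  have sides: "sides ?E u v \<longleftrightarrow> sides E (\<pi> u) (\<pi> v)" for u v
    by (simp add: sides_def nb)
  have "(`) \<pi> ` corner_pairs ?E u = corner_pairs E (\<pi> u)"
  proof (intro set_eqI iffI)
    fix C assume "C \<in> (`) \<pi> ` corner_pairs ?E u"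
    then obtain d where "d \<in> corner_pairs ?E u" "C = \<pi> ` d" by (elim imageE)
    then show "C \<in> corner_pairs E (\<pi> u)"
      unfolding corner_pairs_def sides by auto
  next
    fix C assume "C \<in> corner_pairs E (\<pi> u)"
    then obtain x' y' where C: "C = {x', y'}" "sides E (\<pi> u) x'" "sides E (\<pi> u) y'" "sides E x' y'"
      unfolding corner_pairs_def by auto
    obtain x y where "x' = \<pi> x" "y' = \<pi> y"
      using bij_is_surj[OF assms(1)] by (metis surjD)
    then show "C \<in> (`) \<pi> ` corner_pairs ?E u"
      using C unfolding corner_pairs_def sides by (intro image_eqI[of _ _ "{x, y}"]) auto
  qed
  moreover have "inj_on ((`) \<pi>) (corner_pairs ?E u)"
    using bij_is_inj[OF assms(1)] by (intro inj_on_image) (metis inj_on_subset subset_UNIV)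
  ultimately show ?thesis
    unfolding valency_def by (metis card_image)
qed

lemma valency_flip: "valency (\<lambda>u v. E (flip u) (flip v)) u = valency E (flip u)"
  by (intro valency_bij flip_neighbours involuntory_imp_bij flip_flip)

fun translate :: "int \<Rightarrow> int \<Rightarrow> vertex \<Rightarrow> vertex" where
  "translate s t (Outer i) = Outer (i + s)"
| "translate s t (Inner j) = Inner (j + t)"

lemma valency_translate:
  "valency (\<lambda>u v. E (translate s t u) (translate s t v)) u = valency E (translate s t u)"
proof (rule valency_bij)
  have "translate s t (translate (- s) (- t) u) = u" "translate (- s) (- t) (translate s t u) = u" for u
    by (cases u; simp)+
  then show "bij (translate s t)"
    by (intro o_bij[of "translate (- s) (- t)"]) (simp_all add: fun_eq_iff)
  show "neighbours (translate s t u) (translate s t v) \<longleftrightarrow> neighbours u v" for u v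
    by (cases u; cases v) auto
qed

lemma shift_eq_translate: "shift m n k = translate (k * int m) (k * int n)"
proof
  show "shift m n k u = translate (k * int m) (k * int n) u" for u by (cases u) simp_all
qed

lemma cover_triangulation_valency_shift:
  assumes "cover_triangulation m n E"
  shows "valency E (shift m n k u) = valency E u"
proof -
  have "shift m n (- k) (shift m n k u) = u" for u by (cases u) simp_all
  then have "E (shift m n k u) (shift m n k v) \<longleftrightarrow> E u v" for u v
    using cover_triangulationD(4)[OF assms] by metis
  then have "(\<lambda>u v. E (translate (k * int m) (k * int n) u) (translate (k * int m) (k * int n) v)) = E"
    unfolding shift_eq_translate by (intro ext)
  then show ?thesis
    using valency_translate[of E "k * int m" "k * int n" u] by (simp add: shift_eq_translate)
qed

section \<open>Zigzag triangulations\<close>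

fun zigzag :: "(int \<Rightarrow> int) \<Rightarrow> vertex \<Rightarrow> vertex \<Rightarrow> bool" where
  "zigzag L (Outer i) (Inner j) \<longleftrightarrow> L i \<le> j \<and> j \<le> L (i + 1)"
| "zigzag L (Inner j) (Outer i) \<longleftrightarrow> L i \<le> j \<and> j \<le> L (i + 1)"
| "zigzag L _ _ \<longleftrightarrow> False"

lemma neighbours_Outer: "neighbours (Outer i) v \<longleftrightarrow> v = Outer (i - 1) \<or> v = Outer (i + 1)"
  by (cases v) auto

lemma neighbours_Inner: "neighbours (Inner i) v \<longleftrightarrow> v = Inner (i - 1) \<or> v = Inner (i + 1)"
  by (cases v) auto

lemma neighbours_sym: "neighbours u v \<longleftrightarrow> neighbours v u"
  by (cases u; cases v) auto

text \<open>A shortest outer chord would cut off a vertex with at most one corner.\<close>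

lemma no_outer_chord:
  assumes "cover_triangulation m n E" and val: "\<And>i. valency E (Outer i) \<ge> 2"
  shows "\<not> E (Outer i) (Outer j)"
proof
  assume "E (Outer i) (Outer j)"
  define P where "P d \<longleftrightarrow> (\<exists>i j. E (Outer i) (Outer j) \<and> j - i = int d)" for d
  note sym = cover_triangulationD(3)[OF assms(1)] and chord = cover_triangulationD(5)[OF assms(1)] and ncross = cover_triangulationD(6)[OF assms(1)]
  have "\<exists>d. P d"
  proof (cases "i \<le> j")
    case True
    then show ?thesis
      unfolding P_def using \<open>E (Outer i) (Outer j)\<close> by (intro exI[of _ "nat (j - i)"]) force
  next
    case False
    then show ?thesis
      unfolding P_def using sym[OF \<open>E (Outer i) (Outer j)\<close>] by (intro exI[of _ "nat (i - j)"]) force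
  qed
  then have "P (LEAST d. P d)" by (rule LeastI_ex)
  then obtain a b where ab: "E (Outer a) (Outer b)" "b - a = int (LEAST d. P d)"
    unfolding P_def by blast
  have min: "b - a \<le> \<bar>y - x\<bar>" if "E (Outer x) (Outer y)" for x y
  proof -
    have "P (nat \<bar>y - x\<bar>)"
      unfolding P_def using that sym[OF that]
      by (cases "x \<le> y") (force intro: exI[of _ x] exI[of _ y])+
    then have "(LEAST d. P d) \<le> nat \<bar>y - x\<bar>" by (rule Least_le)
    then show ?thesis using ab by linarith
  qed
  have "b - a \<ge> 2"
    using chord[OF ab(1)] ab(2) by auto
  let ?u = "Outer (a + 1)"
  \<comment> \<open>A chord at \<open>?u\<close> cannot leave the region cut off by the chord from
    \<open>a\<close> to \<open>b\<close>; it would be an outer chord shorter than the shortest one.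
    Only the two boundary neighbours of \<open>?u\<close> remain.\<close>
  have nbr: "v = Outer a \<or> v = Outer (a + 2)" if "sides E ?u v" for v
  proof (cases "neighbours ?u v")
    case True
    then show ?thesis by (auto simp: neighbours_Outer)
  next
    case False
    then have E: "E ?u v" using that by (simp add: sides_def)
    have nc: "\<not> crosses (Outer a) (Outer b) ?u v"
      using ncross ab(1) E by blast
    show ?thesis
    proof (cases v)
      case (Outer y)
      have "a \<le> y" "y \<le> b"
        using nc \<open>b - a \<ge> 2\<close> Outer by (auto simp: crosses_defs)
      moreover have "b - a \<le> \<bar>y - (a + 1)\<bar>"
        using min E Outer by blast
      moreover have "\<bar>y - (a + 1)\<bar> \<ge> 2"
        using chord[OF E] Outer by auto
      ultimately show ?thesis using Outer by auto
    next
      case (Inner y)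
      then show ?thesis using nc \<open>b - a \<ge> 2\<close> by (auto simp: crosses_defs)
    qed
  qed
  have "\<not> sides E v v" for v
    using chord[of v v] by (cases v) (auto simp: sides_def)
  then have "corner_pairs E ?u \<subseteq> {{Outer a, Outer (a + 2)}}"
    unfolding corner_pairs_def using nbr by (auto simp: insert_commute)
  then have "valency E ?u \<le> 1"
    unfolding valency_def by (metis card.empty card_insert_disjoint card_mono empty_iff finite.emptyI finite.insertI One_nat_def)
  then show False using val[of "a + 1"] by simp
qed

text \<open>Without peripheral chords everything is encoded in the sets \<open>S i\<close> of inner
  vertices joined to \<open>Outer i\<close>. Non-crossing orders these sets along i, and maximality
  makes each of them the full interval between consecutive minima.\<close>

lemma cover_triangulation_imp_zigzag:
  assumes ct: "cover_triangulation m n E" and val: "\<And>u. valency E u \<ge> 2"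
  obtains L where "\<And>i. L i \<le> L (i + 1)" "E = zigzag L"
proof -
  note sym = cover_triangulationD(3)[OF ct] and chord = cover_triangulationD(5)[OF ct] and ncross = cover_triangulationD(6)[OF ct] and max = cover_triangulationD(7)[OF ct]
  have noO: "\<not> E (Outer i) (Outer j)" for i j
    using no_outer_chord ct val by blast
  have noI: "\<not> E (Inner i) (Inner j)" for i j
    using no_outer_chord[OF cover_triangulation_flip[OF ct], of i j] val by (simp add: valency_flip)
  define S where "S i = {j. E (Outer i) (Inner j)}" for i
  \<comment> \<open>Otherwise the only sides at \<open>Outer i\<close> are its two boundary
    segments, whose far ends are joined by no side, and there is no corner.\<close>
  have ne: "S i \<noteq> {}" for i
  proof
    assume "S i = {}"
    then have *: "v = Outer (i - 1) \<or> v = Outer (i + 1)" if "sides E (Outer i) v" for v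
      using that noO unfolding S_def sides_def by (cases v) (auto simp: neighbours_Outer)
    have "\<not> sides E x y" if "sides E (Outer i) x" "sides E (Outer i) y" for x y
      using *[OF that(1)] *[OF that(2)] noO by (elim disjE) (simp_all add: sides_def)
    then have "corner_pairs E (Outer i) = {}"
      unfolding corner_pairs_def by blast
    then show False using val[of "Outer i"] by (simp add: valency_def)
  qed
  have mono: "j \<le> j'" if "j \<in> S i" "j' \<in> S i'" "i < i'" for i i' j j'
    using ncross[of "Outer i" "Inner j" "Outer i'" "Inner j'"] that
    by (auto simp: S_def crosses_defs)
  define L where "L i = (LEAST j. j \<in> S i)" for i
  \<comment> \<open>Any element \<open>a\<close> of \<open>S (i - 1)\<close> is a lower bound, so
    counting upwards from \<open>a\<close> in \<open>nat\<close> shows that the minimum in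
    \<open>int\<close> is attained.\<close>
  have least: "L i \<in> S i \<and> (\<forall>j\<in>S i. L i \<le> j)" for i
  proof -
    obtain a b where "a \<in> S (i - 1)" "b \<in> S i" using ne by blast
    define d where "d = (LEAST d. a + int d \<in> S i)"
    have "a \<le> j" if "j \<in> S i" for j using mono[OF \<open>a \<in> S (i - 1)\<close> that] by simp
    then have ex: "\<exists>d. j = a + int d" if "j \<in> S i" for j
      using that zle_iff_zadd by blast
    then have "a + int d \<in> S i"
      unfolding d_def using \<open>b \<in> S i\<close> by (metis (mono_tags, lifting) LeastI)
    moreover have "a + int d \<le> j" if j: "j \<in> S i" for j
    proof -
      obtain e where "j = a + int e" using ex j by blast
      then show ?thesis using j Least_le[of "\<lambda>d. a + int d \<in> S i" e] by (simp add: d_def)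
    qed
    ultimately have "L i = a + int d"
      unfolding L_def by (intro Least_equality) auto
    then show ?thesis using \<open>a + int d \<in> S i\<close> \<open>\<And>j. j \<in> S i \<Longrightarrow> a + int d \<le> j\<close> by auto
  qed
  have step: "L i \<le> L (i + 1)" for i
    using mono[of "L i" i "L (i + 1)" "i + 1"] least by auto
  \<comment> \<open>Maximality applies: chords at \<open>Outer i\<close> share an end with the new
    one, and those at other outer vertices end on the appropriate side of \<open>j\<close> by
    \<open>mono\<close>.\<close>
  have "E (Outer i) (Inner j)" if j: "L i \<le> j" "j \<le> L (i + 1)" for i j
  proof (rule max)
    show "\<not> crosses (Outer i) (Inner j) x y" if "E x y" for x y
    proof -
      have "\<not> crosses (Outer i) (Inner j) (Outer i') (Inner j')" if "E (Outer i') (Inner j')" for i' j'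
      proof -
        consider "i' < i" | "i' = i" | "i' = i + 1" | "i + 1 < i'" by linarith
        then have "i' < i \<and> j' \<le> j \<or> i' = i \<or> i' > i \<and> j' \<ge> j"
          using that mono[of j' i' "L i" i] mono[of "L (i + 1)" "i + 1" j' i'] least j
          by cases (force simp: S_def)+
        then show ?thesis by (auto simp: crosses_defs)
      qed
      moreover have "\<not> crosses (Outer i) (Inner j) (Inner j') (Outer i')" if "E (Inner j') (Outer i')" for i' j'
        using calculation[OF sym[OF that]] by (simp add: crosses_commute)
      ultimately show ?thesis
        using that noO noI by (cases x; cases y) simp_all
    qed
  qed simp
  \<comment> \<open>The upper bound compares \<open>j\<close> with one particular chord at the next
    outer vertex, the one ending in \<open>L (i + 1)\<close>.\<close>
  moreover have "L i \<le> j \<and> j \<le> L (i + 1)" if "E (Outer i) (Inner j)" for i j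
    using least mono[of j i "L (i + 1)" "i + 1"] that by (auto simp: S_def)
  ultimately have OI: "E (Outer i) (Inner j) \<longleftrightarrow> L i \<le> j \<and> j \<le> L (i + 1)" for i j
    by blast
  moreover have "E (Inner j) (Outer i) \<longleftrightarrow> L i \<le> j \<and> j \<le> L (i + 1)" for i j
    using OI sym by metis
  ultimately have "E u v \<longleftrightarrow> zigzag L u v" for u v
    using noO noI by (cases u; cases v) simp_all
  then have "E = zigzag L" by (intro ext)
  with step show ?thesis by (rule that)
qed

lemma mono_int_stepI:
  fixes L :: "int \<Rightarrow> int"
  assumes "\<And>i. L i \<le> L (i + 1)"
  shows "mono L"
proof
  fix i j :: int assume "i \<le> j"
  then show "L i \<le> L j"
  proof (induction j rule: int_ge_induct)
    case (step k)
    then show ?case using assms[of k] by linarith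
  qed simp
qed

text \<open>Assumption \<open>ex\<close> says that the intervals from \<open>L i\<close> to
  \<open>L (i + 1)\<close> exhaust the inner vertices. Every vertex of either side then carries a
  bridge, and these bridges block all peripheral chords.\<close>

lemma cover_triangulation_zigzag:
  assumes "m > 0" "n > 0" and step: "\<And>i. L i \<le> L (i + 1)"
    and per: "\<And>i. L (i + int m) = L i + int n"
    and ex: "\<And>j. \<exists>i. L i \<le> j \<and> j \<le> L (i + 1)"
  shows "cover_triangulation m n (zigzag L)"
proof (rule cover_triangulationI)
  have mono: "L i \<le> L j" if "i \<le> j" for i j
    using mono_int_stepI[of L] step that by (simp add: mono_def)
  have perk: "L (i + k * int m) = L i + k * int n" for i k
  proof (induction k rule: int_induct[where k = 0])
    case (step1 k)
    then show ?case using per[of "i + k * int m"] by (simp add: algebra_simps)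
  next
    case (step2 k)
    then show ?case using per[of "i + (k - 1) * int m"] by (simp add: algebra_simps)
  qed auto
  show "m > 0" "n > 0" by fact+
  show "zigzag L v u" if "zigzag L u v" for u v
    using that by (cases u; cases v) auto
  show "zigzag L (shift m n k u) (shift m n k v)" if "zigzag L u v" for u v k
  proof -
    have "L (i + k * int m + 1) = L (i + 1) + k * int n" for i
      using perk[of "i + 1" k] by (simp add: add.assoc add.commute)
    then show ?thesis
      using that by (cases u; cases v) (auto simp: perk)
  qed
  show "chord m n u v" if "zigzag L u v" for u v
    using that by (cases u; cases v) auto
  show "\<not> crosses u v x y" if "zigzag L u v" "zigzag L x y" for u v x y
  proof -
    have *: "\<not> crosses (Outer i) (Inner j) (Outer i') (Inner j')"
      if "L i \<le> j" "j \<le> L (i + 1)" "L i' \<le> j'" "j' \<le> L (i' + 1)" for i j i' j'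
      using that mono[of "i + 1" i'] mono[of "i' + 1" i]
      by (cases i i' rule: linorder_cases) (auto simp: crosses_defs)
    have ends: "\<exists>i j. (u = Outer i \<and> v = Inner j \<or> u = Inner j \<and> v = Outer i) \<and> L i \<le> j \<and> j \<le> L (i + 1)"
      if "zigzag L u v" for u v
      using that by (cases u; cases v) simp_all
    obtain i j where ij: "u = Outer i \<and> v = Inner j \<or> u = Inner j \<and> v = Outer i" "L i \<le> j" "j \<le> L (i + 1)"
      using ends[OF \<open>zigzag L u v\<close>] by blast
    obtain i' j' where ij': "x = Outer i' \<and> y = Inner j' \<or> x = Inner j' \<and> y = Outer i'" "L i' \<le> j'" "j' \<le> L (i' + 1)"
      using ends[OF \<open>zigzag L x y\<close>] by blast
    show ?thesis
      using ij(1) ij'(1) *[OF ij(2,3) ij'(2,3)] by (metis crosses_commute)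
  qed
  show "zigzag L u v" if c: "chord m n u v" and nc: "\<And>x y. zigzag L x y \<Longrightarrow> \<not> crosses u v x y" for u v
  proof -
    have O: "\<not> crosses u v (Outer i) (Inner (L i))" "\<not> crosses u v (Outer i) (Inner (L (i + 1)))" for i
      using nc step by auto
    \<comment> \<open>A bridge is squeezed between the last chord at \<open>Outer (i - 1)\<close>
      and the first chord at \<open>Outer (i + 1)\<close>.\<close>
    have brd: "L i \<le> j \<and> j \<le> L (i + 1)"
      if "{u, v} = {Outer i, Inner j}" for i j
    proof -
      have "\<not> crosses (Outer i) (Inner j) (Outer (i - 1)) (Inner (L i))"
        "\<not> crosses (Outer i) (Inner j) (Outer (i + 1)) (Inner (L (i + 1)))"
        using O(2)[of "i - 1"] O(1)[of "i + 1"] that crosses_commute(1)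
        by (auto simp: doubleton_eq_iff)
      then show ?thesis by (auto simp: crosses_defs)
    qed
    show ?thesis
    proof (cases u; cases v)
      fix i j assume uv: "u = Outer i" "v = Outer j"
      \<comment> \<open>Either \<open>Outer (i + 1)\<close> or \<open>Outer (j + 1)\<close> lies
        strictly between the ends, and the bridge leaving it crosses the chord.\<close>
      have "i + 2 \<le> j \<or> j + 2 \<le> i" using c uv by auto
      then show ?thesis
        using O(1)[of "i + 1"] O(1)[of "j + 1"] uv by (auto simp: crosses_defs)
    next
      fix i j assume uv: "u = Inner i" "v = Inner j"
      have *: "\<not> crosses u v (Inner a) (Outer (SOME i. L i \<le> a \<and> a \<le> L (i + 1)))" for a
        using nc someI_ex[OF ex[of a]] by simp
      have "i + 2 \<le> j \<or> j + 2 \<le> i" using c uv by auto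
      then show ?thesis
        using *[of "i + 1"] *[of "j + 1"] uv by (auto simp: crosses_defs)
    qed (use brd in auto)
  qed
qed

text \<open>The triangles at \<open>Outer i\<close> stand on the two outer segments beside it
  (\<open>?A\<close>) and on each inner segment from \<open>L i\<close> to \<open>L (i + 1)\<close>
  (\<open>?f\<close>).\<close>

lemma valency_zigzag_Outer:
  assumes step: "\<And>i. L i \<le> L (i + 1)"
  shows "int (valency (zigzag L) (Outer i)) = 2 + L (i + 1) - L i"
proof -
  have mono: "L i \<le> L j" if "i \<le> j" for i j
    using mono_int_stepI[of L] step that by (simp add: mono_def)
  let ?A = "{{Outer (i - 1), Inner (L i)}, {Outer (i + 1), Inner (L (i + 1))}}"
  let ?f = "\<lambda>j. {Inner j, Inner (j + 1)}"
  have "corner_pairs (zigzag L) (Outer i) = ?A \<union> ?f ` {L i..<L (i + 1)}" (is "_ = ?R")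
  proof
    have "{x, y} \<in> ?R" if "sides (zigzag L) (Outer i) x" "sides (zigzag L) (Outer i) y"
      "sides (zigzag L) x y" for x y
    proof -
      have two: "L i = j \<and> a = Outer (i - 1) \<or> L (i + 1) = j \<and> a = Outer (i + 1)"
        if "a = Outer (i - 1) \<or> a = Outer (i + 1)" "L i \<le> j" "j \<le> L (i + 1)" "zigzag L a (Inner j)" for a j
        using that by auto
      show ?thesis
      proof (cases x; cases y)
        fix a b assume "x = Outer a" "y = Outer b"
        then show ?thesis using that by (auto simp: sides_def)
      next
        fix a j assume "x = Outer a" "y = Inner j"
        then show ?thesis using that two[of x j] by (auto simp: sides_def neighbours_Outer)
      next
        fix a j assume "x = Inner j" "y = Outer a"
        then show ?thesis using that two[of y j] by (auto simp: sides_def neighbours_Outer insert_commute)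
      next
        fix a j assume "x = Inner a" "y = Inner j"
        then have "j = a + 1 \<or> a = j + 1" "L i \<le> a" "a \<le> L (i + 1)" "L i \<le> j" "j \<le> L (i + 1)"
          using that by (auto simp: sides_def)
        then show ?thesis
          using \<open>x = Inner a\<close> \<open>y = Inner j\<close>
          by (auto simp: insert_commute)
      qed
    qed
    then show "corner_pairs (zigzag L) (Outer i) \<subseteq> ?R"
      unfolding corner_pairs_def by blast
    have "{Outer (i - 1), Inner (L i)} \<in> corner_pairs (zigzag L) (Outer i)"
      unfolding corner_pairs_def using step[of i] step[of "i - 1"]
      by (intro CollectI exI conjI) (auto simp: sides_def)
    moreover have "{Outer (i + 1), Inner (L (i + 1))} \<in> corner_pairs (zigzag L) (Outer i)"
      unfolding corner_pairs_def using step[of i] step[of "i + 1"]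
      by (intro CollectI exI conjI) (auto simp: sides_def)
    moreover have "?f j \<in> corner_pairs (zigzag L) (Outer i)" if "j \<in> {L i..<L (i + 1)}" for j
      unfolding corner_pairs_def using that
      by (intro CollectI exI conjI) (auto simp: sides_def)
    ultimately show "?R \<subseteq> corner_pairs (zigzag L) (Outer i)"
      by auto
  qed
  moreover have "card (?A \<union> ?f ` {L i..<L (i + 1)}) = card ?A + card (?f ` {L i..<L (i + 1)})"
    by (intro card_Un_disjoint) (auto simp: doubleton_eq_iff)
  moreover have "card ?A = 2"
    by (simp add: doubleton_eq_iff)
  moreover have "card (?f ` {L i..<L (i + 1)}) = nat (L (i + 1) - L i)"
    by (subst card_image) (auto simp: inj_on_def doubleton_eq_iff)
  ultimately show ?thesis
    using step[of i] by (simp add: valency_def)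
qed

text \<open>Here \<open>L' j\<close> is the largest i with \<open>L i < j\<close>, a generalised
  inverse of \<open>L\<close>. The strict inequality gives both
  \<open>i \<le> L' (j + 1) \<longleftrightarrow> L i \<le> j\<close> and
  \<open>L' j \<le> i \<longleftrightarrow> j \<le> L (i + 1)\<close>, which turn the two zigzag
  conditions into each other. Inner valencies are computed this way from the outer formula.\<close>

lemma zigzag_dual:
  assumes step: "\<And>i. L i \<le> L (i + 1)"
    and lo: "\<And>j. \<exists>i. L i < j" and hi: "\<And>j. \<exists>i. j \<le> L i"
  obtains L' where "\<And>j. L' j \<le> L' (j + 1)" "\<And>u v. zigzag L (flip u) (flip v) = zigzag L' u v"
    "\<And>i j. i \<le> L' j \<longleftrightarrow> L i < j"
proof -
  have mono: "L i \<le> L j" if "i \<le> j" for i j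
    using mono_int_stepI[of L] step that by (simp add: mono_def)
  have "\<exists>i. L i < j \<and> j \<le> L (i + 1)" for j
  proof -
    obtain a b where "L a < j" "j \<le> L b" using lo hi by blast
    then have "a < b" using mono[of b a] by linarith
    define d where "d = (LEAST d. j \<le> L (a + int d))"
    have "j \<le> L (a + int (nat (b - a)))" using \<open>a < b\<close> \<open>j \<le> L b\<close> by simp
    then have d: "j \<le> L (a + int d)" unfolding d_def by (rule LeastI)
    then have "d \<noteq> 0" using \<open>L a < j\<close> by (intro notI) simp
    then have "\<not> j \<le> L (a + int (d - 1))"
      unfolding d_def by (intro not_less_Least) simp
    then show ?thesis
      using d \<open>d \<noteq> 0\<close> by (intro exI[of _ "a + int (d - 1)"]) (simp add: of_nat_diff)
  qed
  then obtain L' where L': "\<And>j. L (L' j) < j" "\<And>j. j \<le> L (L' j + 1)" by metis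
  have iff: "i \<le> L' j \<longleftrightarrow> L i < j" for i j
    using L'(1)[of j] L'(2)[of j] mono[of i "L' j"] mono[of "L' j + 1" i] by (cases "i \<le> L' j") auto
  have iff': "L' j \<le> i \<longleftrightarrow> j \<le> L (i + 1)" for i j
    using iff[of "i + 1" j] by linarith
  have "L' j \<le> L' (j + 1)" for j
    unfolding iff using L'(1)[of j] by linarith
  moreover have "zigzag L (flip u) (flip v) = zigzag L' u v" for u v
    by (cases u; cases v) (auto simp: iff iff')
  ultimately show ?thesis using iff that by blast
qed

section \<open>Gluing ears\<close>

text \<open>
  One new inner vertex \<open>tip n q\<close> is placed after each block of \<open>n\<close> inner vertices; old indices are
  moved by \<open>insert_index n\<close>.
\<close>

definition insert_index :: "nat \<Rightarrow> int \<Rightarrow> int" where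
  "insert_index n j = j + j div int n"

fun insert_vertex :: "nat \<Rightarrow> vertex \<Rightarrow> vertex" where
  "insert_vertex n (Outer i) = Outer i"
| "insert_vertex n (Inner j) = Inner (insert_index n j)"

definition tip :: "nat \<Rightarrow> int \<Rightarrow> int" where
  "tip n q = q * (int n + 1) + int n"

text \<open>Besides the old arcs, \<open>ear n E\<close> contains the old boundary sides that a new vertex makes interior.\<close>

definition ear :: "nat \<Rightarrow> (vertex \<Rightarrow> vertex \<Rightarrow> bool) \<Rightarrow> vertex \<Rightarrow> vertex \<Rightarrow> bool" where
  "ear n E u v \<longleftrightarrow> (\<exists>x y. u = insert_vertex n x \<and> v = insert_vertex n y \<and> sides E x y \<and> \<not> neighbours u v)"

context
  fixes n :: nat
  assumes n: "n > 0"
begin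

lemma insert_index_mono: "i < j \<Longrightarrow> insert_index n i < insert_index n j"
  using zdiv_mono1[of i j "int n"] n by (simp add: insert_index_def)

lemma insert_index_less: "insert_index n i < insert_index n j \<longleftrightarrow> i < j"
  using insert_index_mono by (metis linorder_neqE not_less_iff_gr_or_eq)

lemma insert_index_le: "insert_index n i \<le> insert_index n j \<longleftrightarrow> i \<le> j"
  using insert_index_less by (metis linorder_not_less)

lemma insert_index_eq: "insert_index n i = insert_index n j \<longleftrightarrow> i = j"
  using insert_index_less by (metis less_irrefl linorder_neqE)

lemma insert_index_add: "insert_index n (i + k * int n) = insert_index n i + k * (int n + 1)"
  using n by (simp add: insert_index_def algebra_simps)

lemma insert_index_Suc: "insert_index n (j + 1) = insert_index n j + (if (j + 1) mod int n = 0 then 2 else 1)"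
proof -
  define q r where "q = j div int n" and "r = j mod int n"
  have j: "j = q * int n + r" "0 \<le> r" "r < int n" unfolding q_def r_def using n by auto
  show ?thesis
  proof (cases "r + 1 = int n")
    case True
    then have "j + 1 = (q + 1) * int n" using j by (simp add: algebra_simps)
    then have "(j + 1) div int n = q + 1" "(j + 1) mod int n = 0" using n by simp_all
    then show ?thesis using q_def by (simp add: insert_index_def)
  next
    case False
    then have "r + 1 < int n" using j by simp
    have "j + 1 = int n * q + (r + 1)" using j by simp
    then have "(j + 1) div int n = q" "(j + 1) mod int n = r + 1"
      using \<open>r + 1 < int n\<close> j by (intro int_div_pos_eq int_mod_pos_eq; simp)+
    then show ?thesis using q_def j(2) by (simp add: insert_index_def)
  qed
qed

text \<open>A tip sits between the last old vertex of block \<open>q\<close> and the first one of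
  block \<open>q + 1\<close>.\<close>

lemma tip_insert_index: "tip n q - 1 = insert_index n (q * int n + int n - 1)" "tip n q + 1 = insert_index n (q * int n + int n)"
proof -
  have e: "q * int n + int n = (q + 1) * int n" by (simp add: algebra_simps)
  have "insert_index n (q * int n + int n) = tip n q + 1"
    unfolding e using insert_index_add[of 0 "q + 1"] by (simp add: insert_index_def tip_def algebra_simps)
  moreover have "insert_index n (q * int n + int n) = insert_index n (q * int n + int n - 1) + 2"
    using insert_index_Suc[of "q * int n + int n - 1"] by (simp add: e)
  ultimately show "tip n q - 1 = insert_index n (q * int n + int n - 1)" "tip n q + 1 = insert_index n (q * int n + int n)"
    by simp_all
qed

lemma tip_not_insert_index: "tip n q \<noteq> insert_index n j"
proof
  assume "tip n q = insert_index n j"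
  then have "insert_index n (q * int n + int n - 1) < insert_index n j" "insert_index n j < insert_index n (q * int n + int n)"
    using tip_insert_index[of q] by linarith+
  then show False unfolding insert_index_less by simp
qed

lemma insert_index_or_tip: "(\<exists>i. j = insert_index n i) \<or> (\<exists>q. j = tip n q)"
proof -
  define q r where "q = j div (int n + 1)" and "r = j mod (int n + 1)"
  have j: "j = q * (int n + 1) + r" "0 \<le> r" "r \<le> int n"
    unfolding q_def r_def using pos_mod_bound[of "int n + 1" j] by (simp_all del: div_mult_mod_eq add: div_mult_mod_eq[symmetric])
  show ?thesis
  proof (cases "r = int n")
    case True
    then show ?thesis using j by (auto simp: tip_def)
  next
    case False
    then have "insert_index n r = r" using j n by (simp add: insert_index_def)
    then have "j = insert_index n (r + q * int n)" using j by (simp add: insert_index_add)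
    then show ?thesis by blast
  qed
qed

lemma insert_vertex_cases:
  obtains x where "v = insert_vertex n x" | q where "v = Inner (tip n q)"
proof (cases v)
  case (Outer i)
  then have "v = insert_vertex n (Outer i)" by simp
  then show ?thesis using that by blast
next
  case (Inner j)
  then show ?thesis using insert_index_or_tip[of j] that insert_vertex.simps(2)[of n] by metis
qed

lemma insert_vertex_eq: "insert_vertex n x = insert_vertex n y \<longleftrightarrow> x = y"
  by (cases x; cases y) (auto simp: insert_index_eq)

lemma inj_insert_vertex: "inj (insert_vertex n)"
  by (simp add: inj_def insert_vertex_eq)

lemma tip_not_insert_vertex: "Inner (tip n q) \<noteq> insert_vertex n x" "insert_vertex n x \<noteq> Inner (tip n q)"
  by (cases x; simp add: tip_not_insert_index; use tip_not_insert_index in metis)+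

lemma insert_vertex_precedes: "insert_vertex n x \<lhd> insert_vertex n y \<longleftrightarrow> x \<lhd> y"
  by (cases x; cases y) (auto simp: insert_index_less)

lemma insert_vertex_crosses: "crosses (insert_vertex n u) (insert_vertex n v) (insert_vertex n x) (insert_vertex n y) \<longleftrightarrow> crosses u v x y"
  unfolding crosses_defs insert_vertex_precedes ..

lemma insert_vertex_shift: "insert_vertex n (shift m n k x) = shift m (n + 1) k (insert_vertex n x)"
  by (cases x) (simp_all add: insert_index_add)

lemma not_neighbours_insert_vertex:
  assumes "chord m n x y"
  shows "\<not> neighbours (insert_vertex n x) (insert_vertex n y)"
proof (cases x; cases y)
  fix i j assume "x = Inner i" "y = Inner j"
  then have "i + 2 \<le> j \<or> j + 2 \<le> i" using assms by auto
  moreover have "insert_index n i + 2 \<le> insert_index n j" if "i + 2 \<le> j" for i j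
    using insert_index_mono[of i "i + 1"] insert_index_mono[of "i + 1" j] that by linarith
  ultimately show ?thesis using \<open>x = _\<close> \<open>y = _\<close>
    by fastforce
qed (use assms in auto)

lemma neighbours_not_crosses: "neighbours u v \<Longrightarrow> \<not> crosses u v x y"
  by (cases u; cases v; cases x; cases y) (auto simp: crosses_defs)

lemma sides_insert_vertex_neighbours:
  assumes "neighbours (insert_vertex n x) (insert_vertex n y)"
  shows "neighbours x y"
proof (cases x; cases y)
  fix i j assume "x = Inner i" "y = Inner j"
  then have a: "insert_index n i = insert_index n j + 1 \<or> insert_index n j = insert_index n i + 1" using assms by auto
  have "\<not> j + 1 < i" "\<not> i + 1 < j" "i \<noteq> j"
    using a insert_index_mono[of i "i+1"] insert_index_mono[of "i+1" j] insert_index_mono[of j "j+1"] insert_index_mono[of "j+1" i] by auto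
  then show ?thesis using \<open>x = _\<close> \<open>y = _\<close> by auto
qed (use assms in auto)

text \<open>An old boundary segment either remains one or becomes the base of an ear, hence an arc.
  All old triangles therefore survive.\<close>

lemma sides_ear_insert_vertex: "sides (ear n E) (insert_vertex n x) (insert_vertex n y) \<longleftrightarrow> sides E x y"
  unfolding sides_def[of "ear n E"] ear_def
  using sides_insert_vertex_neighbours[of x y] by (auto simp: insert_vertex_eq sides_def)

lemma sides_ear_tip: "sides (ear n E) (Inner (tip n q)) v \<longleftrightarrow>
    v = insert_vertex n (Inner (q * int n + int n - 1)) \<or> v = insert_vertex n (Inner (q * int n + int n))"
  using tip_insert_index[of q] by (auto simp: sides_def ear_def tip_not_insert_vertex neighbours_Inner)

lemma sides_ear_tip': "sides (ear n E) v (Inner (tip n q)) \<longleftrightarrow>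
    v = insert_vertex n (Inner (q * int n + int n - 1)) \<or> v = insert_vertex n (Inner (q * int n + int n))"
  using tip_insert_index[of q] by (auto simp: sides_def ear_def tip_not_insert_vertex neighbours_sym[of v] neighbours_Inner)

lemma ear_base: "ear n E (insert_vertex n (Inner (q * int n + int n - 1))) (insert_vertex n (Inner (q * int n + int n)))"
  unfolding ear_def using tip_insert_index[of q]
  by (intro exI[of _ "Inner (q * int n + int n - 1)"] exI[of _ "Inner (q * int n + int n)"])
     (auto simp: sides_def)

lemma cover_triangulation_ear:
  assumes "cover_triangulation m n E"
  shows "cover_triangulation m (n + 1) (ear n E)"
proof (rule cover_triangulationI)
  note ct = cover_triangulationD[OF assms]
  have sidesym: "sides E u v \<longleftrightarrow> sides E v u" for u v
    using ct(3) neighbours_sym by (auto simp: sides_def)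
  show "m > 0" "n + 1 > 0" using ct(1) by auto
  show "ear n E v u" if "ear n E u v" for u v
    using that sidesym neighbours_sym unfolding ear_def by blast
  show "ear n E (shift m (n + 1) k u) (shift m (n + 1) k v)" if uv: "ear n E u v" for u v k
  proof -
    obtain x y where xy: "u = insert_vertex n x" "v = insert_vertex n y" "sides E x y" "\<not> neighbours u v"
      using uv unfolding ear_def by blast
    have nb: "neighbours (shift m n' k x) (shift m n' k y) \<longleftrightarrow> neighbours x y" for x y m n'
      by (cases x; cases y) auto
    have "sides E (shift m n k x) (shift m n k y)"
      using xy(3) ct(4) by (auto simp: sides_def nb)
    then show ?thesis
      using xy(4) unfolding xy(1,2) insert_vertex_shift[symmetric] ear_def
      by (intro exI[of _ "shift m n k x"] exI[of _ "shift m n k y"]) (auto simp: insert_vertex_shift nb)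
  qed
  show "chord m (n + 1) u v" if uv: "ear n E u v" for u v
  proof -
    obtain x y where xy: "u = insert_vertex n x" "v = insert_vertex n y" "sides E x y" "\<not> neighbours u v"
      using uv unfolding ear_def by blast
    show ?thesis
    proof (cases x; cases y)
      fix i j assume e: "x = Outer i" "y = Outer j"
      then have "chord m n x y" using xy ct(5)[of x y] by (auto simp: sides_def)
      then show ?thesis using e xy by auto
    next
      fix i j assume e: "x = Inner i" "y = Inner j"
      \<comment> \<open>Adding the period \<open>n\<close> to an old index adds \<open>n + 1\<close>
        to the new one, so lengths up to \<open>n\<close> become lengths up to \<open>n + 1\<close>.
        The base of an ear attains this bound when \<open>n = 1\<close>.\<close>
      have "i \<noteq> j" "\<bar>i - j\<bar> \<le> int n"
        using xy(3) ct(5)[of x y] n e by (auto simp: sides_def)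
      then have "insert_index n i \<le> insert_index n (j + int n)" "insert_index n j \<le> insert_index n (i + int n)" "insert_index n i \<noteq> insert_index n j"
        by (auto simp: insert_index_le insert_index_eq)
      moreover have "insert_index n (k + int n) = insert_index n k + int n + 1" for k
        using insert_index_add[of k 1] by simp
      ultimately show ?thesis
        using xy(4) e xy(1,2) by (auto simp: abs_if split: if_splits)
    qed (use xy in auto)
  qed
  have nc: "\<not> crosses u v x y" if "sides E u v" "sides E x y" for u v x y
    using that ct(6) neighbours_not_crosses crosses_sym unfolding sides_def by blast
  show "\<not> crosses u v x y" if "ear n E u v" "ear n E x y" for u v x y
    using that nc unfolding ear_def by (auto simp: insert_vertex_crosses)
  show "ear n E u v" if c: "chord m (n + 1) u v" and nc: "\<And>x y. ear n E x y \<Longrightarrow> \<not> crosses u v x y" for u v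
  proof -
    \<comment> \<open>A chord at a tip would cross the base of its ear, so both ends of the given
      chord are old vertices.\<close>
    have tip: False if c: "chord m (n + 1) (Inner (tip n q)) v"
      and nc: "\<not> crosses (Inner (tip n q)) v (Inner (tip n q - 1)) (Inner (tip n q + 1))" for q v
      using that by (cases v) (auto simp: crosses_defs)
    have b: "\<not> crosses u v (Inner (tip n q - 1)) (Inner (tip n q + 1))" for q
      using nc[OF ear_base[of E q]] by (simp add: tip_insert_index)
    have sym: "chord m (n + 1) v u"
      using c by (cases u; cases v) auto
    obtain x where x: "u = insert_vertex n x"
      using tip c b by (cases u rule: insert_vertex_cases) blast+
    obtain y where y: "v = insert_vertex n y"
      using tip[of _ u] sym b crosses_commute(1)[of u v] by (cases v rule: insert_vertex_cases) auto
    have "\<not> neighbours u v"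
      using c by (cases u; cases v) auto
    \<comment> \<open>If the old vertices were neighbours, the chord is the base of an ear;
      otherwise it is a chord of the old strip and maximality of \<open>E\<close> applies.\<close>
    moreover have "sides E x y"
    proof (cases "neighbours x y")
      case False
      have "E x y"
      proof (rule ct(7))
        show "chord m n x y"
        proof (cases x; cases y)
          fix i j assume e: "x = Inner i" "y = Inner j"
          have "i \<noteq> j" using c e x y by auto
          moreover have "\<bar>i - j\<bar> \<noteq> 1" using False e by auto
          moreover have "i \<le> j + int n"
          proof (rule ccontr)
            assume "\<not> i \<le> j + int n"
            then have "insert_index n (j + int n) < insert_index n i" by (simp add: insert_index_less)
            then show False using insert_index_add[of j 1] c e x y by auto
          qed
          moreover have "j \<le> i + int n"
          proof (rule ccontr)
            assume "\<not> j \<le> i + int n"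
            then have "insert_index n (i + int n) < insert_index n j" by (simp add: insert_index_less)
            then show False using insert_index_add[of i 1] c e x y by auto
          qed
          ultimately show ?thesis using e by auto
        qed (use c x y in auto)
        show "\<not> crosses x y a b" if "E a b" for a b
        proof -
          have "ear n E (insert_vertex n a) (insert_vertex n b)"
            unfolding ear_def using that not_neighbours_insert_vertex[OF ct(5)[OF that]]
            by (intro exI[of _ a] exI[of _ b]) (auto simp: sides_def)
          then show ?thesis using nc[of "insert_vertex n a" "insert_vertex n b"] unfolding x y insert_vertex_crosses by blast
        qed
      qed
      then show ?thesis by (simp add: sides_def)
    qed (simp add: sides_def)
    ultimately show ?thesis
      unfolding ear_def using x y by blast
  qed
qed

lemma corner_pairs_ear_Outer: "corner_pairs (ear n E) (Outer i) = (`) (insert_vertex n) ` corner_pairs E (Outer i)"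
  (is "?A = ?B")
proof
  have tip: "\<not> sides (ear n E) (Outer i) (Inner (tip n q))" for q
    by (simp add: sides_ear_tip')
  have O: "sides (ear n E) (Outer i) (insert_vertex n x) \<longleftrightarrow> sides E (Outer i) x" for x
    using sides_ear_insert_vertex[of E "Outer i" x] by simp
  show "?A \<subseteq> ?B"
  proof
    fix c assume "c \<in> ?A"
    then obtain x' y' where c: "c = {x', y'}" "sides (ear n E) (Outer i) x'" "sides (ear n E) (Outer i) y'"
      "sides (ear n E) x' y'"
      unfolding corner_pairs_def by auto
    obtain x y where "x' = insert_vertex n x" "y' = insert_vertex n y"
      using c tip by (cases x' rule: insert_vertex_cases; cases y' rule: insert_vertex_cases) auto
    then show "c \<in> ?B"
      unfolding corner_pairs_def using c by (intro image_eqI[of _ _ "{x, y}"]) (auto simp: O sides_ear_insert_vertex)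
  qed
  show "?B \<subseteq> ?A"
  proof
    fix c assume "c \<in> ?B"
    then obtain d where "d \<in> corner_pairs E (Outer i)" "c = insert_vertex n ` d" by (elim imageE)
    then obtain x y where "c = {insert_vertex n x, insert_vertex n y}" "sides E (Outer i) x" "sides E (Outer i) y" "sides E x y"
      unfolding corner_pairs_def by auto
    then show "c \<in> ?A"
      unfolding corner_pairs_def
      by (intro CollectI exI[of _ "insert_vertex n x"] exI[of _ "insert_vertex n y"]) (auto simp: O sides_ear_insert_vertex)
  qed
qed

lemma valency_ear_Outer: "valency (ear n E) (Outer i) = valency E (Outer i)"
  unfolding valency_def corner_pairs_ear_Outer
  by (intro card_image inj_on_image) (metis inj_insert_vertex inj_on_subset subset_UNIV)

lemma corner_pairs_ear_tip:
  assumes "\<And>u. \<not> E u u"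
  shows "corner_pairs (ear n E) (Inner (tip n q)) = {{Inner (tip n q - 1), Inner (tip n q + 1)}}"
proof -
  let ?a = "insert_vertex n (Inner (q * int n + int n - 1))" and ?b = "insert_vertex n (Inner (q * int n + int n))"
  have ab: "sides (ear n E) ?a ?b" "sides (ear n E) ?b ?a"
    unfolding sides_ear_insert_vertex by (auto simp: sides_def)
  have irr: "\<not> sides (ear n E) ?a ?a" "\<not> sides (ear n E) ?b ?b"
    unfolding sides_ear_insert_vertex using assms by (auto simp: sides_def)
  have "corner_pairs (ear n E) (Inner (tip n q)) = {{?a, ?b}}"
    unfolding corner_pairs_def sides_ear_tip using ab irr by blast
  then show ?thesis by (simp add: tip_insert_index)
qed

text \<open>Each ear next to the vertex adds one corner: \<open>?C\<close> accounts for the tip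
  before it, when \<open>j\<close> opens a block, and \<open>?D\<close> for the tip after it, when
  \<open>j\<close> closes one. For \<open>n = 1\<close> both occur.\<close>

lemma corner_pairs_ear_Inner:
  assumes sym: "\<And>u v. E u v \<Longrightarrow> E v u" and irr: "\<And>u. \<not> E u u"
  shows "corner_pairs (ear n E) (insert_vertex n (Inner j)) = (`) (insert_vertex n) ` corner_pairs E (Inner j)
    \<union> (\<lambda>q. {Inner (tip n q), Inner (tip n q - 1)}) ` {q. j = q * int n + int n}
    \<union> (\<lambda>q. {Inner (tip n q), Inner (tip n q + 1)}) ` {q. j = q * int n + int n - 1}" (is "?A = ?B \<union> ?C \<union> ?D")
proof
  let ?a = "\<lambda>q. insert_vertex n (Inner (q * int n + int n - 1))" and ?b = "\<lambda>q. insert_vertex n (Inner (q * int n + int n))"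
  let ?u = "insert_vertex n (Inner j)" and ?S = "sides (ear n E)"
  have irrS: "\<not> sides E u u" for u
    using irr by (cases u) (auto simp: sides_def)
  have tp: "{v, y} \<in> ?C \<union> ?D" if v: "v = Inner (tip n q)" and "?S ?u v" "?S ?u y" "?S v y" for v y q
  proof -
    have "?u = ?a q \<or> ?u = ?b q" using that by (simp add: sides_ear_tip')
    then have j: "j = q * int n + int n - 1 \<or> j = q * int n + int n" by (auto simp: insert_index_eq)
    have "y = ?a q \<or> y = ?b q" using that by (simp add: sides_ear_tip)
    moreover have "y \<noteq> ?u" using that(3) irrS[of "Inner j"] sides_ear_insert_vertex[of E "Inner j" "Inner j"] by auto
    ultimately have "j = q * int n + int n - 1 \<and> y = ?b q \<or> j = q * int n + int n \<and> y = ?a q"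
      using j by auto
    then show ?thesis using v tip_insert_index[of q] by auto
  qed
  have symS: "?S u v \<Longrightarrow> ?S v u" for u v
    using sym neighbours_sym unfolding sides_def ear_def by blast
  show "?A \<subseteq> ?B \<union> ?C \<union> ?D"
  proof
    fix c assume "c \<in> ?A"
    then obtain x' y' where c: "c = {x', y'}" "?S ?u x'" "?S ?u y'" "?S x' y'"
      unfolding corner_pairs_def by auto
    show "c \<in> ?B \<union> ?C \<union> ?D"
    proof (cases x' rule: insert_vertex_cases)
      case (1 x)
      show ?thesis
      proof (cases y' rule: insert_vertex_cases)
        case (1 y)
        have "c \<in> ?B"
          unfolding corner_pairs_def using c \<open>x' = _\<close> \<open>y' = _\<close>
          by (intro image_eqI[of _ _ "{x, y}"]) (auto simp: sides_ear_insert_vertex simp del: insert_vertex.simps)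
        then show ?thesis by blast
      next
        case (2 q)
        then have "{y', x'} \<in> ?C \<union> ?D" using c symS by (intro tp)
        then have "c \<in> ?C \<union> ?D" unfolding c(1) by (simp only: insert_commute)
        then show ?thesis by (auto simp only: Un_iff)
      qed
    next
      case (2 q)
      then have "c \<in> ?C \<union> ?D" unfolding c(1) using c by (intro tp)
      then show ?thesis by (auto simp only: Un_iff)
    qed
  qed
  have "?B \<subseteq> ?A"
  proof
    fix c assume "c \<in> ?B"
    then obtain d where "d \<in> corner_pairs E (Inner j)" "c = insert_vertex n ` d" by (elim imageE)
    then obtain x y where "c = {insert_vertex n x, insert_vertex n y}" "sides E (Inner j) x" "sides E (Inner j) y" "sides E x y"
      unfolding corner_pairs_def by auto
    then show "c \<in> ?A"
      unfolding corner_pairs_def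
      by (intro CollectI exI[of _ "insert_vertex n x"] exI[of _ "insert_vertex n y"]) (auto simp: sides_ear_insert_vertex simp del: insert_vertex.simps)
  qed
  moreover have "?C \<subseteq> ?A"
  proof
    fix c assume "c \<in> ?C"
    then obtain q where q: "j = q * int n + int n" "c = {Inner (tip n q), ?a q}"
      using tip_insert_index by auto
    have "?S ?u (?a q)" unfolding sides_ear_insert_vertex q by (simp add: sides_def)
    then show "c \<in> ?A"
      unfolding corner_pairs_def using q
      by (intro CollectI exI[of _ "Inner (tip n q)"] exI[of _ "?a q"])
         (auto simp: sides_ear_tip sides_ear_tip' simp del: insert_vertex.simps)
  qed
  moreover have "?D \<subseteq> ?A"
  proof
    fix c assume "c \<in> ?D"
    then obtain q where q: "j = q * int n + int n - 1" "c = {Inner (tip n q), ?b q}"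
      using tip_insert_index by auto
    have "?S ?u (?b q)" unfolding sides_ear_insert_vertex q by (simp add: sides_def)
    then show "c \<in> ?A"
      unfolding corner_pairs_def using q
      by (intro CollectI exI[of _ "Inner (tip n q)"] exI[of _ "?b q"])
         (auto simp: sides_ear_tip sides_ear_tip' simp del: insert_vertex.simps)
  qed
  ultimately show "?B \<union> ?C \<union> ?D \<subseteq> ?A" by (intro Un_least)
qed

lemma valency_ear_tip:
  assumes "\<And>u. \<not> E u u"
  shows "valency (ear n E) (Inner (tip n q)) = 1"
  unfolding valency_def corner_pairs_ear_tip[of E q, OF assms] by simp

lemma finite_multiples: "finite {q. j = q * int n + c}" "card {q. j = q * int n + c} = (if (j - c) mod int n = 0 then 1 else 0)"
proof -
  have "{q. j = q * int n + c} = (if (j - c) mod int n = 0 then {(j - c) div int n} else {})"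
  proof (cases "(j - c) mod int n = 0")
    case True
    then have "j = (j - c) div int n * int n + c" using div_mult_mod_eq[of "j - c" "int n"] by linarith
    then show ?thesis using n True by auto
  next
    case False
    then show ?thesis by auto
  qed
  then show "finite {q. j = q * int n + c}" "card {q. j = q * int n + c} = (if (j - c) mod int n = 0 then 1 else 0)"
    by simp_all
qed

lemma valency_ear_Inner:
  assumes sym: "\<And>u v. E u v \<Longrightarrow> E v u" and irr: "\<And>u. \<not> E u u" and fin: "finite (corner_pairs E (Inner j))"
  shows "valency (ear n E) (Inner (insert_index n j)) = valency E (Inner j)
      + (if j mod int n = 0 then 1 else 0) + (if (j + 1) mod int n = 0 then 1 else 0)"
    and "finite (corner_pairs (ear n E) (Inner (insert_index n j)))"
proof -
  let ?B = "(`) (insert_vertex n) ` corner_pairs E (Inner j)"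
  let ?C = "(\<lambda>q. {Inner (tip n q), Inner (tip n q - 1)}) ` {q. j = q * int n + int n}"
  let ?D = "(\<lambda>q. {Inner (tip n q), Inner (tip n q + 1)}) ` {q. j = q * int n + int n - 1}"
  have fin': "finite ?B" "finite ?C" "finite ?D"
    using fin finite_multiples(1)[of j "int n"] finite_multiples(1)[of j "int n - 1"]
    by (auto simp: add_diff_eq)
  have BCD: "?B \<inter> (?C \<union> ?D) = {}"
  proof -
    have "Inner (tip n q) \<notin> insert_vertex n ` d" for q d
      using tip_not_insert_vertex by blast
    then show ?thesis by auto (metis insertI1)+
  qed
  have CD: "?C \<inter> ?D = {}"
  proof -
    have "tip n q \<noteq> tip n q' + 1" for q q'
      using tip_not_insert_index tip_insert_index(2) by auto
    then show ?thesis by (auto simp: doubleton_eq_iff)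
  qed
  have B: "card ?B = card (corner_pairs E (Inner j))"
    by (intro card_image inj_on_image) (metis inj_insert_vertex inj_on_subset subset_UNIV)
  have tipeq: "tip n q = tip n q' \<longleftrightarrow> q = q'" for q q'
    using n by (simp add: tip_def)
  have C: "card ?C = card {q. j = q * int n + int n}"
    by (intro card_image inj_onI) (auto simp: doubleton_eq_iff tipeq)
  have D: "card ?D = card {q. j = q * int n + int n - 1}"
    by (intro card_image inj_onI) (auto simp: doubleton_eq_iff tipeq)
  have eq: "corner_pairs (ear n E) (Inner (insert_index n j)) = ?B \<union> (?C \<union> ?D)"
    using corner_pairs_ear_Inner[of E j, OF sym irr] by (simp add: Un_assoc)
  have C': "card {q. j = q * int n + int n} = (if j mod int n = 0 then 1 else 0)"
    using finite_multiples(2)[of j "int n"] by simp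
  have D': "card {q. j = q * int n + int n - 1} = (if (j + 1) mod int n = 0 then 1 else 0)"
  proof -
    have "j - (int n - 1) = j + 1 - int n" by simp
    then have "(j - (int n - 1)) mod int n = (j + 1) mod int n" by (metis mod_diff_right_eq mod_self diff_zero)
    then show ?thesis
      using finite_multiples(2)[of j "int n - 1"] by (simp add: add_diff_eq)
  qed
  show "finite (corner_pairs (ear n E) (Inner (insert_index n j)))"
    unfolding eq using fin' by blast
  have "card (?B \<union> (?C \<union> ?D)) = card ?B + (card ?C + card ?D)"
    using fin' BCD CD by (subst card_Un_disjoint; (simp only: finite_Un)?; (subst card_Un_disjoint)?; simp)
  then show "valency (ear n E) (Inner (insert_index n j)) = valency E (Inner j)
      + (if j mod int n = 0 then 1 else 0) + (if (j + 1) mod int n = 0 then 1 else 0)"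
    unfolding valency_def eq B C D C' D' by linarith
qed

end

section \<open>Friezes with a given quiddity row\<close>

text \<open>These are signed continuants, the determinants of tridiagonal matrices with diagonal
  \<open>b\<close> and ones beside it. They are the classical expression of frieze entries by the
  quiddity row.\<close>

fun continuant :: "(int \<Rightarrow> int) \<Rightarrow> int \<Rightarrow> nat \<Rightarrow> int" where
  "continuant b i 0 = 0"
| "continuant b i (Suc 0) = 1"
| "continuant b i (Suc (Suc k)) = b (i + int k) * continuant b i (Suc k) - continuant b i k"

text \<open>Consecutive rows solve the same second order recurrence, and the left-hand side is their
  Casoratian, which such a recurrence keeps constant.\<close>

lemma continuant_diamond:
  "continuant b i (k + 1) * continuant b (i + 1) (k + 1) - continuant b i (k + 2) * continuant b (i + 1) k = 1"
proof (induction k)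
  case (Suc k)
  then show ?case by (simp add: algebra_simps)
qed simp

text \<open>A certificate that the frieze with quiddity row \<open>b\<close> has positive entries.
  Unlike the condition \<open>b j \<ge> 2\<close>, it can be carried along when ears create
  quiddities equal to 1.\<close>

definition supersolution :: "(int \<Rightarrow> int) \<Rightarrow> (int \<Rightarrow> int) \<Rightarrow> bool" where
  "supersolution b x \<longleftrightarrow> (\<forall>j. x j > 0) \<and> (\<forall>j. x (j - 1) + x (j + 1) \<le> b j * x j)"

text \<open>The Casoratian of a continuant row and a supersolution is nondecreasing, hence positive.\<close>

lemma continuant_casoratian:
  assumes "supersolution b x"
  shows "continuant b i (Suc k) > 0 \<and> continuant b i (Suc k) * x (i + int k - 1) - continuant b i k * x (i + int k) > 0"
proof (induction k)
  case 0
  then show ?case using assms by (simp add: supersolution_def)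
next
  case (Suc k)
  let ?c = "continuant b i"
  have x: "x (i + int k - 1) + x (i + int k + 1) \<le> b (i + int k) * x (i + int k)"
    and pos: "x j > 0" for j
    using assms by (auto simp: supersolution_def)
  have "?c (Suc k) * (x (i + int k - 1) + x (i + int k + 1)) \<le> ?c (Suc k) * (b (i + int k) * x (i + int k))"
    using Suc x by (intro mult_left_mono) auto
  then have W: "?c (Suc (Suc k)) * x (i + int k) - ?c (Suc k) * x (i + int k + 1) > 0"
    using Suc by (simp add: algebra_simps)
  moreover have "?c (Suc k) * x (i + int k + 1) > 0"
    using Suc pos by simp
  ultimately have "?c (Suc (Suc k)) * x (i + int k) > 0" by linarith
  then have "?c (Suc (Suc k)) > 0"
    using pos[of "i + int k"] by (simp add: zero_less_mult_iff)
  then show ?case using W by (simp add: algebra_simps)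
qed

lemma infinite_frieze_continuant:
  assumes "supersolution b x"
  shows "infinite_frieze (continuant b)"
  unfolding infinite_frieze_def
proof (intro conjI allI impI)
  show "continuant b i k > 0" if "k \<ge> 2" for i k
    using continuant_casoratian[OF assms, of i "k - 1"] that by simp
qed (use continuant_diamond[of b] in simp_all)

text \<open>The diamond rule can be solved for the entry of the next row, because the entry
  multiplying it is positive.\<close>

lemma infinite_frieze_unique:
  assumes F: "infinite_frieze F" and G: "infinite_frieze G" and FG: "\<And>i. G i 2 = F (i + t) 2"
  shows "G i k = F (i + t) k"
proof -
  have "\<forall>i. G i k = F (i + t) k \<and> G i (Suc k) = F (i + t) (Suc k)"
  proof (induction k)
    case 0
    then show ?case using F G by (simp add: infinite_frieze_def)
  next
    case (Suc k)
    have "G i (Suc (Suc k)) = F (i + t) (Suc (Suc k))" for i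
    proof (cases k)
      case 0
      then show ?thesis using FG by (simp add: numeral_2_eq_2)
    next
      case (Suc l)
      have g: "G i (k + 1) * G (i + 1) (k + 1) - G i (k + 2) * G (i + 1) k = 1"
        and f: "F (i + t) (k + 1) * F (i + t + 1) (k + 1) - F (i + t) (k + 2) * F (i + t + 1) k = 1"
        using F G unfolding infinite_frieze_def by blast+
      have "F (i + t + 1) k > 0"
        using F Suc unfolding infinite_frieze_def by (cases l) auto
      have "G (i + 1) k = F (i + t + 1) k" "G (i + 1) (k + 1) = F (i + t + 1) (k + 1)"
        "G i (k + 1) = F (i + t) (k + 1)"
        using Suc.IH by (simp_all add: add.assoc add.commute[of 1])
      then have "G i (k + 2) * F (i + t + 1) k = F (i + t) (k + 2) * F (i + t + 1) k"
        using f g[unfolded \<open>G (i + 1) k = _\<close> \<open>G (i + 1) (k + 1) = _\<close> \<open>G i (k + 1) = _\<close>] by linarith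
      then show ?thesis using \<open>F (i + t + 1) k > 0\<close> by simp
    qed
    then show ?case using Suc by simp
  qed
  then show ?thesis by blast
qed

lemma continuant_2 [simp]: "continuant b i 2 = b i"
  by (simp add: numeral_2_eq_2)

section \<open>Lifting curves to the strip\<close>

text \<open>Logarithms of the marked points; the radius 2 of the outer circle becomes the real part
  \<open>ln 2\<close>, and deck translations add multiples of 2 pi to the imaginary part.\<close>

fun lifted :: "nat \<Rightarrow> nat \<Rightarrow> vertex \<Rightarrow> complex" where
  "lifted m n (Outer i) = Complex (ln 2) (2 * pi * of_int i / of_nat m)"
| "lifted m n (Inner j) = Complex 0 (2 * pi * of_int j / of_nat n)"

definition strip :: "complex set" where
  "strip = {z. 0 \<le> Re z \<and> Re z \<le> ln 2}"

definition lifts :: "(real \<Rightarrow> complex) \<Rightarrow> (real \<Rightarrow> complex) \<Rightarrow> bool" where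
  "lifts f g \<longleftrightarrow> path f \<and> (\<forall>t\<in>{0..1}. f t \<in> strip \<and> g t = exp (f t))"

text \<open>By \<open>lifts_homotopic\<close> this is a full homotopy class: the ends of a lift are
  its only invariant.\<close>

definition curve_class :: "nat \<Rightarrow> nat \<Rightarrow> vertex \<Rightarrow> vertex \<Rightarrow> (real \<Rightarrow> complex) set" where
  "curve_class m n u v = {g. \<exists>f. lifts f g \<and> pathstart f = lifted m n u \<and> pathfinish f = lifted m n v}"

lemma exp_in_annulus: "exp z \<in> annulus \<longleftrightarrow> z \<in> strip"
proof -
  have "exp (Re z) \<le> 2 \<longleftrightarrow> Re z \<le> ln 2" using ln_ge_iff[of 2 "Re z"] by simp
  then show ?thesis by (simp add: annulus_def strip_def norm_exp_eq_Re)
qed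

lemma exp_in_boundary: "exp z \<in> annulus_boundary \<longleftrightarrow> Re z = 0 \<or> Re z = ln 2"
proof -
  have "exp (Re z) = 2 \<longleftrightarrow> Re z = ln 2" by (metis exp_ln ln_exp zero_less_numeral)
  then show ?thesis by (simp add: annulus_boundary_def norm_exp_eq_Re)
qed

lemma boundary_subset_annulus: "annulus_boundary \<subseteq> annulus"
  by (auto simp: annulus_boundary_def annulus_def)

lemma convex_strip: "convex strip"
proof -
  have "strip = {z. Re z \<ge> 0} \<inter> {z. Re z \<le> ln 2}" by (auto simp: strip_def)
  then show ?thesis by (metis convex_Int convex_halfspace_Re_ge convex_halfspace_Re_le)
qed

lemma annulus_nonzero: "annulus \<subseteq> - {0}"
  by (auto simp: annulus_def)

lemma lifts_path:
  assumes "lifts f g"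
  shows "path g" "path_image g \<subseteq> annulus" "pathstart g = exp (pathstart f)" "pathfinish g = exp (pathfinish f)"
proof -
  have "path (exp \<circ> f)" using assms by (intro path_continuous_image continuous_intros) (auto simp: lifts_def)
  then show "path g" by (rule path_eq) (use assms in \<open>auto simp: lifts_def\<close>)
  show "path_image g \<subseteq> annulus" using assms by (auto simp: lifts_def path_image_def exp_in_annulus)
  show "pathstart g = exp (pathstart f)" "pathfinish g = exp (pathfinish f)"
    using assms by (auto simp: lifts_def pathstart_def pathfinish_def)
qed

lemma lifts_exists:
  assumes "path g" "path_image g \<subseteq> annulus" "pathstart g = exp a"
  obtains f where "lifts f g" "pathstart f = a"
proof -
  have im: "path_image g \<subseteq> - {0}" using assms(2) annulus_nonzero by blast
  obtain f where f: "path f" "pathstart f = a" "\<And>t. t \<in> {0..1} \<Longrightarrow> exp (f t) = g t"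
    using covering_space_lift_path_strong[OF covering_space_exp_punctured_plane UNIV_I assms(1) im assms(3)]
    by metis
  have "f t \<in> strip" if "t \<in> {0..1}" for t
  proof -
    have "g t \<in> annulus" using assms(2) that by (auto simp: path_image_def)
    then show ?thesis using f(3)[OF that] exp_in_annulus[of "f t"] by simp
  qed
  then have "lifts f g" using f by (simp add: lifts_def)
  then show ?thesis using that f by blast
qed

text \<open>One direction is monodromy of the covering \<open>exp\<close>; the other pushes the
  straight-line homotopy of the convex strip down to the annulus.\<close>

lemma lifts_homotopic:
  assumes "lifts f g" "lifts f' g'" "pathstart f = pathstart f'"
  shows "homotopic_paths annulus g g' \<longleftrightarrow> pathfinish f = pathfinish f'"
proof
  note p = lifts_path[OF assms(1)] and p' = lifts_path[OF assms(2)]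
  assume hom: "homotopic_paths annulus g g'"
  show "pathfinish f = pathfinish f'"
  proof (rule covering_space_monodromy[OF covering_space_exp_punctured_plane])
    show "homotopic_paths (- {0}) g g'"
      using homotopic_paths_subset[OF hom annulus_nonzero] .
  qed (use p p' assms annulus_nonzero in \<open>auto simp: lifts_def\<close>)
next
  assume fin: "pathfinish f = pathfinish f'"
  have "homotopic_paths strip f f'"
  proof (rule homotopic_paths_linear)
    show "closed_segment (f t) (f' t) \<subseteq> strip" if "t \<in> {0..1}" for t
      using assms that by (intro closed_segment_subset convex_strip) (auto simp: lifts_def)
  qed (use assms fin in \<open>auto simp: lifts_def\<close>)
  then have "homotopic_paths annulus (exp \<circ> f) (exp \<circ> f')"
    by (rule homotopic_paths_continuous_image) (auto intro!: continuous_intros simp: exp_in_annulus)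
  moreover have "homotopic_paths annulus g (exp \<circ> f)" "homotopic_paths annulus g' (exp \<circ> f')"
    using lifts_path[OF assms(1)] lifts_path[OF assms(2)] assms
    by (auto intro!: homotopic_paths_eq simp: lifts_def)
  ultimately show "homotopic_paths annulus g g'"
    by (meson homotopic_paths_sym homotopic_paths_trans)
qed

lemma lifts_reversepath: "lifts f g \<Longrightarrow> lifts (reversepath f) (reversepath g)"
  by (auto simp: lifts_def reversepath_def path_reversepath[of f, unfolded reversepath_def])

lemma lifts_joinpaths:
  assumes "lifts f g" "lifts f' g'" "pathfinish f = pathstart f'"
  shows "lifts (f +++ f') (g +++ g')"
proof -
  have "path (f +++ f')" using assms by (simp add: lifts_def)
  then show ?thesis using assms by (auto simp: lifts_def joinpaths_def)
qed

lemma exp_eq_shift: "exp z = exp w \<longleftrightarrow> (\<exists>k::int. z = w + Complex 0 (2 * pi * of_int k))"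
  unfolding exp_eq by (simp add: complex_eq_iff mult.commute mult.left_commute)

lemma lifts_shift:
  assumes "lifts f g"
  shows "lifts (\<lambda>t. f t + Complex 0 (2 * pi * of_int k)) g"
proof -
  have "exp (f t) = exp (f t + Complex 0 (2 * pi * of_int k))" for t
    unfolding exp_eq_shift by (intro exI[of _ "- k"]) (simp add: complex_eq_iff)
  moreover have "path (\<lambda>t. f t + Complex 0 (2 * pi * of_int k))"
    using assms unfolding lifts_def path_def by (intro continuous_intros) auto
  ultimately show ?thesis
    using assms by (auto simp: lifts_def strip_def)
qed

context
  fixes m n :: nat
  assumes m: "m > 0" and n: "n > 0"
begin

lemma lifted_shift: "lifted m n (shift m n k v) = lifted m n v + Complex 0 (2 * pi * of_int k)"
  using m n by (cases v) (auto simp: complex_eq_iff field_simps)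

lemma lifted_eq: "lifted m n u = lifted m n v \<longleftrightarrow> u = v"
  using m n by (cases u; cases v) (auto simp: complex_eq_iff)

lemma lifted_strip: "lifted m n v \<in> strip"
  by (cases v) (auto simp: strip_def)

lemma exp_lifted_eq: "exp (lifted m n u) = exp (lifted m n v) \<longleftrightarrow> (\<exists>k. u = shift m n k v)"
  unfolding exp_eq_shift lifted_shift[symmetric] lifted_eq ..

lemma exp_lifted_Outer: "exp (lifted m n (Outer (int k))) = outer_point m k"
  by (simp add: outer_point_def exp_eq_polar)

lemma exp_lifted_Inner: "exp (lifted m n (Inner (int k))) = inner_point n k"
  by (simp add: inner_point_def exp_eq_polar)

lemma shift_mod:
  "\<exists>k j. j < m \<and> Outer i = shift m n k (Outer (int j))"
  "\<exists>k j. j < n \<and> Inner i = shift m n k (Inner (int j))"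
proof -
  have *: "nat (i mod int p) < p" "i = int (nat (i mod int p)) + (i div int p) * int p" if "p > 0" for p
    using that by (auto simp: nat_less_iff)
  show "\<exists>k j. j < m \<and> Outer i = shift m n k (Outer (int j))"
    using *[OF m] by (intro exI[of _ "i div int m"] exI[of _ "nat (i mod int m)"]) simp
  show "\<exists>k j. j < n \<and> Inner i = shift m n k (Inner (int j))"
    using *[OF n] by (intro exI[of _ "i div int n"] exI[of _ "nat (i mod int n)"]) simp
qed

lemma marked_iff_lifted: "p \<in> marked_points m n \<longleftrightarrow> (\<exists>v. p = exp (lifted m n v))"
proof
  assume "p \<in> marked_points m n"
  then show "\<exists>v. p = exp (lifted m n v)"
    using exp_lifted_Outer exp_lifted_Inner unfolding marked_points_def by (metis Un_iff imageE)
next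
  assume "\<exists>v. p = exp (lifted m n v)"
  then obtain v where v: "p = exp (lifted m n v)" by blast
  show "p \<in> marked_points m n"
  proof (cases v)
    case (Outer i)
    then obtain k j where "j < m" "v = shift m n k (Outer (int j))" using shift_mod(1) by blast
    then have "p = outer_point m j" using v exp_lifted_eq exp_lifted_Outer by metis
    then show ?thesis using \<open>j < m\<close> by (simp add: marked_points_def)
  next
    case (Inner i)
    then obtain k j where "j < n" "v = shift m n k (Inner (int j))" using shift_mod(2) by blast
    then have "p = inner_point n j" using v exp_lifted_eq exp_lifted_Inner by metis
    then show ?thesis using \<open>j < n\<close> by (simp add: marked_points_def)
  qed
qed

lemma exp_marked: "exp z \<in> marked_points m n \<longleftrightarrow> (\<exists>v. z = lifted m n v)"
proof
  assume "exp z \<in> marked_points m n"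
  then obtain v k where "z = lifted m n v + Complex 0 (2 * pi * of_int k)"
    unfolding marked_iff_lifted exp_eq_shift by blast
  then show "\<exists>v. z = lifted m n v" using lifted_shift by metis
qed (auto simp: marked_iff_lifted)

lemma curve_classI: "lifts f g \<Longrightarrow> pathstart f = lifted m n u \<Longrightarrow> pathfinish f = lifted m n v \<Longrightarrow> g \<in> curve_class m n u v"
  unfolding curve_class_def by blast

lemma curve_classE:
  assumes "g \<in> curve_class m n u v"
  obtains f where "lifts f g" "pathstart f = lifted m n u" "pathfinish f = lifted m n v"
  using assms unfolding curve_class_def by blast

lemma curve_class_ends:
  assumes "g \<in> curve_class m n u v"
  shows "pathstart g = exp (lifted m n u)" "pathfinish g = exp (lifted m n v)" "path g" "path_image g \<subseteq> annulus"
proof -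
  obtain f where "lifts f g" "pathstart f = lifted m n u" "pathfinish f = lifted m n v"
    using assms by (rule curve_classE)
  then show "pathstart g = exp (lifted m n u)" "pathfinish g = exp (lifted m n v)" "path g" "path_image g \<subseteq> annulus"
    using lifts_path[of f g] by simp_all
qed

lemma curve_class_exists:
  assumes "path g" "path_image g \<subseteq> annulus" "pathstart g = exp (lifted m n u)" "pathfinish g \<in> marked_points m n"
  obtains v where "g \<in> curve_class m n u v"
proof -
  obtain f where f: "lifts f g" "pathstart f = lifted m n u"
    using lifts_exists assms by blast
  then have "exp (pathfinish f) \<in> marked_points m n" using assms lifts_path(4) by metis
  then obtain v where "pathfinish f = lifted m n v" using exp_marked by blast
  then show ?thesis using f that curve_classI by blast
qed

lemma curve_class_shift_subset: "curve_class m n u v \<subseteq> curve_class m n (shift m n k u) (shift m n k v)"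
proof
  fix g assume "g \<in> curve_class m n u v"
  then obtain f where f: "lifts f g" "pathstart f = lifted m n u" "pathfinish f = lifted m n v"
    by (rule curve_classE)
  let ?f = "\<lambda>t. f t + Complex 0 (2 * pi * of_int k)"
  have "lifts ?f g" using lifts_shift f(1) .
  then show "g \<in> curve_class m n (shift m n k u) (shift m n k v)"
    using f by (intro curve_classI[of ?f]) (auto simp: lifted_shift pathstart_def pathfinish_def)
qed

lemma shift_shift: "shift m n k (shift m n l u) = shift m n (k + l) u" "shift m n 0 u = u"
  by (cases u; simp add: algebra_simps)+

lemma curve_class_shift: "curve_class m n (shift m n k u) (shift m n k v) = curve_class m n u v"
  using curve_class_shift_subset[of u v k] curve_class_shift_subset[of "shift m n k u" "shift m n k v" "- k"]
  by (simp add: shift_shift)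

text \<open>Two lifts of one curve differ by a deck translation at the start, and by uniqueness of
  lifting then also at the end.\<close>

lemma curve_class_disjoint:
  assumes "g \<in> curve_class m n u v" "g \<in> curve_class m n u' v'"
  shows "\<exists>k. u' = shift m n k u \<and> v' = shift m n k v"
proof -
  obtain k where k: "u' = shift m n k u"
    using curve_class_ends(1)[OF assms(1)] curve_class_ends(1)[OF assms(2)] exp_lifted_eq by metis
  have "g \<in> curve_class m n u' (shift m n k v)"
    using assms(1) k curve_class_shift by simp
  then obtain f f' where "lifts f g" "pathstart f = lifted m n u'" "pathfinish f = lifted m n (shift m n k v)"
    "lifts f' g" "pathstart f' = lifted m n u'" "pathfinish f' = lifted m n v'"
    using assms(2) unfolding curve_class_def by blast
  moreover have "homotopic_paths annulus g g"
    using curve_class_ends[OF assms(1)] by simp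
  ultimately have "shift m n k v = v'"
    using lifts_homotopic[of f g f' g] lifted_eq by simp
  then show ?thesis using k by blast
qed

lemma homotopy_class_curve_class:
  assumes "g \<in> curve_class m n u v"
  shows "homotopy_class g = curve_class m n u v"
proof -
  obtain f where f: "lifts f g" "pathstart f = lifted m n u" "pathfinish f = lifted m n v"
    using assms by (rule curve_classE)
  have "h \<in> curve_class m n u v" if hom: "homotopic_paths annulus g h" for h
  proof -
    have h: "path h" "path_image h \<subseteq> annulus" "pathstart h = exp (pathstart f)"
      using hom homotopic_paths_imp_path homotopic_paths_imp_subset homotopic_paths_imp_pathstart lifts_path(3)[OF f(1)]
      by metis+
    then obtain f' where "lifts f' h" "pathstart f' = pathstart f" using lifts_exists by blast
    then show ?thesis
      using lifts_homotopic[OF f(1), of f' h] hom f by (intro curve_classI) auto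
  qed
  moreover have "homotopic_paths annulus g h" if "h \<in> curve_class m n u v" for h
    using that f lifts_homotopic[OF f(1)] unfolding curve_class_def by auto
  ultimately show ?thesis unfolding homotopy_class_def by blast
qed

lemma curve_class_reversepath: "g \<in> curve_class m n u v \<Longrightarrow> reversepath g \<in> curve_class m n v u"
  unfolding curve_class_def using lifts_reversepath by fastforce

lemma curve_class_joinpaths: "g \<in> curve_class m n u v \<Longrightarrow> h \<in> curve_class m n v w \<Longrightarrow> g +++ h \<in> curve_class m n u w"
  unfolding curve_class_def using lifts_joinpaths by fastforce

lemma curve_class_nonempty: "curve_class m n u v \<noteq> {}"
proof -
  let ?f = "linepath (lifted m n u) (lifted m n v)"
  have "path_image ?f \<subseteq> strip"
    using closed_segment_subset[OF lifted_strip lifted_strip convex_strip] by simp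
  then have "lifts ?f (exp \<circ> ?f)" by (auto simp: lifts_def path_image_def)
  then show ?thesis using curve_classI[of ?f "exp \<circ> ?f" u v] by auto
qed

lemma curve_class_inj: "curve_class m n u v = curve_class m n u w \<longleftrightarrow> v = w"
proof
  assume eq: "curve_class m n u v = curve_class m n u w"
  obtain g where g: "g \<in> curve_class m n u v" using curve_class_nonempty by blast
  then obtain f f' where "lifts f g" "pathstart f = lifted m n u" "pathfinish f = lifted m n v"
    "lifts f' g" "pathstart f' = lifted m n u" "pathfinish f' = lifted m n w"
    using eq unfolding curve_class_def by blast
  moreover have "homotopic_paths annulus g g"
    using curve_class_ends[OF g] by simp
  ultimately show "v = w"
    using lifts_homotopic[of f g f' g] lifted_eq by simp
qed simp

end

section \<open>Crossings and boundary curves in the strip\<close>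

text \<open>Compactness encloses both paths in a rectangle resting on the real axis, with the four
  ends interlaced on its lower edge. This is the situation of \<open>fashoda_interlace\<close>,
  after identifying the plane with \<open>real^2\<close>.\<close>

lemma halfplane_interlace:
  fixes f g :: "real \<Rightarrow> complex"
  assumes "path f" "path g"
    and Im: "\<And>t. t \<in> {0..1} \<Longrightarrow> Im (f t) \<ge> 0" "\<And>t. t \<in> {0..1} \<Longrightarrow> Im (g t) \<ge> 0"
    and ends: "Im (f 0) = 0" "Im (f 1) = 0" "Im (g 0) = 0" "Im (g 1) = 0"
    and less: "Re (f 0) < Re (g 0)" "Re (g 0) < Re (f 1)" "Re (f 1) < Re (g 1)"
  shows "\<exists>s\<in>{0..1}. \<exists>t\<in>{0..1}. f s = g t"
proof -
  define \<phi> :: "complex \<Rightarrow> real^2" where "\<phi> z = vector [Re z, Im z]" for z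
  have nth: "\<phi> z $ 1 = Re z" "\<phi> z $ 2 = Im z" for z
    by (simp_all add: \<phi>_def)
  have cont: "continuous_on S \<phi>" for S
  proof -
    have "\<phi> = (\<lambda>z. \<chi> i. if i = 1 then Re z else Im z)"
      by (simp add: fun_eq_iff vec_eq_iff forall_2 nth)
    moreover have "continuous_on S (\<lambda>z. if i = 1 then Re z else Im z)" for i :: 2
      by (cases "i = 1") (auto intro: continuous_intros)
    ultimately show ?thesis
      by (simp add: continuous_on_vec_lambda)
  qed
  have "bounded (path_image f \<union> path_image g)"
    using assms by (simp add: bounded_path_image)
  then obtain B where B: "\<And>z. z \<in> path_image f \<union> path_image g \<Longrightarrow> norm z \<le> B"
    unfolding bounded_iff by blast
  have box: "path_image (\<phi> \<circ> h) \<subseteq> cbox (vector [- B, 0]) (vector [B, B])"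
    if "path_image h \<subseteq> path_image f \<union> path_image g" "\<And>t. t \<in> {0..1} \<Longrightarrow> Im (h t) \<ge> 0" for h
  proof -
    have "- B \<le> Re (h t) \<and> Re (h t) \<le> B \<and> Im (h t) \<le> B" if "t \<in> {0..1}" for t
    proof -
      have "h t \<in> path_image h" using that by (simp add: path_image_def)
      then have "norm (h t) \<le> B" using B \<open>path_image h \<subseteq> _\<close> by blast
      then show ?thesis using abs_Re_le_cmod[of "h t"] abs_Im_le_cmod[of "h t"] by linarith
    qed
    then show ?thesis
      using that(2) by (auto simp: path_image_def mem_box_cart forall_2 nth)
  qed
  obtain z where "z \<in> path_image (\<phi> \<circ> f)" "z \<in> path_image (\<phi> \<circ> g)"
  proof (rule fashoda_interlace)
    show "path (\<phi> \<circ> f)" "path (\<phi> \<circ> g)"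
      using assms cont by (auto intro: path_continuous_image)
    show "path_image (\<phi> \<circ> f) \<subseteq> cbox (vector [- B, 0]) (vector [B, B])"
      "path_image (\<phi> \<circ> g) \<subseteq> cbox (vector [- B, 0]) (vector [B, B])"
      using Im by (intro box; simp)+
  qed (use ends less in \<open>simp_all add: pathstart_def pathfinish_def nth\<close>)
  then obtain s t where "s \<in> {0..1}" "t \<in> {0..1}" "\<phi> (f s) = \<phi> (g t)"
    by (auto simp: path_image_def)
  then show ?thesis
    using nth by (metis complex_eqI)
qed

text \<open>The strip becomes the upper half-plane and both of its sides lie on the real line, so that one
  application of Fashoda's theorem covers all kinds of crossings.\<close>

definition to_halfplane :: "complex \<Rightarrow> complex" where
  "to_halfplane z = exp (of_real (pi / ln 2) * Complex (Im z) (Re z))"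

lemma to_halfplane_Re_Im:
  "Re (to_halfplane z) = exp (pi / ln 2 * Im z) * cos (pi / ln 2 * Re z)"
  "Im (to_halfplane z) = exp (pi / ln 2 * Im z) * sin (pi / ln 2 * Re z)"
  by (simp_all add: to_halfplane_def Re_exp Im_exp)

lemma strip_angle:
  assumes "z \<in> strip"
  shows "0 \<le> pi / ln 2 * Re z" "pi / ln 2 * Re z \<le> pi"
  using assms by (auto simp: strip_def field_simps)

lemma to_halfplane_inj:
  assumes "z \<in> strip" "w \<in> strip" "to_halfplane z = to_halfplane w"
  shows "z = w"
proof -
  have "pi / ln 2 * Im z = pi / ln 2 * Im w"
  proof -
    have "norm (to_halfplane z) = norm (to_halfplane w)" using assms by simp
    then show ?thesis by (simp add: to_halfplane_def norm_exp_eq_Re)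
  qed
  then have Im: "Im z = Im w" by simp
  then have "cos (pi / ln 2 * Re z) = cos (pi / ln 2 * Re w)"
    using assms(3) to_halfplane_Re_Im(1)[of z] to_halfplane_Re_Im(1)[of w] by simp
  then have "pi / ln 2 * Re z = pi / ln 2 * Re w"
    using strip_angle[OF assms(1)] strip_angle[OF assms(2)] by (metis cos_inj_pi)
  then show ?thesis using Im by (simp add: complex_eq_iff)
qed

lemma ivt_either:
  fixes y :: "real \<Rightarrow> real"
  assumes "continuous_on {a..b} y" "a \<le> b" "y a \<le> c \<and> c \<le> y b \<or> y b \<le> c \<and> c \<le> y a"
  obtains t where "t \<in> {a..b}" "y t = c"
  using IVT'[of y a c b] IVT2'[of y b c a] assms by auto

text \<open>The value of \<open>\<sigma>\<close> tells on which side of the boundary line the strip lies.\<close>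

definition component :: "nat \<Rightarrow> nat \<Rightarrow> (int \<Rightarrow> vertex) \<Rightarrow> nat \<Rightarrow> real \<Rightarrow> real \<Rightarrow> bool" where
  "component m n c p r \<sigma> \<longleftrightarrow> c = Outer \<and> p = m \<and> r = ln 2 \<and> \<sigma> = -1 \<or> c = Inner \<and> p = n \<and> r = 0 \<and> \<sigma> = 1"

lemma component_Outer: "component m n Outer m (ln 2) (-1)"
  and component_Inner: "component m n Inner n 0 1"
  by (simp_all add: component_def)

lemma component_simps:
  assumes "component m n c p r \<sigma>"
  shows "lifted m n (c i) = Complex r (2 * pi * of_int i / of_nat p)" "c i = c j \<longleftrightarrow> i = j"
    "neighbours (c i) (c j) \<longleftrightarrow> \<bar>i - j\<bar> = 1"
    "chord m n (c i) (c j) \<longleftrightarrow> 2 \<le> \<bar>i - j\<bar> \<and> \<bar>i - j\<bar> \<le> int p"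
    "shift m n k (c i) = c (i + k * int p)" "r = 0 \<or> r = ln 2"
  using assms by (auto simp: component_def)

lemma vertex_pair_cases:
  obtains c p r \<sigma> i j where "component m n c p r \<sigma>" "u = c i" "v = c j"
  | i j where "u = Outer i" "v = Inner j" | i j where "u = Inner j" "v = Outer i"
  using component_Outer component_Inner by (cases u; cases v) metis+

context
  fixes m n :: nat
  assumes m: "m > 0" and n: "n > 0"
begin

lemma component_pos: "component m n c p r \<sigma> \<Longrightarrow> p > 0"
  using m n by (auto simp: component_def)

text \<open>The outer side goes to the negative half-axis, where growing indices run to the left,
  and the inner side to the positive one. This is the origin of \<open>\<lhd>\<close>.\<close>

lemma to_halfplane_lifted:
  "Im (to_halfplane (lifted m n u)) = 0"
  "u \<lhd> v \<Longrightarrow> Re (to_halfplane (lifted m n u)) < Re (to_halfplane (lifted m n v))"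
proof -
  show "Im (to_halfplane (lifted m n u)) = 0"
    by (cases u) (simp_all add: to_halfplane_Re_Im)
  have O: "Re (to_halfplane (lifted m n (Outer i))) = - exp (pi / ln 2 * (2 * pi * of_int i / of_nat m))" for i
    by (simp add: to_halfplane_Re_Im)
  have I: "Re (to_halfplane (lifted m n (Inner i))) = exp (pi / ln 2 * (2 * pi * of_int i / of_nat n))" for i
    by (simp add: to_halfplane_Re_Im)
  have less: "pi / ln 2 * (2 * pi * of_int i / of_nat p) < pi / ln 2 * (2 * pi * of_int j / of_nat p)"
    if "i < j" "p > 0" for i j :: int and p :: nat
    using that by (intro mult_strict_left_mono divide_strict_right_mono) simp_all
  show "Re (to_halfplane (lifted m n u)) < Re (to_halfplane (lifted m n v))" if "u \<lhd> v"
  proof (cases u; cases v)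
    fix i j assume "u = Outer i" "v = Inner j"
    then show ?thesis unfolding O I by (metis O I exp_gt_zero neg_less_0_iff_less order_less_trans)
  qed (use that less m n in \<open>auto simp: O I simp del: lifted.simps\<close>)
qed

text \<open>Stated for arbitrary paths in the strip, so that reversing a path or exchanging the two
  reduces all eight interlaced orders of the four ends to the one treated in
  \<open>meet_interlace\<close>.\<close>

definition meet :: "vertex \<Rightarrow> vertex \<Rightarrow> vertex \<Rightarrow> vertex \<Rightarrow> bool" where
  "meet u v x y \<longleftrightarrow> (\<forall>f g. path f \<and> path g \<and> (\<forall>t\<in>{0..1}. f t \<in> strip \<and> g t \<in> strip) \<and>
     f 0 = lifted m n u \<and> f 1 = lifted m n v \<and> g 0 = lifted m n x \<and> g 1 = lifted m n y \<longrightarrow>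
     (\<exists>s\<in>{0..1}. \<exists>t\<in>{0..1}. f s = g t))"

lemma meetD: "\<lbrakk>meet u v x y; path f; path g; \<And>t. t \<in> {0..1} \<Longrightarrow> f t \<in> strip; \<And>t. t \<in> {0..1} \<Longrightarrow> g t \<in> strip;
  f 0 = lifted m n u; f 1 = lifted m n v; g 0 = lifted m n x; g 1 = lifted m n y\<rbrakk> \<Longrightarrow>
  \<exists>s\<in>{0..1}. \<exists>t\<in>{0..1}. f s = g t"
  unfolding meet_def by blast

lemma meet_interlace:
  assumes "u \<lhd> x" "x \<lhd> v" "v \<lhd> y"
  shows "meet u v x y"
  unfolding meet_def
proof (intro allI impI; elim conjE)
  fix f g assume fg: "path f" "path g" "\<forall>t\<in>{0..1}. f t \<in> strip \<and> g t \<in> strip"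
    "f 0 = lifted m n u" "f 1 = lifted m n v" "g 0 = lifted m n x" "g 1 = lifted m n y"
  have cont: "continuous_on S to_halfplane" for S
    unfolding to_halfplane_def Complex_eq by (intro continuous_intros)
  have "\<exists>s\<in>{0..1}. \<exists>t\<in>{0..1}. (to_halfplane \<circ> f) s = (to_halfplane \<circ> g) t"
  proof (rule halfplane_interlace)
    show "path (to_halfplane \<circ> f)" "path (to_halfplane \<circ> g)"
      using fg cont by (auto intro: path_continuous_image)
    have Im: "Im (to_halfplane z) \<ge> 0" if "z \<in> strip" for z
      unfolding to_halfplane_Re_Im using strip_angle[OF that] by (simp add: sin_ge_zero)
    show "Im ((to_halfplane \<circ> f) t) \<ge> 0" "Im ((to_halfplane \<circ> g) t) \<ge> 0" if "t \<in> {0..1}" for t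
      using Im fg(3) that by auto
  qed (use fg to_halfplane_lifted assms in auto)
  then show "\<exists>s\<in>{0..1}. \<exists>t\<in>{0..1}. f s = g t"
    using fg(3) to_halfplane_inj unfolding comp_def by metis
qed

lemma meet_sym:
  assumes "meet u v x y"
  shows "meet x y u v" "meet v u x y"
proof -
  show "meet x y u v"
    unfolding meet_def
  proof (intro allI impI; elim conjE)
    fix f g assume fg: "path f" "path g" "\<forall>t\<in>{0..1}. f t \<in> strip \<and> g t \<in> strip"
      "f 0 = lifted m n x" "f 1 = lifted m n y" "g 0 = lifted m n u" "g 1 = lifted m n v"
    have "\<exists>s\<in>{0..1}. \<exists>t\<in>{0..1}. g s = f t"
      by (rule meetD[OF assms]) (use fg in auto)
    then show "\<exists>s\<in>{0..1}. \<exists>t\<in>{0..1}. f s = g t" by metis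
  qed
  show "meet v u x y"
    unfolding meet_def
  proof (intro allI impI; elim conjE)
    fix f g assume fg: "path f" "path g" "\<forall>t\<in>{0..1}. f t \<in> strip \<and> g t \<in> strip"
      "f 0 = lifted m n v" "f 1 = lifted m n u" "g 0 = lifted m n x" "g 1 = lifted m n y"
    have "\<exists>s\<in>{0..1}. \<exists>t\<in>{0..1}. reversepath f s = g t"
      by (rule meetD[OF assms]) (use fg in \<open>auto simp: reversepath_def path_reversepath[of f, unfolded reversepath_def]\<close>)
    then obtain s t where "s \<in> {0..1}" "t \<in> {0..1}" "f (1 - s) = g t" by (auto simp: reversepath_def)
    then show "\<exists>s\<in>{0..1}. \<exists>t\<in>{0..1}. f s = g t"
      by (intro bexI[of _ "1 - s"] bexI[of _ t]) auto
  qed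
qed

lemma crosses_meet:
  assumes "crosses u v x y"
  shows "meet u v x y"
proof -
  have between: "meet u v x y" if b: "between u v x" "beyond u v y" for u v x y
  proof -
    consider "u \<lhd> x" "x \<lhd> v" "v \<lhd> y" | "u \<lhd> x" "x \<lhd> v" "y \<lhd> u"
      | "v \<lhd> x" "x \<lhd> u" "u \<lhd> y" | "v \<lhd> x" "x \<lhd> u" "y \<lhd> v"
      using b unfolding between_def beyond_def by blast
    then show ?thesis
      by cases (meson meet_interlace meet_sym)+
  qed
  then show ?thesis
    using assms meet_sym unfolding crosses_def by meson
qed

text \<open>The meeting point is no end of either curve: the four ends are distinct and lie on the
  boundary, which the interiors of the curves avoid.\<close>

lemma crosses_imp_interior_meet:
  assumes cr: "crosses u v x y"
    and f: "lifts f g" "f 0 = lifted m n u" "f 1 = lifted m n v" "g ` {0<..<1} \<inter> annulus_boundary = {}"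
    and f': "lifts f' g'" "f' 0 = lifted m n x" "f' 1 = lifted m n y" "g' ` {0<..<1} \<inter> annulus_boundary = {}"
  shows "\<exists>s\<in>{0<..<1}. \<exists>t\<in>{0<..<1}. f s = f' t"
proof -
  have "\<exists>s\<in>{0..1}. \<exists>t\<in>{0..1}. f s = f' t"
    by (rule meetD[OF crosses_meet[OF cr]]) (use f f' in \<open>auto simp: lifts_def\<close>)
  then obtain s t where st: "s \<in> {0..1}" "t \<in> {0..1}" "f s = f' t" by blast
  have bdry: "Re (lifted m n w) = 0 \<or> Re (lifted m n w) = ln 2" for w
    by (cases w) auto
  have interior: "Re (f s) \<noteq> 0 \<and> Re (f s) \<noteq> ln 2" if "lifts f g" "g ` {0<..<1} \<inter> annulus_boundary = {}" "s \<in> {0<..<1}" for f g s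
  proof -
    have "exp (f s) \<notin> annulus_boundary" using that by (force simp: lifts_def)
    then show ?thesis by (simp add: exp_in_boundary)
  qed
  have ne: "u \<noteq> x" "u \<noteq> y" "v \<noteq> x" "v \<noteq> y"
    using cr precedes_irrefl unfolding crosses_defs by blast+
  have "f s = lifted m n u \<or> f s = lifted m n v" if "s \<notin> {0<..<1}"
    using that st(1) f by (cases "s = 0"; cases "s = 1") auto
  moreover have "f' t = lifted m n x \<or> f' t = lifted m n y" if "t \<notin> {0<..<1}"
    using that st(2) f' by (cases "t = 0"; cases "t = 1") auto
  ultimately show ?thesis
    using st(3) ne bdry interior[OF f(1,4)] interior[OF f'(1,4)] lifted_eq[OF m n] st by metis
qed

section \<open>Curves running along the boundary\<close>

lemma boundary_lift_Re:
  assumes "lifts f g" "path_image g \<subseteq> annulus_boundary" "t \<in> {0..1}"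
  shows "Re (f t) = Re (f 0)"
proof (rule ccontr)
  assume ne: "Re (f t) \<noteq> Re (f 0)"
  have Re: "Re (f s) = 0 \<or> Re (f s) = ln 2" if "s \<in> {0..1}" for s
  proof -
    have "exp (f s) \<in> annulus_boundary" using assms that by (auto simp: lifts_def path_image_def)
    then show ?thesis by (simp add: exp_in_boundary)
  qed
  have "continuous_on {0..1} f" using assms by (simp add: lifts_def path_def)
  then have "continuous_on {0..t} f" using assms(3) by (rule_tac continuous_on_subset) auto
  then have cont: "continuous_on {0..t} (\<lambda>t. Re (f t))" by (intro continuous_intros)
  \<comment> \<open>Changing sides would mean crossing the middle of the strip, away from the
    boundary.\<close>
  have "Re (f 0) \<le> ln 2 / 2 \<and> ln 2 / 2 \<le> Re (f t) \<or> Re (f t) \<le> ln 2 / 2 \<and> ln 2 / 2 \<le> Re (f 0)"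
    using Re[of 0] Re[OF assms(3)] ne by auto
  then obtain s where "s \<in> {0..t}" "Re (f s) = ln 2 / 2"
    using ivt_either[of 0 t "\<lambda>t. Re (f t)" "ln 2 / 2"] cont assms(3) by auto
  then show False using Re[of s] assms(3) by auto
qed

text \<open>By the intermediate value theorem a curve along one side sweeps over every vertex
  between its ends. This limits boundary segments to neighbours and keeps chords from being
  contractible.\<close>

lemma boundary_lift:
  assumes "lifts f g" "path_image g \<subseteq> annulus_boundary" "f 0 = lifted m n u" "f 1 = lifted m n v"
  obtains c p r \<sigma> i j where "component m n c p r \<sigma>" "u = c i" "v = c j"
    "\<And>k. i < k \<and> k < j \<or> j < k \<and> k < i \<Longrightarrow> \<exists>t\<in>{0<..<1}. f t = lifted m n (c k)"
proof (cases rule: vertex_pair_cases[of m n u v])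
  case (1 c p r \<sigma> i j)
  have cont: "continuous_on {0..1} (\<lambda>t. Im (f t))"
    using assms by (intro continuous_intros) (auto simp: lifts_def path_def)
  have p: "p > 0" using component_pos 1 by blast
  have "\<exists>t\<in>{0<..<1}. f t = lifted m n (c k)" if k: "i < k \<and> k < j \<or> j < k \<and> k < i" for k
  proof -
    have le: "2 * pi * real_of_int a / real p \<le> 2 * pi * real_of_int b / real p" if "a \<le> b" for a b
      using that by (intro divide_right_mono mult_left_mono) auto
    have "Im (f 0) \<le> 2 * pi * k / p \<and> 2 * pi * k / p \<le> Im (f 1) \<or>
        Im (f 1) \<le> 2 * pi * k / p \<and> 2 * pi * k / p \<le> Im (f 0)"
      using k le assms 1 component_simps(1)[OF 1(1)] by auto
    then obtain t where t: "t \<in> {0..1}" "Im (f t) = 2 * pi * k / p"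
      using ivt_either[OF cont] by auto
    moreover have "Re (f t) = r"
      using boundary_lift_Re[OF assms(1,2) t(1)] assms(3) 1 component_simps(1)[OF 1(1)] by simp
    ultimately have eq: "f t = lifted m n (c k)"
      using component_simps(1)[OF 1(1)] by (simp add: complex_eq_iff)
    moreover have "t \<noteq> 0" "t \<noteq> 1"
      using eq assms k 1 lifted_eq[OF m n] component_simps(2)[OF 1(1)] by auto
    ultimately show ?thesis using t by (intro bexI[of _ t]) auto
  qed
  then show ?thesis using that 1 by blast
qed (use boundary_lift_Re[OF assms(1,2), of 1] assms in auto)

lemma boundary_segment_neighbours:
  assumes "boundary_segment m n h" "h \<in> curve_class m n u v"
  shows "neighbours u v"
proof -
  obtain f where f: "lifts f h" "f 0 = lifted m n u" "f 1 = lifted m n v"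
    using curve_classE[OF m n assms(2)] by (metis pathstart_def pathfinish_def)
  have h: "path_image h \<subseteq> annulus_boundary" "simple_path h"
    "path_image h \<inter> marked_points m n = {h 0, h 1}"
    using assms by (auto simp: boundary_segment_def pathstart_def pathfinish_def)
  have he: "h t = exp (f t)" if "t \<in> {0..1}" for t using f that by (auto simp: lifts_def)
  have inj: "s = t" if "h s = h t" "s \<in> {0..1}" "t \<in> {0<..<1}" for s t
    using h(2) that unfolding simple_path_def loop_free_def by fastforce
  obtain c p r \<sigma> i j where c: "component m n c p r \<sigma>" "u = c i" "v = c j"
    and mid: "\<And>k. i < k \<and> k < j \<or> j < k \<and> k < i \<Longrightarrow> \<exists>t\<in>{0<..<1}. f t = lifted m n (c k)"
    using boundary_lift[OF f(1) h(1) f(2,3)] by metis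
  have nomid: "\<not> (i < k \<and> k < j \<or> j < k \<and> k < i)" for k
  proof
    assume "i < k \<and> k < j \<or> j < k \<and> k < i"
    then obtain t where t: "t \<in> {0<..<1}" "f t = lifted m n (c k)" using mid by blast
    then have "h t \<in> marked_points m n"
      using he[of t] marked_iff_lifted[OF m n] by auto
    moreover have "h t \<in> path_image h"
      using t unfolding path_image_def by (intro imageI) auto
    ultimately have "h t \<in> {h 0, h 1}" using h(3) by blast
    then have "h 0 = h t \<or> h 1 = h t" by auto
    then show False using inj[of 0 t] inj[of 1 t] t by auto
  qed
  \<comment> \<open>A lift with equal ends would move along a line from \<open>?y 0\<close> to
    \<open>?y (1/2)\<close> and back, taking the intermediate value \<open>?c\<close> once in each
    half, against simplicity. A full boundary circle is not concerned: its lift ends at an adjacent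
    vertex.\<close>
  have "i \<noteq> j"
  proof
    assume "i = j"
    then have eq: "f 0 = f 1" using f c by simp
    let ?y = "\<lambda>t. Im (f t)"
    have cont: "continuous_on {0..1} ?y"
      using f by (intro continuous_intros) (auto simp: lifts_def path_def)
    have feq: "s = t" if "?y s = ?y t" "s \<in> {0..1}" "t \<in> {0<..<1}" for s t
    proof -
      have "f s = f t"
        using that boundary_lift_Re[OF f(1) h(1), of s] boundary_lift_Re[OF f(1) h(1), of t]
        by (simp add: complex_eq_iff)
      then show ?thesis using inj[of s t] he that by auto
    qed
    have ne: "?y (1/2) \<noteq> ?y 0" using feq[of 0 "1/2"] by auto
    let ?c = "(?y 0 + ?y (1/2)) / 2"
    obtain s where s: "s \<in> {0..1/2}" "?y s = ?c"
      using ivt_either[of 0 "1/2" ?y ?c] continuous_on_subset[OF cont] by force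
    obtain t where t: "t \<in> {1/2..1}" "?y t = ?c"
      using ivt_either[of "1/2" 1 ?y ?c] continuous_on_subset[OF cont] eq by force
    have "?y s \<noteq> ?y 0" "?y s \<noteq> ?y (1/2)" using s(2) ne by auto
    then have "s \<noteq> 0" "s \<noteq> 1/2" by metis+
    then have "t = s" using feq[of t s] s t by auto
    then show False using s t \<open>s \<noteq> 1/2\<close> by auto
  qed
  have "\<bar>i - j\<bar> = 1"
    using nomid[of "i + 1"] nomid[of "i - 1"] \<open>i \<noteq> j\<close> by auto
  then show ?thesis using c component_simps(3)[OF c(1)] by simp
qed

lemma neighbours_boundary_segment:
  assumes "neighbours u v"
  obtains h where "boundary_segment m n h" "h \<in> curve_class m n u v"
proof -
  obtain c p r \<sigma> i j where c: "component m n c p r \<sigma>" "u = c i" "v = c j"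
    using assms by (cases rule: vertex_pair_cases[of m n u v]) auto
  have ij: "\<bar>i - j\<bar> = 1" using assms c component_simps(3)[OF c(1)] by simp
  have p: "p > 0" using component_pos c by blast
  let ?f = "linepath (lifted m n u) (lifted m n v)" and ?a = "\<lambda>t. real_of_int i + t * real_of_int (j - i)"
  have f: "?f t = Complex r (2 * pi * ?a t / p)" for t
    unfolding c(2,3) component_simps(1)[OF c(1)] linepath_def
    by (simp add: complex_eq_iff algebra_simps add_divide_distrib diff_divide_distrib)
  have ft: "?f t \<in> strip" for t
    unfolding f using component_simps(6)[OF c(1)] by (auto simp: strip_def)
  have lifts: "lifts ?f (exp \<circ> ?f)"
    using ft by (simp add: lifts_def)
  have curve_class: "exp \<circ> ?f \<in> curve_class m n u v"
    by (rule curve_classI[OF m n lifts]) simp_all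
  have "boundary_segment m n (exp \<circ> ?f)"
    unfolding boundary_segment_def
  proof (intro conjI)
    \<comment> \<open>Equal values force \<open>\<bar>s - t\<bar>\<close> to be a multiple of
      \<open>p\<close>, and it is at most 1. The value 1 arises only for \<open>p = 1\<close>, where
      the segment closes up to a circle.\<close>
    have ends: "s = t \<or> s = 0 \<and> t = 1 \<or> s = 1 \<and> t = 0"
      if "s \<in> {0..1}" "t \<in> {0..1}" and e: "exp (?f s) = exp (?f t)" for s t
    proof -
      obtain k :: int where "2 * pi * ?a s / p = 2 * pi * ?a t / p + 2 * pi * k"
        using e unfolding exp_eq_shift f by (auto simp: complex_eq_iff)
      then have "2 * pi * ?a s = 2 * pi * (?a t + k * p)"
        using p by (simp add: field_simps)
      then have "?a s = ?a t + k * p" by (simp only: mult_cancel_left) simp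
      then have *: "(s - t) * real_of_int (j - i) = real_of_int (k * int p)" by (simp add: algebra_simps)
      then have "\<bar>s - t\<bar> = real_of_int \<bar>k * int p\<bar>"
        using ij by (simp add: abs_mult[symmetric] abs_minus_commute)
          (metis (no_types) abs_minus_commute abs_mult mult.right_neutral of_int_1 of_int_abs of_int_diff)
      moreover have "\<bar>s - t\<bar> \<le> 1" using that by auto
      ultimately have "real_of_int \<bar>k * int p\<bar> \<le> 1" by linarith
      then have "\<bar>k * int p\<bar> \<le> 1" by (simp only: of_int_le_1_iff)
      then have "\<bar>k * int p\<bar> = 0 \<or> \<bar>k * int p\<bar> = 1" by linarith
      then have "\<bar>s - t\<bar> = 0 \<or> \<bar>s - t\<bar> = 1"
        unfolding \<open>\<bar>s - t\<bar> = real_of_int \<bar>k * int p\<bar>\<close> by (elim disjE) (simp_all only: of_int_0 of_int_1 simp_thms)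
      then show ?thesis using that by auto
    qed
    have "path (exp \<circ> ?f)" using curve_class_ends(3)[OF m n curve_class] .
    then show "simple_path (exp \<circ> ?f)"
      using ends by (simp add: simple_path_def loop_free_def)
    show "path_image (exp \<circ> ?f) \<subseteq> annulus_boundary"
      using component_simps(6)[OF c(1)] by (auto simp: path_image_def exp_in_boundary f)
    show "path_image (exp \<circ> ?f) \<inter> marked_points m n = {pathstart (exp \<circ> ?f), pathfinish (exp \<circ> ?f)}"
    proof
      show "path_image (exp \<circ> ?f) \<inter> marked_points m n \<subseteq> {pathstart (exp \<circ> ?f), pathfinish (exp \<circ> ?f)}"
      proof
        fix z assume "z \<in> path_image (exp \<circ> ?f) \<inter> marked_points m n"
        then obtain t where t: "t \<in> {0..1}" "z = exp (?f t)" "exp (?f t) \<in> marked_points m n"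
          by (auto simp: path_image_def)
        then obtain w where w: "?f t = lifted m n w" using exp_marked[OF m n] by blast
        have "\<exists>k::int. ?a t = k"
        proof -
          obtain k :: int where "2 * pi * ?a t / p = 2 * pi * k / p"
            using w unfolding f using c(1) by (cases w) (auto simp: component_def)
          then have "2 * pi * ?a t = 2 * pi * k" using p by simp
          then show ?thesis by (intro exI[of _ k]) simp
        qed
        then obtain k :: int where "?a t = k" by blast
        then have "t * real_of_int (j - i) = real_of_int (k - i)" by simp
        then have "\<bar>t\<bar> * 1 = real_of_int \<bar>k - i\<bar>"
          using ij by (metis abs_minus_commute abs_mult of_int_1 of_int_abs)
        then have "t = real_of_int \<bar>k - i\<bar>" using t by simp
        then have "t = 0 \<or> t = 1" using t(1) by (auto simp del: of_int_abs)
        then show "z \<in> {pathstart (exp \<circ> ?f), pathfinish (exp \<circ> ?f)}"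
          using t by (auto simp: pathstart_def pathfinish_def)
      qed
      show "{pathstart (exp \<circ> ?f), pathfinish (exp \<circ> ?f)} \<subseteq> path_image (exp \<circ> ?f) \<inter> marked_points m n"
        using curve_class_ends[OF m n curve_class] marked_iff_lifted[OF m n]
        by (metis (no_types, lifting) IntI empty_subsetI insert_subset pathfinish_in_path_image pathstart_in_path_image)
    qed
  qed
  then show ?thesis using curve_class that by blast
qed

lemma contractible_trivial:
  assumes "g \<in> curve_class m n u v" "u = v \<or> neighbours u v"
  shows "contractible_into_boundary m n g"
proof -
  have "\<exists>h\<in>curve_class m n u v. path_image h \<subseteq> annulus_boundary \<and> path_image h \<inter> marked_points m n \<subseteq> {pathstart h, pathfinish h}"
  proof (cases "neighbours u v")
    case True
    then obtain h where "boundary_segment m n h" "h \<in> curve_class m n u v"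
      by (rule neighbours_boundary_segment)
    then show ?thesis by (intro bexI[of _ h]) (auto simp: boundary_segment_def)
  next
    case False
    then have "u = v" using assms(2) by blast
    let ?f = "\<lambda>t::real. lifted m n u"
    have "lifts ?f (exp \<circ> ?f)"
      using lifted_strip[OF m n] by (simp add: lifts_def path_def)
    then have "exp \<circ> ?f \<in> curve_class m n u v"
      using \<open>u = v\<close> by (intro curve_classI[OF m n]) (auto simp: pathstart_def pathfinish_def)
    moreover have "exp (lifted m n u) \<in> annulus_boundary"
      by (cases u) (simp_all add: exp_in_boundary)
    ultimately show ?thesis
      by (intro bexI[of _ "exp \<circ> ?f"]) (auto simp: path_image_def pathstart_def)
  qed
  then obtain h where h: "h \<in> curve_class m n u v" "path_image h \<subseteq> annulus_boundary"
    "path_image h \<inter> marked_points m n \<subseteq> {pathstart h, pathfinish h}" by blast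
  have "homotopic_paths annulus g h"
    using homotopy_class_curve_class[OF m n assms(1)] h(1) by (auto simp: homotopy_class_def)
  then show ?thesis
    unfolding contractible_into_boundary_def
    using h(2,3) curve_class_ends(1,2)[OF m n assms(1)] curve_class_ends(1,2)[OF m n h(1)]
    by (intro exI[of _ h] conjI) simp_all
qed

text \<open>A boundary curve in the class would have both ends on one side and pass the vertex
  \<open>c k\<close> next to the start. Its distances 1 and \<open>\<bar>i - j\<bar> - 1\<close>
  from the ends lie strictly between 0 and \<open>p\<close>, so it projects to a marked point
  different from both ends.\<close>

lemma chord_not_contractible:
  assumes "g \<in> curve_class m n u v" "chord m n u v"
  shows "\<not> contractible_into_boundary m n g"
proof
  assume "contractible_into_boundary m n g"
  then obtain h where h: "homotopic_paths annulus g h" "path_image h \<subseteq> annulus_boundary"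
    "path_image h \<inter> marked_points m n \<subseteq> {pathstart g, pathfinish g}"
    unfolding contractible_into_boundary_def by blast
  have "h \<in> curve_class m n u v"
    using homotopy_class_curve_class[OF m n assms(1)] h(1) by (auto simp: homotopy_class_def)
  then obtain f where f: "lifts f h" "f 0 = lifted m n u" "f 1 = lifted m n v"
    using curve_classE[OF m n] by (metis pathstart_def pathfinish_def)
  obtain c p r \<sigma> i j where c: "component m n c p r \<sigma>" "u = c i" "v = c j"
    and mid: "\<And>k. i < k \<and> k < j \<or> j < k \<and> k < i \<Longrightarrow> \<exists>t\<in>{0<..<1}. f t = lifted m n (c k)"
    using boundary_lift[OF f(1) h(2) f(2,3)] by metis
  have ij: "2 \<le> \<bar>i - j\<bar>" "\<bar>i - j\<bar> \<le> int p"
    using assms(2) c component_simps(4)[OF c(1)] by auto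
  define k where "k = (if i < j then i + 1 else i - 1)"
  have "i < k \<and> k < j \<or> j < k \<and> k < i" using ij by (auto simp: k_def)
  then obtain t where t: "t \<in> {0<..<1}" "f t = lifted m n (c k)" using mid by blast
  then have "h t = exp (lifted m n (c k))" using f by (auto simp: lifts_def)
  moreover from this have "h t \<in> marked_points m n"
    using marked_iff_lifted[OF m n] by auto
  moreover have "h t \<in> path_image h"
    using t unfolding path_image_def by (intro imageI) auto
  ultimately have "exp (lifted m n (c k)) = exp (lifted m n (c i)) \<or> exp (lifted m n (c k)) = exp (lifted m n (c j))"
    using h(3) curve_class_ends(1,2)[OF m n assms(1)] c by auto
  then obtain l where "k = i + l * int p \<or> k = j + l * int p"
    unfolding exp_lifted_eq[OF m n] component_simps(2,5)[OF c(1)] by blast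
  then have "int p dvd k - i \<or> int p dvd k - j" by auto
  then show False
    using ij zdvd_imp_le[of "int p" "k - i"] zdvd_imp_le[of "int p" "i - k"]
      zdvd_imp_le[of "int p" "k - j"] zdvd_imp_le[of "int p" "j - k"]
    by (auto simp: k_def dvd_diff_commute split: if_splits)
qed

end

section \<open>Disjoint representatives\<close>

text \<open>The direction in which a peripheral chord bulges away from its own side.\<close>

fun bend :: "vertex \<Rightarrow> vertex \<Rightarrow> real" where
  "bend (Outer _) (Outer _) = -1"
| "bend (Inner _) (Inner _) = 1"
| "bend _ _ = 0"

text \<open>Chords between the two sides are drawn as segments, all others as parabolas with a common small
  leading coefficient \<open>\<kappa>\<close>: two such parabolas differ by an affine function, hence meet at most once.\<close>

definition standard_lift :: "nat \<Rightarrow> nat \<Rightarrow> real \<Rightarrow> vertex \<Rightarrow> vertex \<Rightarrow> real \<Rightarrow> complex" where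
  "standard_lift m n \<kappa> u v t = linepath (lifted m n u) (lifted m n v) t +
     of_real (bend u v * \<kappa> * (Im (lifted m n v) - Im (lifted m n u))\<^sup>2 * t * (1 - t))"

lemma standard_lift_component:
  assumes "component m n c p r \<sigma>" and a: "a = 2 * pi * of_int i / p" and b: "b = 2 * pi * of_int j / p"
  shows "standard_lift m n \<kappa> (c i) (c j) t = Complex (r + \<sigma> * \<kappa> * ((b - a)\<^sup>2 * t * (1 - t))) (a + t * (b - a))"
proof -
  have "bend (c i) (c j) = \<sigma>" using assms(1) by (auto simp: component_def)
  moreover have "lifted m n (c i) = Complex r a" "lifted m n (c j) = Complex r b"
    by (simp_all add: component_simps(1)[OF assms(1)] a b)
  ultimately show ?thesis
    by (simp add: standard_lift_def linepath_def complex_eq_iff algebra_simps)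
qed

lemma standard_lift_bridge:
  "standard_lift m n \<kappa> (Outer i) (Inner j) t = Complex ((1 - t) * ln 2)
     (2 * pi * of_int j / n + (1 - t) * (2 * pi * of_int i / m - 2 * pi * of_int j / n))"
  "standard_lift m n \<kappa> (Inner j) (Outer i) t = Complex (t * ln 2)
     (2 * pi * of_int j / n + t * (2 * pi * of_int i / m - 2 * pi * of_int j / n))"
  by (simp_all add: standard_lift_def linepath_def complex_eq_iff algebra_simps add_divide_distrib diff_divide_distrib)

text \<open>Keeps nested peripheral chords apart: with a common leading coefficient, widening the
  interval raises one factor of the product and lowers none.\<close>

lemma nested_parabolas:
  fixes x :: real
  assumes "a \<le> a'" "b' \<le> b" "a < a' \<or> b' < b" "a' < x" "x < b'"
  shows "(x - a') * (b' - x) < (x - a) * (b - x)"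
proof (cases "a < a'")
  case True
  have "(x - a') * (b' - x) < (x - a) * (b' - x)" using assms True by simp
  also have "\<dots> \<le> (x - a) * (b - x)" using assms by (intro mult_left_mono) auto
  finally show ?thesis .
next
  case False
  have "(x - a') * (b' - x) < (x - a') * (b - x)" using assms False by simp
  also have "\<dots> \<le> (x - a) * (b - x)" using assms by (intro mult_right_mono) auto
  finally show ?thesis .
qed

text \<open>Separates a peripheral chord over the interval from \<open>a\<close> to \<open>b\<close>
  from a bridge whose foot \<open>x0\<close> is outside it. The bridge climbs \<open>h\<close> over
  a run of \<open>d\<close>, and \<open>small\<close> says that its slope is at least
  \<open>\<kappa> * (b - a)\<close>, the slope of the parabola at its ends and hence its
  steepest.\<close>

lemma parabola_below_segment:
  fixes x :: real
  assumes x0: "x0 \<le> a \<or> b \<le> x0" and "0 < \<kappa>" "0 < \<tau>" and small: "\<kappa> * \<bar>d\<bar> * (b - a) \<le> h"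
    and x: "x = x0 + \<tau> * d" "a < x" "x < b"
  shows "\<kappa> * ((x - a) * (b - x)) < \<tau> * h"
proof -
  have "(x - a) * (b - x) < \<tau> * \<bar>d\<bar> * (b - a)"
    using x0
  proof
    assume "x0 \<le> a"
    then have "x - a \<le> \<tau> * \<bar>d\<bar>" using x abs_ge_self[of d] \<open>0 < \<tau>\<close>
      by (smt (verit) mult_left_mono)
    moreover have "(x - a) * (b - x) < (x - a) * (b - a)" using x by simp
    moreover have "(x - a) * (b - a) \<le> \<tau> * \<bar>d\<bar> * (b - a)" using x calculation(1) by (intro mult_right_mono) auto
    ultimately show ?thesis by linarith
  next
    assume "b \<le> x0"
    then have "b - x \<le> \<tau> * \<bar>d\<bar>" using x abs_ge_minus_self[of d] \<open>0 < \<tau>\<close>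
      by (smt (verit) mult_left_mono mult_minus_right)
    moreover have "(x - a) * (b - x) < (b - x) * (b - a)" using x by (simp add: mult.commute)
    moreover have "(b - x) * (b - a) \<le> \<tau> * \<bar>d\<bar> * (b - a)" using x calculation(1) by (intro mult_right_mono) auto
    ultimately show ?thesis by linarith
  qed
  then have "\<kappa> * ((x - a) * (b - x)) < \<kappa> * (\<tau> * \<bar>d\<bar> * (b - a))"
    using \<open>0 < \<kappa>\<close> by simp
  also have "\<dots> = \<tau> * (\<kappa> * \<bar>d\<bar> * (b - a))" by (simp add: algebra_simps)
  also have "\<dots> \<le> \<tau> * h" using small \<open>0 < \<tau>\<close> by simp
  finally show ?thesis .
qed

text \<open>The maximum is attained midway. With \<open>\<kappa> * pi\<^sup>2 < ln 2 / 2\<close> a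
  peripheral chord thus stays in the half of the strip next to its own side.\<close>

lemma parabola_bound:
  fixes x :: real
  assumes "a < x" "x < b" "b - a \<le> 2 * pi"
  shows "0 < (x - a) * (b - x)" "(x - a) * (b - x) \<le> pi\<^sup>2"
proof -
  show "0 < (x - a) * (b - x)" using assms by simp
  have "4 * ((x - a) * (b - x)) \<le> (b - a)\<^sup>2"
    using zero_le_power2[of "(x - a) - (b - x)"] by (simp add: power2_eq_square algebra_simps)
  also have "\<dots> \<le> (2 * pi)\<^sup>2" using assms by (intro power_mono) auto
  finally show "(x - a) * (b - x) \<le> pi\<^sup>2" by (simp add: power_mult_distrib)
qed

lemma component_crosses:
  assumes "component m n c p r \<sigma>"
  shows "i < i' \<and> i' < j \<and> j < j' \<Longrightarrow> crosses (c i) (c j) (c i') (c j')"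
    "i' < i \<and> i < j' \<and> j' < j \<Longrightarrow> crosses (c i) (c j) (c i') (c j')"
  using assms unfolding component_def by (elim disjE; clarify; simp add: crosses_defs)+

context
  fixes m n :: nat
  assumes m: "m > 0" and n: "n > 0"
begin

text \<open>Parametrised by the imaginary part x, the chord becomes the graph of a parabola. The
  squared length in \<open>standard_lift\<close> is there to give all of them the same leading
  coefficient.\<close>

lemma standard_lift_component_point:
  assumes "component m n c p r \<sigma>" "chord m n (c i) (c j)" "t \<in> {0<..<1}"
    and a: "a = 2 * pi * of_int (min i j) / p" and b: "b = 2 * pi * of_int (max i j) / p"
  shows "\<exists>x. a < x \<and> x < b \<and> b - a \<le> 2 * pi \<and>
    standard_lift m n \<kappa> (c i) (c j) t = Complex (r + \<sigma> * (\<kappa> * ((x - a) * (b - x)))) x"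
proof -
  have p: "p > 0" using component_pos m n assms(1) by blast
  have ij: "2 \<le> \<bar>i - j\<bar>" "\<bar>i - j\<bar> \<le> int p" using assms(2) component_simps(4)[OF assms(1)] by auto
  let ?a = "2 * pi * real_of_int i / p" and ?b = "2 * pi * real_of_int j / p"
  let ?x = "?a + t * (?b - ?a)"
  have ab: "a < b \<and> b - a \<le> 2 * pi"
  proof -
    have ba: "b - a = 2 * pi * (real_of_int \<bar>i - j\<bar> / p)"
      unfolding a b by (cases "i \<le> j") (simp_all add: diff_divide_distrib[symmetric] right_diff_distrib[symmetric] min_def max_def)
    have "real_of_int \<bar>i - j\<bar> \<le> real p" "0 < real_of_int \<bar>i - j\<bar>" using ij by linarith+
    then have L: "real_of_int \<bar>i - j\<bar> / p \<le> 1" "0 < real_of_int \<bar>i - j\<bar> / p"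
      using p by (simp_all del: of_int_abs)
    have "0 < b - a" unfolding ba using L(2) by (intro mult_pos_pos) auto
    moreover have "b - a \<le> 2 * pi" unfolding ba using mult_left_mono[OF L(1), of "2 * pi"] by (simp del: of_int_abs)
    ultimately show ?thesis by simp
  qed
  have swap: "?a = a \<and> ?b = b \<or> ?a = b \<and> ?b = a"
    unfolding a b by (cases "i \<le> j") (simp_all add: min_def max_def)
  have "(?x - a) * (b - ?x) = (?b - ?a)\<^sup>2 * t * (1 - t)"
    using swap by (elim disjE conjE) (simp_all add: power2_eq_square algebra_simps)
  then have "standard_lift m n \<kappa> (c i) (c j) t = Complex (r + \<sigma> * (\<kappa> * ((?x - a) * (b - ?x)))) ?x"
    unfolding standard_lift_component[OF assms(1) refl refl] by (simp add: mult.assoc)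
  moreover have "a < ?x \<and> ?x < b"
  proof -
    have "a < a + t * (b - a)" "a + t * (b - a) < b" "a < b + t * (a - b)" "b + t * (a - b) < b"
      using ab assms(3) mult_strict_right_mono[of t 1 "b - a"] mult_pos_pos[of t "b - a"]
      by (auto simp: algebra_simps)
    then show ?thesis using swap by (elim disjE conjE) simp_all
  qed
  ultimately show ?thesis using ab by blast
qed

lemma standard_lift_interior:
  assumes "chord m n u v" "0 < \<kappa>" "\<kappa> * pi\<^sup>2 < ln 2 / 2" "t \<in> {0<..<1}"
  shows "0 < Re (standard_lift m n \<kappa> u v t)" "Re (standard_lift m n \<kappa> u v t) < ln 2"
proof -
  have "0 < Re (standard_lift m n \<kappa> u v t) \<and> Re (standard_lift m n \<kappa> u v t) < ln 2"
  proof (cases rule: vertex_pair_cases[of m n u v])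
    case (1 c p r \<sigma> i j)
    obtain x a b where x: "a < x" "x < b" "b - a \<le> 2 * pi"
      "standard_lift m n \<kappa> u v t = Complex (r + \<sigma> * (\<kappa> * ((x - a) * (b - x)))) x"
      using standard_lift_component_point[OF 1(1) _ assms(4) refl refl, of i j \<kappa>] assms(1) 1 by blast
    have "0 < \<kappa> * ((x - a) * (b - x))" "\<kappa> * ((x - a) * (b - x)) \<le> \<kappa> * pi\<^sup>2"
      using parabola_bound[OF x(1-3)] assms(2) by auto
    then show ?thesis using x(4) assms(3) 1(1) by (auto simp: component_def)
  qed (use assms(4) in \<open>auto simp: standard_lift_bridge\<close>)
  then show "0 < Re (standard_lift m n \<kappa> u v t)" "Re (standard_lift m n \<kappa> u v t) < ln 2" by auto
qed

lemma standard_lift_ends: "standard_lift m n \<kappa> u v 0 = lifted m n u" "standard_lift m n \<kappa> u v 1 = lifted m n v"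
  by (simp_all add: standard_lift_def linepath_def)

lemma standard_lift_inj:
  assumes "chord m n u v" "s \<in> {0..1}" "t \<in> {0..1}" "exp (standard_lift m n \<kappa> u v s) = exp (standard_lift m n \<kappa> u v t)"
  shows "s = t \<or> s = 0 \<and> t = 1 \<or> s = 1 \<and> t = 0"
proof -
  obtain k :: int where k: "standard_lift m n \<kappa> u v s = standard_lift m n \<kappa> u v t + Complex 0 (2 * pi * k)"
    using assms(4) unfolding exp_eq_shift by blast
  show ?thesis
  proof (cases rule: vertex_pair_cases[of m n u v])
    case (1 c p r \<sigma> i j)
    have p: "p > 0" using component_pos m n 1 by blast
    have ij: "2 \<le> \<bar>i - j\<bar>" "\<bar>i - j\<bar> \<le> int p" using assms(1) 1 component_simps(4)[OF 1(1)] by auto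
    let ?a = "2 * pi * real_of_int i / p" and ?b = "2 * pi * real_of_int j / p"
    have "?a + s * (?b - ?a) = ?a + t * (?b - ?a) + 2 * pi * k"
      using arg_cong[OF k, of Im] unfolding 1(2,3) standard_lift_component[OF 1(1) refl refl] by simp
    then have "2 * pi * ((s - t) * real_of_int (j - i)) = 2 * pi * (k * p)"
      using p by (simp add: field_simps)
    then have eq: "(s - t) * real_of_int (j - i) = real_of_int k * p" by (simp only: mult_cancel_left) simp
    show ?thesis
    proof (cases "k = 0")
      case True
      then show ?thesis using eq ij by auto
    next
      \<comment> \<open>Advancing by a full turn takes a run of at least \<open>p\<close>, the
        maximal length of a chord, hence the whole parameter interval.\<close>
      case False
      have "1 * real p \<le> \<bar>real_of_int k\<bar> * p" using False p by (intro mult_right_mono) linarith+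
      also have "\<dots> = \<bar>s - t\<bar> * real_of_int \<bar>j - i\<bar>" using arg_cong[OF eq, of abs] by (simp add: abs_mult)
      also have "\<dots> \<le> \<bar>s - t\<bar> * real p" using ij by (intro mult_left_mono) linarith+
      finally have "1 \<le> \<bar>s - t\<bar>" using p by simp
      then show ?thesis using assms(2,3) by auto
    qed
  next
    case (2 i j)
    then show ?thesis using arg_cong[OF k, of Re] by (simp add: standard_lift_bridge)
  next
    case (3 i j)
    then show ?thesis using arg_cong[OF k, of Re] by (simp add: standard_lift_bridge)
  qed
qed

lemma standard_lift_curve:
  assumes "chord m n u v" "0 < \<kappa>" "\<kappa> * pi\<^sup>2 < ln 2 / 2"
  shows "exp \<circ> standard_lift m n \<kappa> u v \<in> curve_class m n u v" "simple_curve m n (exp \<circ> standard_lift m n \<kappa> u v)"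
proof -
  have strip: "standard_lift m n \<kappa> u v t \<in> strip" if "t \<in> {0..1}" for t
  proof (cases "t = 0 \<or> t = 1")
    case True
    then show ?thesis using standard_lift_ends lifted_strip[OF m n] by auto
  next
    case False
    then have "t \<in> {0<..<1}" using that by auto
    then show ?thesis using standard_lift_interior[OF assms] by (simp add: strip_def less_imp_le)
  qed
  have "path (standard_lift m n \<kappa> u v)"
    unfolding path_def standard_lift_def linepath_def by (intro continuous_intros)
  then have "lifts (standard_lift m n \<kappa> u v) (exp \<circ> standard_lift m n \<kappa> u v)"
    using strip by (simp add: lifts_def)
  then show curve_class: "exp \<circ> standard_lift m n \<kappa> u v \<in> curve_class m n u v"
    by (rule curve_classI[OF m n]) (simp_all add: pathstart_def pathfinish_def standard_lift_ends)
  show "simple_curve m n (exp \<circ> standard_lift m n \<kappa> u v)"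
    unfolding simple_curve_def
  proof (intro conjI)
    show "simple_path (exp \<circ> standard_lift m n \<kappa> u v)"
      unfolding simple_path_def loop_free_def comp_def
      using curve_class_ends(3)[OF m n curve_class] standard_lift_inj[OF assms(1)] unfolding comp_def by blast
    show "pathstart (exp \<circ> standard_lift m n \<kappa> u v) \<in> marked_points m n" "pathfinish (exp \<circ> standard_lift m n \<kappa> u v) \<in> marked_points m n"
      unfolding curve_class_ends[OF m n curve_class] marked_iff_lifted[OF m n] by blast+
    have "exp (standard_lift m n \<kappa> u v t) \<notin> annulus_boundary" if "t \<in> {0<..<1}" for t
      using standard_lift_interior[OF assms that] by (simp add: exp_in_boundary)
    then show "(exp \<circ> standard_lift m n \<kappa> u v) ` {0<..<1} \<inter> annulus_boundary = {}"
      unfolding comp_def by blast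
  qed (rule curve_class_ends[OF m n curve_class])
qed

lemma standard_lift_shift: "standard_lift m n \<kappa> (shift m n k u) (shift m n k v) t = standard_lift m n \<kappa> u v t + Complex 0 (2 * pi * k)"
proof -
  have "bend (shift m n k u) (shift m n k v) = bend u v" by (cases u; cases v) auto
  then show ?thesis
    unfolding standard_lift_def lifted_shift[OF m n] linepath_def by (simp add: algebra_simps complex_eq_iff)
qed

text \<open>Three situations arise, according to how many of the chords are bridges:
  \<open>periph\<close>, \<open>mixed\<close> and \<open>bridges\<close>. In each, non-interlacing
  orders the ends so that the two graphs are strictly separated.\<close>

lemma standard_lifts_disjoint:
  assumes uv: "chord m n u v" and xy: "chord m n x y" and nc: "\<not> crosses u v x y" and ne: "{u, v} \<noteq> {x, y}"
    and \<kappa>: "0 < \<kappa>" "\<kappa> * pi\<^sup>2 < ln 2 / 2"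
    and small: "\<kappa> * \<bar>Im (lifted m n u) - Im (lifted m n v)\<bar> * (2 * pi) \<le> ln 2"
      "\<kappa> * \<bar>Im (lifted m n x) - Im (lifted m n y)\<bar> * (2 * pi) \<le> ln 2"
    and st: "s \<in> {0<..<1}" "t \<in> {0<..<1}"
  shows "standard_lift m n \<kappa> u v s \<noteq> standard_lift m n \<kappa> x y t"
proof
  assume eq: "standard_lift m n \<kappa> u v s = standard_lift m n \<kappa> x y t"
  have less: "2 * pi * real_of_int a / real p \<le> 2 * pi * real_of_int b / real p"
    if "a \<le> b" for a b and p :: nat
    using that by (intro divide_right_mono mult_left_mono) auto
  have less': "2 * pi * real_of_int a / real p < 2 * pi * real_of_int b / real p"
    if "a < b" "p > 0" for a b and p :: nat
    using that by (intro divide_strict_right_mono mult_strict_left_mono) auto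
  \<comment> \<open>Here \<open>\<tau>\<close> is the height above the inner side as a fraction of
    \<open>ln 2\<close>, so that bridges can be compared whichever way they are traversed.\<close>
  have bridge: "\<exists>\<tau> i j. 0 < \<tau> \<and> \<tau> < 1 \<and> {u, v} = {Outer i, Inner j} \<and>
      standard_lift m n \<kappa> u v t = Complex (\<tau> * ln 2) (2 * pi * of_int j / n + \<tau> * (2 * pi * of_int i / m - 2 * pi * of_int j / n))"
    if uv: "u = Outer i \<and> v = Inner j \<or> u = Inner j \<and> v = Outer i" and t: "t \<in> {0<..<1}" for u v t i j
    using uv
  proof (elim disjE conjE)
    assume "u = Outer i" "v = Inner j"
    then show ?thesis
      using t standard_lift_bridge(1) by (intro exI[of _ "1 - t"] exI[of _ i] exI[of _ j]) auto
  next
    assume "u = Inner j" "v = Outer i"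
    then show ?thesis
      using t standard_lift_bridge(2) by (intro exI[of _ t] exI[of _ i] exI[of _ j]) auto
  qed
  \<comment> \<open>All data are generalised, because the fact is needed with either chord in the
    peripheral role.\<close>
  have mixed: False
    if c: "component m n c p r \<sigma>" "u = c i" "v = c j" and uv: "chord m n u v"
      and nc: "\<not> crosses u v x y" and small: "\<kappa> * \<bar>Im (lifted m n x) - Im (lifted m n y)\<bar> * (2 * pi) \<le> ln 2"
      and eq: "standard_lift m n \<kappa> u v s = standard_lift m n \<kappa> x y t" and st: "s \<in> {0<..<1}" "t \<in> {0<..<1}"
      and xy: "x = Outer i' \<and> y = Inner j' \<or> x = Inner j' \<and> y = Outer i'"
    for u v x y s t i j i' j' c p r \<sigma>
  proof -
    let ?a = "2 * pi * real_of_int (min i j) / p" and ?b = "2 * pi * real_of_int (max i j) / p"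
    have p: "p > 0" using component_pos m n c by blast
    obtain z where z: "?a < z" "z < ?b" "?b - ?a \<le> 2 * pi"
      "standard_lift m n \<kappa> u v s = Complex (r + \<sigma> * (\<kappa> * ((z - ?a) * (?b - z)))) z"
      using standard_lift_component_point[OF c(1) _ st(1) refl refl, of i j \<kappa>] uv c by blast
    obtain \<tau> I J where \<tau>: "0 < \<tau>" "\<tau> < 1" and xyI: "{x, y} = {Outer I, Inner J}" and
      "standard_lift m n \<kappa> x y t = Complex (\<tau> * ln 2) (2 * pi * of_int J / n + \<tau> * (2 * pi * of_int I / m - 2 * pi * of_int J / n))"
      using bridge[OF xy st(2)] by blast
    then have Re: "r + \<sigma> * (\<kappa> * ((z - ?a) * (?b - z))) = \<tau> * ln 2"
      and Im: "z = 2 * pi * of_int J / n + \<tau> * (2 * pi * of_int I / m - 2 * pi * of_int J / n)"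
      using z(4) eq by auto
    let ?d = "2 * pi * real_of_int I / m - 2 * pi * real_of_int J / n"
    have "\<bar>Im (lifted m n x) - Im (lifted m n y)\<bar> = \<bar>?d\<bar>"
      using xyI by (auto simp: doubleton_eq_iff abs_minus_commute)
    then have "\<kappa> * \<bar>?d\<bar> * (?b - ?a) \<le> \<kappa> * \<bar>?d\<bar> * (2 * pi)" "\<kappa> * \<bar>?d\<bar> * (2 * pi) \<le> ln 2"
      using z(3) \<kappa> small by (auto intro: mult_left_mono)
    then have d: "\<kappa> * \<bar>?d\<bar> * (?b - ?a) \<le> ln 2" by linarith
    have nc': "\<not> crosses u v (Outer I) (Inner J)"
      using nc xyI crosses_commute(2) by (auto simp: doubleton_eq_iff)
    show False
    proof (cases "c = Outer")
      case True
      then have o: "p = m" "r = ln 2" "\<sigma> = -1" using c(1) vertex.distinct(1) unfolding component_def by metis+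
      have "I \<le> min i j \<or> max i j \<le> I"
        using nc' c(2,3) True by (auto simp: crosses_defs min_def max_def)
      then have foot: "2 * pi * of_int I / m \<le> ?a \<or> ?b \<le> 2 * pi * real_of_int I / m"
        using less o by blast
      \<comment> \<open>Seen from the outer side the bridge starts at its outer foot, has height
        \<open>1 - \<tau>\<close> and runs in the opposite direction.\<close>
      have "\<kappa> * ((z - ?a) * (?b - z)) < (1 - \<tau>) * ln 2"
      proof (rule parabola_below_segment[OF foot \<kappa>(1) _ _ _ z(1,2)])
        show "\<kappa> * \<bar>- ?d\<bar> * (?b - ?a) \<le> ln 2" using d by (simp only: abs_minus_cancel)
        show "z = 2 * pi * of_int I / m + (1 - \<tau>) * - ?d" using Im by (simp add: algebra_simps diff_divide_distrib)
      qed (use \<tau> in simp)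
      then show False using Re o by (simp add: algebra_simps)
    next
      case False
      then have o: "c = Inner" "p = n" "r = 0" "\<sigma> = 1" using c(1) by (auto simp: component_def)
      have "J \<le> min i j \<or> max i j \<le> J"
        using nc' c(2,3) o by (auto simp: crosses_defs min_def max_def)
      then have foot: "2 * pi * of_int J / n \<le> ?a \<or> ?b \<le> 2 * pi * real_of_int J / n"
        using less o by blast
      have "\<kappa> * ((z - ?a) * (?b - z)) < \<tau> * ln 2"
        by (rule parabola_below_segment[OF foot \<kappa>(1) \<tau>(1) d Im z(1,2)])
      then show False using Re o by simp
    qed
  qed
  have bridges: False
    if uv: "u = Outer i \<and> v = Inner j \<or> u = Inner j \<and> v = Outer i"
      and xy: "x = Outer i' \<and> y = Inner j' \<or> x = Inner j' \<and> y = Outer i'" for i j i' j'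
  proof -
    obtain \<tau> I J where \<tau>: "0 < \<tau>" "\<tau> < 1" and I: "{u, v} = {Outer I, Inner J}" and
      r: "standard_lift m n \<kappa> u v s = Complex (\<tau> * ln 2) (2 * pi * of_int J / n + \<tau> * (2 * pi * of_int I / m - 2 * pi * of_int J / n))"
      using bridge[OF uv st(1)] by blast
    obtain \<tau>' I' J' where \<tau>': "0 < \<tau>'" "\<tau>' < 1" and I': "{x, y} = {Outer I', Inner J'}" and
      r': "standard_lift m n \<kappa> x y t = Complex (\<tau>' * ln 2) (2 * pi * of_int J' / n + \<tau>' * (2 * pi * of_int I' / m - 2 * pi * of_int J' / n))"
      using bridge[OF xy st(2)] by blast
    have "\<tau> = \<tau>'" using eq r r' by simp
    then have e: "(1 - \<tau>) * (2 * pi * of_int J / n) + \<tau> * (2 * pi * of_int I / m) =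
        (1 - \<tau>) * (2 * pi * of_int J' / n) + \<tau> * (2 * pi * of_int I' / m)"
      using eq r r' by (simp add: algebra_simps diff_divide_distrib)
    have "\<not> crosses (Outer I) (Inner J) (Outer I') (Inner J')"
      using nc I I' crosses_commute by (auto simp: doubleton_eq_iff)
    moreover have "I \<noteq> I' \<or> J \<noteq> J'" using ne I I' by auto
    \<comment> \<open>Bridges that do not cross are ordered the same way at both ends, strictly at
      one of them; at any interior height they then have different imaginary parts.\<close>
    ultimately consider "I \<le> I'" "J \<le> J'" "I < I' \<or> J < J'" | "I' \<le> I" "J' \<le> J" "I' < I \<or> J' < J"
      by (cases I I' rule: linorder_cases; cases J J' rule: linorder_cases) (auto simp: crosses_defs)
    then show False
    proof cases
      case 1
      have "(1 - \<tau>) * (2 * pi * of_int J / n) \<le> (1 - \<tau>) * (2 * pi * of_int J' / n)"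
        "\<tau> * (2 * pi * of_int I / m) \<le> \<tau> * (2 * pi * of_int I' / m)"
        using \<tau> 1 less by (auto intro!: mult_left_mono simp del: times_divide_eq_right)
      moreover have "(1 - \<tau>) * (2 * pi * of_int J / n) < (1 - \<tau>) * (2 * pi * of_int J' / n) \<or>
        \<tau> * (2 * pi * of_int I / m) < \<tau> * (2 * pi * of_int I' / m)"
        using 1(3) \<tau> less'[OF _ m] less'[OF _ n] by (meson diff_gt_0_iff_gt mult_strict_left_mono)
      ultimately show False using e by linarith
    next
      case 2
      have "(1 - \<tau>) * (2 * pi * of_int J' / n) \<le> (1 - \<tau>) * (2 * pi * of_int J / n)"
        "\<tau> * (2 * pi * of_int I' / m) \<le> \<tau> * (2 * pi * of_int I / m)"
        using \<tau> 2 less by (auto intro!: mult_left_mono simp del: times_divide_eq_right)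
      moreover have "(1 - \<tau>) * (2 * pi * of_int J' / n) < (1 - \<tau>) * (2 * pi * of_int J / n) \<or>
        \<tau> * (2 * pi * of_int I' / m) < \<tau> * (2 * pi * of_int I / m)"
        using 2(3) \<tau> less'[OF _ m] less'[OF _ n] by (meson diff_gt_0_iff_gt mult_strict_left_mono)
      ultimately show False using e by linarith
    qed
  qed
  \<comment> \<open>Chords on opposite sides lie in opposite halves of the strip. Chords on the same
    side lying over a common point are nested, since they do not interlace.\<close>
  have periph: False
    if c: "component m n c p r \<sigma>" "u = c i" "v = c j" and c': "component m n c' p' r' \<sigma>'" "x = c' i'" "y = c' j'"
    for c p r \<sigma> i j c' p' r' \<sigma>' i' j'
  proof -
    let ?a = "2 * pi * real_of_int (min i j) / p" and ?b = "2 * pi * real_of_int (max i j) / p"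
    let ?a' = "2 * pi * real_of_int (min i' j') / p'" and ?b' = "2 * pi * real_of_int (max i' j') / p'"
    have p: "p > 0" using component_pos m n c by blast
    obtain z where z: "?a < z" "z < ?b" "?b - ?a \<le> 2 * pi"
      "standard_lift m n \<kappa> u v s = Complex (r + \<sigma> * (\<kappa> * ((z - ?a) * (?b - z)))) z"
      using standard_lift_component_point[OF c(1) _ st(1) refl refl, of i j \<kappa>] uv c by blast
    obtain z' where z': "?a' < z'" "z' < ?b'" "?b' - ?a' \<le> 2 * pi"
      "standard_lift m n \<kappa> x y t = Complex (r' + \<sigma>' * (\<kappa> * ((z' - ?a') * (?b' - z')))) z'"
      using standard_lift_component_point[OF c'(1) _ st(2) refl refl, of i' j' \<kappa>] xy c' by blast
    have [simp]: "z' = z" and Re: "r + \<sigma> * (\<kappa> * ((z - ?a) * (?b - z))) = r' + \<sigma>' * (\<kappa> * ((z - ?a') * (?b' - z)))"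
      using eq z(4) z'(4) by auto
    have bd: "\<kappa> * ((z - ?a) * (?b - z)) \<le> \<kappa> * pi\<^sup>2" "\<kappa> * ((z - ?a') * (?b' - z)) \<le> \<kappa> * pi\<^sup>2"
      using parabola_bound[OF z(1-3)] parabola_bound[OF z'(1-3)] \<kappa> by auto
    show False
    proof (cases "c = c'")
      case False
      then show False using Re bd \<kappa>(2) c(1) c'(1) by (auto simp: component_def)
    next
      case True
      have "Outer \<noteq> Inner" "Inner \<noteq> Outer" by (metis vertex.distinct(1))+
      then have o: "p' = p" "r' = r" "\<sigma>' = \<sigma>" "\<sigma> \<noteq> 0"
        using True c(1) c'(1) by (auto simp: component_def)
      then have same: "(z - ?a) * (?b - z) = (z - ?a') * (?b' - z)" using Re \<kappa>(1) by simp
      have ineq: "?a < ?b'" "?a' < ?b" using z z' by auto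
      then have "\<not> max i' j' \<le> min i j" "\<not> max i j \<le> min i' j'"
        using less[of "max i' j'" "min i j" p] less[of "max i j" "min i' j'" p] o by auto
      moreover have "min i j \<noteq> min i' j' \<or> max i j \<noteq> max i' j'"
        using ne c c' True by (auto simp: min_def max_def split: if_splits)
      moreover have nc: "\<not> crosses (c (min i j)) (c (max i j)) (c (min i' j')) (c (max i' j'))"
      proof -
        have "min i j = i \<and> max i j = j \<or> min i j = j \<and> max i j = i" for i j :: int by auto
        then show ?thesis using nc c c' True by (metis crosses_commute)
      qed
      have "\<not> (min i j < min i' j' \<and> min i' j' < max i j \<and> max i j < max i' j')"
        "\<not> (min i' j' < min i j \<and> min i j < max i' j' \<and> max i' j' < max i j)"
        using nc component_crosses[OF c(1)] by blast+
      ultimately have nest: "min i j \<le> min i' j' \<and> max i' j' \<le> max i j \<and> (min i j < min i' j' \<or> max i' j' < max i j) \<or>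
          min i' j' \<le> min i j \<and> max i j \<le> max i' j' \<and> (min i' j' < min i j \<or> max i j < max i' j')"
        by linarith
      then show False
      proof
        assume "min i j \<le> min i' j' \<and> max i' j' \<le> max i j \<and> (min i j < min i' j' \<or> max i' j' < max i j)"
        then have "?a \<le> ?a'" "?b' \<le> ?b" "?a < ?a' \<or> ?b' < ?b" using less less' p o by auto
        then show False using nested_parabolas[of ?a ?a' ?b' ?b z] z' same by auto
      next
        assume "min i' j' \<le> min i j \<and> max i j \<le> max i' j' \<and> (min i' j' < min i j \<or> max i j < max i' j')"
        then have "?a' \<le> ?a" "?b \<le> ?b'" "?a' < ?a \<or> ?b < ?b'" using less less' p o by auto
        then show False using nested_parabolas[of ?a' ?a ?b ?b' z] z same by auto
      qed
    qed
  qed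
  have nc': "\<not> crosses x y u v" using nc crosses_sym by blast
  show False
  proof (cases rule: vertex_pair_cases[of m n u v])
    case c: (1 c p r \<sigma> i j)
    note mix = mixed[OF c uv nc small(2) eq st]
    show ?thesis
    proof (cases rule: vertex_pair_cases[of m n x y])
      case 1
      then show ?thesis by (rule periph[OF c])
    next
      case 2
      then show ?thesis by (intro mix disjI1 conjI)
    next
      case 3
      then show ?thesis by (intro mix disjI2 conjI)
    qed
  next
    case (2 i j)
    then have b: "u = Outer i \<and> v = Inner j \<or> u = Inner j \<and> v = Outer i" by simp
    show ?thesis
    proof (cases rule: vertex_pair_cases[of m n x y])
      case 1
      then show ?thesis by (rule mixed[OF _ _ _ xy nc' small(1) eq[symmetric] st(2,1) b])
    next
      case 2
      then show ?thesis by (intro bridges[OF b] disjI1 conjI)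
    next
      case 3
      then show ?thesis by (intro bridges[OF b] disjI2 conjI)
    qed
  next
    case (3 i j)
    then have b: "u = Outer i \<and> v = Inner j \<or> u = Inner j \<and> v = Outer i" by simp
    show ?thesis
    proof (cases rule: vertex_pair_cases[of m n x y])
      case 1
      then show ?thesis by (rule mixed[OF _ _ _ xy nc' small(1) eq[symmetric] st(2,1) b])
    next
      case 2
      then show ?thesis by (intro bridges[OF b] disjI1 conjI)
    next
      case 3
      then show ?thesis by (intro bridges[OF b] disjI2 conjI)
    qed
  qed
qed

text \<open>Curves in the annulus meet as soon as some translates of their lifts do, so all
  translates are compared. Translation preserves every condition on \<open>\<kappa>\<close>, and one
  value serves them all.\<close>

lemma disjoint_curves:
  assumes uv: "chord m n u v" and xy: "chord m n x y"
    and nc: "\<And>k. \<not> crosses u v (shift m n k x) (shift m n k y)"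
    and ne: "\<And>k. {u, v} \<noteq> {shift m n k x, shift m n k y}"
  shows "\<exists>g\<in>curve_class m n u v. \<exists>h\<in>curve_class m n x y. simple_curve m n g \<and> simple_curve m n h \<and> g ` {0<..<1} \<inter> h ` {0<..<1} = {}"
proof -
  let ?d = "\<bar>Im (lifted m n u) - Im (lifted m n v)\<bar>" and ?e = "\<bar>Im (lifted m n x) - Im (lifted m n y)\<bar>"
  \<comment> \<open>The three summands provide the three smallness conditions on
    \<open>\<kappa>\<close>: staying in half of the strip (\<open>k1\<close>) and the two slope
    conditions (\<open>sm\<close>).\<close>
  define D where "D = 4 * pi\<^sup>2 + ?d * (2 * pi) + ?e * (2 * pi)"
  define \<kappa> where "\<kappa> = ln 2 / D"
  have D: "D > 0" "4 * pi\<^sup>2 \<le> D" "?d * (2 * pi) \<le> D" "?e * (2 * pi) \<le> D"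
    unfolding D_def by (auto intro!: add_pos_nonneg)
  have k0: "\<kappa> > 0" using D by (simp add: \<kappa>_def)
  have le: "\<kappa> * X \<le> ln 2" if "X \<le> D" for X
  proof -
    have "\<kappa> * X \<le> \<kappa> * D" using that k0 by simp
    then show ?thesis using D by (simp add: \<kappa>_def)
  qed
  have k1: "\<kappa> * pi\<^sup>2 < ln 2 / 2"
  proof -
    have "\<kappa> * (4 * pi\<^sup>2) \<le> ln 2" by (rule le) (use D in simp)
    moreover have "0 < \<kappa> * pi\<^sup>2" using k0 by simp
    ultimately show ?thesis by (simp add: algebra_simps)
  qed
  have sm: "\<kappa> * ?d * (2 * pi) \<le> ln 2" "\<kappa> * ?e * (2 * pi) \<le> ln 2"
    using le[OF D(3)] le[OF D(4)] by (simp_all add: mult.assoc)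
  let ?g = "exp \<circ> standard_lift m n \<kappa> u v" and ?h = "exp \<circ> standard_lift m n \<kappa> x y"
  have "?g ` {0<..<1} \<inter> ?h ` {0<..<1} = {}"
  proof (rule ccontr)
    assume "?g ` {0<..<1} \<inter> ?h ` {0<..<1} \<noteq> {}"
    then obtain z where "z \<in> ?g ` {0<..<1}" "z \<in> ?h ` {0<..<1}" by blast
    then obtain s t where st: "s \<in> {0<..<1}" "t \<in> {0<..<1}" "exp (standard_lift m n \<kappa> u v s) = exp (standard_lift m n \<kappa> x y t)"
      by (elim imageE) simp
    then obtain k :: int where "standard_lift m n \<kappa> u v s = standard_lift m n \<kappa> x y t + Complex 0 (2 * pi * k)"
      unfolding exp_eq_shift by blast
    then have "standard_lift m n \<kappa> u v s = standard_lift m n \<kappa> (shift m n k x) (shift m n k y) t"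
      by (simp add: standard_lift_shift)
    moreover have "chord m n (shift m n k x) (shift m n k y)"
      using xy by (cases x; cases y) auto
    moreover have "\<kappa> * \<bar>Im (lifted m n (shift m n k x)) - Im (lifted m n (shift m n k y))\<bar> * (2 * pi) \<le> ln 2"
      using sm(2) by (simp add: lifted_shift[OF m n])
    ultimately show False
      using standard_lifts_disjoint[OF uv _ nc ne k0 k1 sm(1) _ st(1,2)] by blast
  qed
  then show ?thesis
    by (intro bexI[of _ ?g] bexI[of _ ?h] conjI standard_lift_curve[OF uv k0 k1] standard_lift_curve[OF xy k0 k1])
qed

end

section \<open>Triangulations of the annulus\<close>

definition arc_of :: "nat \<Rightarrow> nat \<Rightarrow> vertex \<Rightarrow> vertex \<Rightarrow> (real \<Rightarrow> complex) set" where
  "arc_of m n u v = curve_class m n u v \<union> curve_class m n v u"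

definition edges :: "nat \<Rightarrow> nat \<Rightarrow> (real \<Rightarrow> complex) set set \<Rightarrow> vertex \<Rightarrow> vertex \<Rightarrow> bool" where
  "edges m n T u v \<longleftrightarrow> arc_of m n u v \<in> T"

definition arcs_of :: "nat \<Rightarrow> nat \<Rightarrow> (vertex \<Rightarrow> vertex \<Rightarrow> bool) \<Rightarrow> (real \<Rightarrow> complex) set set" where
  "arcs_of m n E = {arc_of m n u v | u v. E u v}"

lemma chord_sym: "chord m n u v \<longleftrightarrow> chord m n v u"
  by (cases u; cases v) (auto simp: abs_minus_commute)

lemma chord_shift: "chord m n (shift m n k u) (shift m n k v) \<longleftrightarrow> chord m n u v"
  by (cases u; cases v) auto

lemma compatible_sym: "compatible m n \<alpha> \<beta> \<Longrightarrow> compatible m n \<beta> \<alpha>"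
  unfolding compatible_def by blast

lemma arc_of_commute: "arc_of m n u v = arc_of m n v u"
  by (simp add: arc_of_def Un_commute)

context
  fixes m n :: nat
  assumes m: "m > 0" and n: "n > 0"
begin

lemma arc_of_eq: "arc_of m n u v = arc_of m n x y \<longleftrightarrow>
    (\<exists>k. x = shift m n k u \<and> y = shift m n k v \<or> x = shift m n k v \<and> y = shift m n k u)"
proof
  assume eq: "arc_of m n u v = arc_of m n x y"
  obtain g where g: "g \<in> curve_class m n u v" using curve_class_nonempty[OF m n] by blast
  then have "g \<in> curve_class m n x y \<or> g \<in> curve_class m n y x" using eq by (auto simp: arc_of_def)
  then show "\<exists>k. x = shift m n k u \<and> y = shift m n k v \<or> x = shift m n k v \<and> y = shift m n k u"
    using curve_class_disjoint[OF m n g] by blast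
next
  assume "\<exists>k. x = shift m n k u \<and> y = shift m n k v \<or> x = shift m n k v \<and> y = shift m n k u"
  then show "arc_of m n u v = arc_of m n x y"
    using curve_class_shift[OF m n] by (auto simp: arc_of_def)
qed

lemma arc_of_shift: "arc_of m n (shift m n k u) (shift m n k v) = arc_of m n u v"
  by (simp add: arc_of_def curve_class_shift[OF m n])

lemma chord_curve:
  assumes "chord m n u v"
  obtains g where "g \<in> curve_class m n u v" "simple_curve m n g"
proof -
  \<comment> \<open>Half of the admissible bound; slope conditions arise only for pairs of
    chords.\<close>
  let ?\<kappa> = "ln 2 / (4 * pi\<^sup>2)"
  have "0 < ?\<kappa>" "?\<kappa> * pi\<^sup>2 < ln 2 / 2" by (simp_all add: power2_eq_square)
  then show ?thesis using standard_lift_curve[OF m n assms] that by blast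
qed

lemma curve_class_lift:
  assumes "g \<in> curve_class m n u v"
  obtains f where "lifts f g" "f 0 = lifted m n u" "f 1 = lifted m n v"
  using curve_classE[OF m n assms] unfolding pathstart_def pathfinish_def by metis

text \<open>A lift meeting its own translate gives two parameters with the same image. Simplicity
  identifies them, so the translation is trivial, but no chord crosses itself.\<close>

lemma simple_no_self_crossing:
  assumes "simple_curve m n g" "g \<in> curve_class m n u v"
  shows "\<not> crosses u v (shift m n k u) (shift m n k v)"
proof
  assume cr: "crosses u v (shift m n k u) (shift m n k v)"
  obtain f where f: "lifts f g" "f 0 = lifted m n u" "f 1 = lifted m n v"
    using curve_class_lift assms(2) by blast
  let ?f = "\<lambda>t. f t + Complex 0 (2 * pi * of_int k)"
  have bd: "g ` {0<..<1} \<inter> annulus_boundary = {}" and simple: "simple_path g"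
    using assms(1) by (auto simp: simple_curve_def)
  obtain s t where st: "s \<in> {0<..<1}" "t \<in> {0<..<1}" "f s = ?f t"
    using crosses_imp_interior_meet[OF m n cr f bd lifts_shift[OF f(1)] _ _ bd, of k] f lifted_shift[OF m n] by auto
  have "g s = exp (f s)" "g t = exp (?f t)"
    using st(1,2) f(1) lifts_shift[OF f(1), of k] unfolding lifts_def by auto
  then have "g s = g t" using st(3) by simp
  then have "s = t"
    using simple st(1,2) unfolding simple_path_def loop_free_def by fastforce
  then have "k = 0" using st(3) by (simp add: complex_eq_iff)
  then show False
    using cr precedes_irrefl by (simp add: shift_shift[OF m n] crosses_defs)
qed

lemma chord_no_self_crossing:
  assumes "chord m n u v"
  shows "\<not> crosses u v (shift m n k u) (shift m n k v)"
  using chord_curve[OF assms] simple_no_self_crossing by metis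

lemma arcs_iff: "\<alpha> \<in> arcs m n \<longleftrightarrow> (\<exists>u v. chord m n u v \<and> \<alpha> = arc_of m n u v)"
proof
  assume "\<alpha> \<in> arcs m n"
  then obtain g where g: "simple_curve m n g" "\<not> contractible_into_boundary m n g"
    "\<alpha> = homotopy_class g \<union> homotopy_class (reversepath g)"
    unfolding arcs_def by blast
  have path: "path g" "path_image g \<subseteq> annulus" "pathstart g \<in> marked_points m n" "pathfinish g \<in> marked_points m n"
    using g(1) by (auto simp: simple_curve_def simple_path_def)
  obtain u where "pathstart g = exp (lifted m n u)"
    using path(3) marked_iff_lifted[OF m n] by blast
  then obtain v where curve_class: "g \<in> curve_class m n u v"
    using curve_class_exists[OF m n path(1,2) _ path(4)] by blast
  have ne: "u \<noteq> v" "\<not> neighbours u v"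
    using contractible_trivial[OF m n curve_class] g(2) by blast+
  have "chord m n u v"
  proof (cases rule: vertex_pair_cases[of m n u v])
    case (1 c p r \<sigma> i j)
    \<comment> \<open>A single turn suffices: a peripheral chord longer than \<open>p\<close>
      interlaces with its translate by \<open>p\<close>.\<close>
    have nc: "\<not> crosses u v (shift m n 1 u) (shift m n 1 v)"
      using simple_no_self_crossing[OF g(1) curve_class] .
    have p: "p > 0" using component_pos m n 1 by blast
    have "\<not> (i < i + int p \<and> i + int p < j \<and> j < j + int p)"
      using nc component_crosses(1)[OF 1(1), of i "i + int p" j "j + int p"] 1 component_simps(5)[OF 1(1), of 1]
      by (metis mult_1)
    moreover have "\<not> (j < j + int p \<and> j + int p < i \<and> i < i + int p)"
      using nc component_crosses(1)[OF 1(1), of j "j + int p" i "i + int p"] 1 component_simps(5)[OF 1(1), of 1]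
        crosses_commute by (metis mult_1)
    ultimately have "\<bar>i - j\<bar> \<le> int p" using p by auto
    then show ?thesis
      using ne 1 component_simps[OF 1(1)] by auto
  qed auto
  moreover have "\<alpha> = arc_of m n u v"
    using g(3) homotopy_class_curve_class[OF m n curve_class] homotopy_class_curve_class[OF m n curve_class_reversepath[OF m n curve_class]]
    by (simp add: arc_of_def)
  ultimately show "\<exists>u v. chord m n u v \<and> \<alpha> = arc_of m n u v" by blast
next
  assume "\<exists>u v. chord m n u v \<and> \<alpha> = arc_of m n u v"
  then obtain u v where uv: "chord m n u v" "\<alpha> = arc_of m n u v" by blast
  obtain g where g: "g \<in> curve_class m n u v" "simple_curve m n g" by (rule chord_curve[OF uv(1)])
  have "\<alpha> = homotopy_class g \<union> homotopy_class (reversepath g)"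
    using uv(2) homotopy_class_curve_class[OF m n g(1)] homotopy_class_curve_class[OF m n curve_class_reversepath[OF m n g(1)]]
    by (simp add: arc_of_def)
  then show "\<alpha> \<in> arcs m n"
    unfolding arcs_def using g chord_not_contractible[OF m n g(1) uv(1)] by blast
qed

lemma compatible_imp_no_crossing:
  assumes "compatible m n (arc_of m n u v) (arc_of m n x y)"
  shows "\<not> crosses u v x y"
proof
  assume cr: "crosses u v x y"
  have *: False if cr: "crosses u v x y" and g: "simple_curve m n g" "g \<in> curve_class m n u v"
    and h: "simple_curve m n h" "h \<in> curve_class m n x y" and disj: "g ` {0<..<1} \<inter> h ` {0<..<1} = {}" for u v x y g h
  proof -
    obtain f where f: "lifts f g" "f 0 = lifted m n u" "f 1 = lifted m n v"
      using curve_class_lift g(2) by blast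
    obtain f' where f': "lifts f' h" "f' 0 = lifted m n x" "f' 1 = lifted m n y"
      using curve_class_lift h(2) by blast
    have bd: "g ` {0<..<1} \<inter> annulus_boundary = {}" "h ` {0<..<1} \<inter> annulus_boundary = {}"
      using g h by (auto simp: simple_curve_def)
    obtain s t where st: "s \<in> {0<..<1}" "t \<in> {0<..<1}" "f s = f' t"
      using crosses_imp_interior_meet[OF m n cr f bd(1) f' bd(2)] by blast
    then have "g s = h t" using f(1) f'(1) by (simp add: lifts_def)
    then show False using disj st(1,2) by blast
  qed
  obtain g h where gh: "g \<in> arc_of m n u v" "h \<in> arc_of m n x y" "simple_curve m n g" "simple_curve m n h"
    "g ` {0<..<1} \<inter> h ` {0<..<1} = {}"
    using assms unfolding compatible_def by blast
  then obtain u' v' x' y' where "g \<in> curve_class m n u' v'" "h \<in> curve_class m n x' y'" "crosses u' v' x' y'"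
    using cr crosses_commute unfolding arc_of_def by (metis UnE)
  then show False using * gh by blast
qed

lemma no_crossing_imp_compatible:
  assumes "chord m n u v" "chord m n x y" "\<And>k. \<not> crosses u v (shift m n k x) (shift m n k y)"
    and ne: "arc_of m n u v \<noteq> arc_of m n x y"
  shows "compatible m n (arc_of m n u v) (arc_of m n x y)"
proof -
  have "{u, v} \<noteq> {shift m n k x, shift m n k y}" for k
    using ne arc_of_shift[of k x y] arc_of_commute by (metis doubleton_eq_iff)
  then have "\<exists>g\<in>curve_class m n u v. \<exists>h\<in>curve_class m n x y. simple_curve m n g \<and> simple_curve m n h \<and> g ` {0<..<1} \<inter> h ` {0<..<1} = {}"
    by (intro disjoint_curves[OF m n] assms)
  then show ?thesis unfolding compatible_def arc_of_def by blast
qed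

lemma same_arc_no_crossing:
  assumes "chord m n u v" "arc_of m n u v = arc_of m n x y"
  shows "\<not> crosses u v x y"
  using assms(2) chord_no_self_crossing[OF assms(1)] crosses_commute(2) unfolding arc_of_eq by metis

lemma edges_chord:
  assumes "T \<subseteq> arcs m n" "edges m n T u v"
  shows "chord m n u v"
proof -
  obtain x y where xy: "chord m n x y" "arc_of m n x y = arc_of m n u v"
    using assms arcs_iff by (metis edges_def subsetD)
  then obtain k where "u = shift m n k x \<and> v = shift m n k y \<or> u = shift m n k y \<and> v = shift m n k x"
    unfolding arc_of_eq by blast
  then show ?thesis using xy(1) chord_sym[of m n x y] by (elim disjE) (simp_all add: chord_shift)
qed

lemma triangulation_imp_cover_triangulation:
  assumes "triangulation m n T"
  shows "cover_triangulation m n (edges m n T)"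
proof (rule cover_triangulationI)
  have T: "T \<subseteq> arcs m n" "pairwise (compatible m n) T"
    and max: "\<And>T'. T \<subseteq> T' \<Longrightarrow> T' \<subseteq> arcs m n \<Longrightarrow> pairwise (compatible m n) T' \<Longrightarrow> T' = T"
    using assms unfolding triangulation_def by blast+
  show "0 < m" "0 < n" by (fact m n)+
  show "edges m n T v u" if "edges m n T u v" for u v
    using that by (simp add: edges_def arc_of_commute)
  show shift: "edges m n T (shift m n k u) (shift m n k v)" if "edges m n T u v" for u v k
    using that by (simp add: edges_def arc_of_shift)
  show chord: "chord m n u v" if "edges m n T u v" for u v
    using edges_chord[OF T(1) that] .
  show "\<not> crosses u v x y" if "edges m n T u v" "edges m n T x y" for u v x y
  proof (cases "arc_of m n u v = arc_of m n x y")
    case True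
    then show ?thesis using same_arc_no_crossing chord that by blast
  next
    case False
    then show ?thesis
      using T(2) that compatible_imp_no_crossing unfolding pairwise_def edges_def by blast
  qed
  show "edges m n T u v"
    if uv: "chord m n u v" and nc: "\<And>x y. edges m n T x y \<Longrightarrow> \<not> crosses u v x y" for u v
  proof -
    let ?\<alpha> = "arc_of m n u v"
    \<comment> \<open>Since \<open>edges m n T\<close> is closed under \<open>shift\<close>,
      \<open>nc\<close> covers all the translates that \<open>no_crossing_imp_compatible\<close>
      asks about.\<close>
    have comp: "compatible m n ?\<alpha> \<beta>" if \<beta>: "\<beta> \<in> T" "\<beta> \<noteq> ?\<alpha>" for \<beta>
    proof -
      obtain x y where xy: "chord m n x y" "\<beta> = arc_of m n x y"
        using \<beta>(1) T(1) arcs_iff by blast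
      then have "edges m n T x y" using \<beta>(1) by (simp add: edges_def)
      then show ?thesis
        using no_crossing_imp_compatible[OF uv xy(1)] nc shift \<beta>(2) xy(2) by auto
    qed
    have "insert ?\<alpha> T = T"
    proof (rule max)
      show "insert ?\<alpha> T \<subseteq> arcs m n" using T(1) uv arcs_iff by blast
      show "pairwise (compatible m n) (insert ?\<alpha> T)"
        unfolding pairwise_insert using T(2) comp compatible_sym by metis
    qed blast
    then show ?thesis by (auto simp: edges_def)
  qed
qed

lemma edges_arcs_of:
  assumes "cover_triangulation m n E"
  shows "edges m n (arcs_of m n E) u v \<longleftrightarrow> E u v"
proof
  assume "edges m n (arcs_of m n E) u v"
  then obtain x y where "arc_of m n x y = arc_of m n u v" "E x y"
    by (auto simp: edges_def arcs_of_def)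
  then show "E u v"
    using cover_triangulationD(3,4)[OF assms] unfolding arc_of_eq by metis
qed (auto simp: edges_def arcs_of_def)

lemma cover_triangulation_imp_triangulation:
  assumes "cover_triangulation m n E"
  shows "triangulation m n (arcs_of m n E)"
  unfolding triangulation_def
proof (intro conjI allI impI; (elim conjE)?)
  note ct = cover_triangulationD[OF assms]
  show "1 \<le> m" "1 \<le> n" using m n by auto
  show "arcs_of m n E \<subseteq> arcs m n"
    using ct(5) arcs_iff unfolding arcs_of_def by blast
  show "pairwise (compatible m n) (arcs_of m n E)"
    unfolding pairwise_def
  proof (intro ballI impI)
    fix \<alpha> \<beta> assume "\<alpha> \<in> arcs_of m n E" "\<beta> \<in> arcs_of m n E" "\<alpha> \<noteq> \<beta>"
    then obtain u v x y where "\<alpha> = arc_of m n u v" "\<beta> = arc_of m n x y" "E u v" "E x y"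
      unfolding arcs_of_def by blast
    then show "compatible m n \<alpha> \<beta>"
      using no_crossing_imp_compatible[of u v x y] ct(4,5,6) \<open>\<alpha> \<noteq> \<beta>\<close> by auto
  qed
  fix T' assume T': "arcs_of m n E \<subseteq> T'" "T' \<subseteq> arcs m n" "pairwise (compatible m n) T'"
  have "\<alpha> \<in> arcs_of m n E" if \<alpha>: "\<alpha> \<in> T'" for \<alpha>
  proof -
    obtain u v where uv: "chord m n u v" "\<alpha> = arc_of m n u v"
      using T'(2) \<alpha> arcs_iff by blast
    have "E u v"
    proof (rule ct(7)[OF uv(1)])
      fix x y assume "E x y"
      then have xy: "arc_of m n x y \<in> T'" using T'(1) by (auto simp: arcs_of_def)
      show "\<not> crosses u v x y"
      proof (cases "arc_of m n u v = arc_of m n x y")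
        case True
        then show ?thesis using same_arc_no_crossing uv(1) by blast
      next
        case False
        then show ?thesis
          using T'(3) \<alpha> uv(2) xy compatible_imp_no_crossing unfolding pairwise_def by blast
      qed
    qed
    then show ?thesis using uv(2) by (auto simp: arcs_of_def)
  qed
  then show "T' = arcs_of m n E" using T'(1) by blast
qed

section \<open>Corners and quiddity sequences\<close>

lemma side_iff_sides:
  assumes "T \<subseteq> arcs m n" "g \<in> curve_class m n u v"
  shows "side m n T g \<longleftrightarrow> sides (edges m n T) u v"
proof -
  have "g \<in> \<Union>T \<longleftrightarrow> edges m n T u v"
  proof
    assume "g \<in> \<Union>T"
    then obtain \<alpha> x y where "g \<in> \<alpha>" "\<alpha> \<in> T" "\<alpha> = arc_of m n x y"
      using assms(1) arcs_iff by blast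
    then have "g \<in> curve_class m n x y \<or> g \<in> curve_class m n y x" by (auto simp: arc_of_def)
    then have "arc_of m n u v = arc_of m n x y"
      using curve_class_disjoint[OF m n assms(2)] unfolding arc_of_eq by blast
    then show "edges m n T u v"
      using \<open>\<alpha> \<in> T\<close> \<open>\<alpha> = _\<close> by (simp add: edges_def)
  next
    assume "edges m n T u v"
    then show "g \<in> \<Union>T" using assms(2) by (auto simp: edges_def arc_of_def)
  qed
  moreover have "(\<exists>h. boundary_segment m n h \<and> homotopic_paths annulus g h) \<longleftrightarrow> neighbours u v"
    using homotopy_class_curve_class[OF m n assms(2)] boundary_segment_neighbours[OF m n]
      neighbours_boundary_segment[OF m n, of u v] unfolding homotopy_class_def by blast
  ultimately show ?thesis by (simp add: side_def sides_def)
qed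

lemma side_in_curve_class:
  assumes "T \<subseteq> arcs m n" "side m n T g" "pathstart g = exp (lifted m n u)"
  obtains x where "g \<in> curve_class m n u x"
proof -
  have "\<exists>x y. g \<in> curve_class m n x y"
  proof (cases "g \<in> \<Union>T")
    case True
    then obtain x y where "g \<in> arc_of m n x y" using assms(1) arcs_iff by blast
    then show ?thesis by (auto simp: arc_of_def)
  next
    case False
    then obtain h where h: "boundary_segment m n h" "homotopic_paths annulus g h"
      using assms(2) by (auto simp: side_def)
    then have "path h" "path_image h \<subseteq> annulus" "pathstart h \<in> marked_points m n" "pathfinish h \<in> marked_points m n"
      using boundary_subset_annulus by (auto simp: boundary_segment_def simple_path_def)
    then obtain x y where hxy: "h \<in> curve_class m n x y"
      using curve_class_exists[OF m n] marked_iff_lifted[OF m n] by metis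
    then show ?thesis
      using homotopy_class_curve_class[OF m n hxy] homotopic_paths_sym[OF h(2)] unfolding homotopy_class_def by blast
  qed
  then obtain x y where xy: "g \<in> curve_class m n x y" by blast
  then obtain k where "u = shift m n k x"
    using assms(3) curve_class_ends(1)[OF m n xy] exp_lifted_eq[OF m n, of u x] by auto
  then show ?thesis using that xy curve_class_shift[OF m n] by metis
qed

text \<open>Once a lift \<open>u\<close> of the point is fixed, each class leaving the point has a
  unique end vertex in the strip, and \<open>reversepath g +++ h\<close> joins two of these.
  Multiplicities are therefore counted correctly.\<close>

lemma corners_eq:
  assumes "T \<subseteq> arcs m n"
  shows "corners m n T (exp (lifted m n u)) = (`) (curve_class m n u) ` corner_pairs (edges m n T) u"
proof (intro set_eqI iffI)
  fix C assume "C \<in> corners m n T (exp (lifted m n u))"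
  then obtain g h where C: "C = {homotopy_class g, homotopy_class h}" and gh: "side m n T g" "side m n T h"
    "pathstart g = exp (lifted m n u)" "pathstart h = exp (lifted m n u)" "side m n T (reversepath g +++ h)"
    unfolding corners_def by blast
  obtain x where x: "g \<in> curve_class m n u x" using side_in_curve_class[OF assms gh(1,3)] .
  obtain y where y: "h \<in> curve_class m n u y" using side_in_curve_class[OF assms gh(2,4)] .
  have "reversepath g +++ h \<in> curve_class m n x y"
    using curve_class_joinpaths[OF m n curve_class_reversepath[OF m n x] y] .
  then have "{x, y} \<in> corner_pairs (edges m n T) u"
    using gh x y side_iff_sides[OF assms] unfolding corner_pairs_def by blast
  moreover have "C = curve_class m n u ` {x, y}"
    using C homotopy_class_curve_class[OF m n x] homotopy_class_curve_class[OF m n y] by simp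
  ultimately show "C \<in> (`) (curve_class m n u) ` corner_pairs (edges m n T) u" by blast
next
  fix C assume "C \<in> (`) (curve_class m n u) ` corner_pairs (edges m n T) u"
  then obtain d where "d \<in> corner_pairs (edges m n T) u" "C = curve_class m n u ` d" by (elim imageE)
  then obtain x y where C: "C = {curve_class m n u x, curve_class m n u y}" and xy: "sides (edges m n T) u x"
    "sides (edges m n T) u y" "sides (edges m n T) x y"
    unfolding corner_pairs_def by auto
  obtain g h where x: "g \<in> curve_class m n u x" and y: "h \<in> curve_class m n u y"
    using curve_class_nonempty[OF m n] by blast
  have j: "reversepath g +++ h \<in> curve_class m n x y"
    using curve_class_joinpaths[OF m n curve_class_reversepath[OF m n x] y] .
  have "C = {homotopy_class g, homotopy_class h}"
    using C homotopy_class_curve_class[OF m n x] homotopy_class_curve_class[OF m n y] by simp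
  then show "C \<in> corners m n T (exp (lifted m n u))"
    unfolding corners_def
    using xy side_iff_sides[OF assms x] side_iff_sides[OF assms y] side_iff_sides[OF assms j]
      curve_class_ends(1)[OF m n x] curve_class_ends(1)[OF m n y] by blast
qed

lemma card_corners:
  assumes "T \<subseteq> arcs m n"
  shows "card (corners m n T (exp (lifted m n u))) = valency (edges m n T) u"
proof -
  have "inj (curve_class m n u)" using curve_class_inj[OF m n] by (simp add: inj_def)
  then show ?thesis
    unfolding corners_eq[OF assms] valency_def
    by (intro card_image inj_on_image) (metis inj_on_subset subset_UNIV)
qed

lemma has_quiddity_outer:
  assumes "T \<subseteq> arcs m n"
  shows "has_quiddity F (outer_quiddity m n T) \<longleftrightarrow> (\<exists>t. \<forall>i. F i 2 = int (valency (edges m n T) (Outer (i + t))))"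
proof -
  have "outer_quiddity m n T ! nat (i mod int m) = int (valency (edges m n T) (Outer i))" for i
  proof -
    obtain k j where j: "j < m" "Outer i = shift m n k (Outer (int j))" using shift_mod(1)[OF m n] by blast
    then have i: "i = int j + k * int m" by simp
    then have "nat (i mod int m) = j" using j(1) by simp
    moreover have "exp (lifted m n (Outer i)) = outer_point m j"
      using j(2) exp_lifted_eq[OF m n] exp_lifted_Outer[OF m n] by metis
    ultimately show ?thesis
      using card_corners[OF assms, of "Outer i"] j(1) by (simp add: outer_quiddity_def)
  qed
  moreover have "length (outer_quiddity m n T) = m" by (simp add: outer_quiddity_def)
  ultimately show ?thesis using m by (auto simp: has_quiddity_def)
qed

lemma has_quiddity_inner:
  assumes "T \<subseteq> arcs m n"
  shows "has_quiddity F (inner_quiddity m n T) \<longleftrightarrow> (\<exists>t. \<forall>i. F i 2 = int (valency (edges m n T) (Inner (i + t))))"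
proof -
  have "inner_quiddity m n T ! nat (i mod int n) = int (valency (edges m n T) (Inner i))" for i
  proof -
    obtain k j where j: "j < n" "Inner i = shift m n k (Inner (int j))" using shift_mod(2)[OF m n] by blast
    then have i: "i = int j + k * int n" by simp
    then have "nat (i mod int n) = j" using j(1) by simp
    moreover have "exp (lifted m n (Inner i)) = inner_point n j"
      using j(2) exp_lifted_eq[OF m n] exp_lifted_Inner[OF m n] by metis
    ultimately show ?thesis
      using card_corners[OF assms, of "Inner i"] j(1) by (simp add: inner_quiddity_def)
  qed
  moreover have "length (inner_quiddity m n T) = n" by (simp add: inner_quiddity_def)
  ultimately show ?thesis using n by (auto simp: has_quiddity_def)
qed

end

text \<open>The bridge from topology to combinatorics: what follows only uses triangulations of the
  strip.\<close>

theorem annulus_pair_iff: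
  "annulus_pair F G \<longleftrightarrow> infinite_frieze F \<and> infinite_frieze G \<and>
    (\<exists>m n E. cover_triangulation m n E \<and> (\<exists>t. \<forall>i. F i 2 = int (valency E (Outer (i + t)))) \<and>
       (\<exists>t. \<forall>i. G i 2 = int (valency E (Inner (i + t)))))" (is "_ \<longleftrightarrow> _ \<and> _ \<and> ?R")
proof -
  have "(\<exists>m n T. triangulation m n T \<and> has_quiddity F (outer_quiddity m n T) \<and> has_quiddity G (inner_quiddity m n T)) \<longleftrightarrow> ?R"
    (is "?L \<longleftrightarrow> _")
  proof
    assume ?L
    then obtain m n T where T: "triangulation m n T" "has_quiddity F (outer_quiddity m n T)"
      "has_quiddity G (inner_quiddity m n T)" by blast
    then have mn: "m > 0" "n > 0" and sub: "T \<subseteq> arcs m n" by (auto simp: triangulation_def)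
    show ?R
      using triangulation_imp_cover_triangulation[OF mn T(1)] T(2,3) has_quiddity_outer[OF mn sub] has_quiddity_inner[OF mn sub] by blast
  next
    assume ?R
    then obtain m n E where E: "cover_triangulation m n E" "\<exists>t. \<forall>i. F i 2 = int (valency E (Outer (i + t)))"
      "\<exists>t. \<forall>i. G i 2 = int (valency E (Inner (i + t)))" by blast
    have mn: "m > 0" "n > 0" using cover_triangulationD[OF E(1)] by blast+
    let ?T = "arcs_of m n E"
    have tri: "triangulation m n ?T" using cover_triangulation_imp_triangulation[OF mn E(1)] .
    then have sub: "?T \<subseteq> arcs m n" by (auto simp: triangulation_def)
    have "edges m n ?T = E" using edges_arcs_of[OF mn E(1)] by (intro ext)
    then show ?L
      using tri E(2,3) has_quiddity_outer[OF mn sub] has_quiddity_inner[OF mn sub] by metis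
  qed
  then show ?thesis by (simp add: annulus_pair_def)
qed

section \<open>Skeletal friezes\<close>

lemma periodic_int:
  fixes f :: "int \<Rightarrow> 'a"
  assumes "\<And>i. f (i + p) = f i"
  shows "f (i + k * p) = f i"
proof (induction k rule: int_induct[where k = 0])
  case (step1 k)
  then show ?case using assms[of "i + k * p"] by (simp add: algebra_simps)
next
  case (step2 k)
  then show ?case using assms[of "i + (k - 1) * p"] by (simp add: algebra_simps)
qed simp

text \<open>For positive entries, avoiding 1 means being at least 2, and a sequence of such entries
  other than all 2 has an entry at least 3. Conversely, any period supplies a quiddity
  sequence.\<close>

lemma skeletal_frieze_iff:
  "skeletal_frieze F \<longleftrightarrow> infinite_frieze F \<and> periodic_frieze F \<and> (\<forall>i. F i 2 \<ge> 2) \<and> (\<exists>i. F i 2 \<ge> 3)"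
proof
  assume "skeletal_frieze F"
  then obtain q t where F: "infinite_frieze F" and q: "q \<noteq> []" "1 \<notin> set q" "q \<noteq> replicate (length q) 2"
    and Fq: "\<And>i. F i 2 = q ! nat ((i + t) mod int (length q))"
    unfolding skeletal_frieze_def has_quiddity_def skeletal_sequence_def reduced_sequence_def by blast
  have "F (i + int (length q)) 2 = F i 2" for i
  proof -
    have "(i + int (length q) + t) mod int (length q) = (i + t) mod int (length q)"
      by (metis add.assoc add.commute mod_add_self2)
    then show ?thesis unfolding Fq by simp
  qed
  then have per: "periodic_frieze F"
    unfolding periodic_frieze_def using q(1) by (intro exI[of _ "int (length q)"]) auto
  have F2: "F i 2 \<ge> 2" for i
  proof -
    have "nat ((i + t) mod int (length q)) < length q" using q(1) by (simp add: nat_less_iff)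
    then have "F i 2 \<noteq> 1" unfolding Fq using q(2) nth_mem by metis
    moreover have "F i 2 > 0" using F unfolding infinite_frieze_def by blast
    ultimately show ?thesis by linarith
  qed
  obtain k where k: "k < length q" "q ! k \<noteq> 2"
    using q(3) by (metis length_replicate nth_equalityI nth_replicate)
  then have "F (int k - t) 2 \<noteq> 2" unfolding Fq by simp
  then have "F (int k - t) 2 \<ge> 3" using F2[of "int k - t"] by linarith
  then show "infinite_frieze F \<and> periodic_frieze F \<and> (\<forall>i. F i 2 \<ge> 2) \<and> (\<exists>i. F i 2 \<ge> 3)"
    using F per F2 by blast
next
  assume "infinite_frieze F \<and> periodic_frieze F \<and> (\<forall>i. F i 2 \<ge> 2) \<and> (\<exists>i. F i 2 \<ge> 3)"
  then obtain n' j where F: "infinite_frieze F" and n': "n' > 0" "\<And>i. F (i + n') 2 = F i 2"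
    and ge: "\<And>i. F i 2 \<ge> 2" and j: "F j 2 \<ge> 3"
    unfolding periodic_frieze_def by blast
  define n where "n = nat n'"
  have n: "n > 0" "int n = n'" using n' by (auto simp: n_def)
  let ?q = "map (\<lambda>k. F (int k) 2) [0..<n]"
  have nth: "F i 2 = ?q ! nat (i mod int n)" for i
  proof -
    have "nat (i mod int n) < n" using n by (simp add: nat_less_iff)
    then have "?q ! nat (i mod int n) = F (i mod int n) 2" using n(1) by simp
    also have "\<dots> = F (i mod int n + (i div int n) * n') 2"
      using periodic_int[of "\<lambda>i. F i 2" n' "i mod int n" "i div int n"] n'(2) by simp
    finally show ?thesis using n(2) by simp
  qed
  have "has_quiddity F ?q"
    unfolding has_quiddity_def
  proof (intro conjI exI allI)
    show "?q \<noteq> []" using n(1) by simp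
    show "F i 2 = ?q ! nat ((i + 0) mod int (length ?q))" for i
      unfolding length_map length_upt diff_zero add_0_right by (rule nth)
  qed
  moreover have "1 \<notin> set ?q"
    using ge by (auto simp: image_iff) (metis numeral_le_one_iff semiring_norm(69))
  moreover have "?q \<noteq> replicate (length ?q) 2"
  proof
    assume "?q = replicate (length ?q) 2"
    moreover have "nat (j mod int n) < length ?q" using n by (simp add: nat_less_iff)
    ultimately have "?q ! nat (j mod int n) = 2" by (metis nth_replicate)
    then show False using nth[of j] j by simp
  qed
  ultimately show "skeletal_frieze F"
    unfolding skeletal_frieze_def skeletal_sequence_def reduced_sequence_def using F by blast
qed

section \<open>Realising a skeletal quiddity row\<close>

lemma int_summation:
  fixes c :: "int \<Rightarrow> int"
  obtains L where "\<And>i. L (i + 1) = L i + c i"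
proof
  define L where "L i = sum c {0..<i} - sum c {i..<0}" for i
  show "L (i + 1) = L i + c i" for i
  proof (cases "i \<ge> 0")
    case True
    then have "{0..<i + 1} = insert i {0..<i}" "{i..<0} = {}" "{i + 1..<0} = {}" by auto
    then show ?thesis by (simp add: L_def)
  next
    case False
    then have "{i..<0} = insert i {i + 1..<0}" "{0..<i} = {}" "{0..<i + 1} = {}" by auto
    then show ?thesis by (simp add: L_def)
  qed
qed

text \<open>The valency formula dictates \<open>L\<close> as an antidifference of
  \<open>a i - 2\<close>; the inner valencies are read off from its dual.\<close>

lemma skeletal_zigzag:
  fixes a :: "int \<Rightarrow> int"
  assumes m: "m > 0" and per: "\<And>i. a (i + int m) = a i" and ge: "\<And>i. a i \<ge> 2" and big: "\<exists>i. a i \<ge> 3"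
  obtains n L where "cover_triangulation m n (zigzag L)" "\<And>i. L i \<le> L (i + 1)" "\<And>i. int (valency (zigzag L) (Outer i)) = a i"
    "\<And>j. valency (zigzag L) (Inner j) \<ge> 2" "\<exists>j. valency (zigzag L) (Inner j) \<ge> 3"
proof -
  obtain L where L: "\<And>i. L (i + 1) = L i + (a i - 2)" using int_summation[of "\<lambda>i. a i - 2"] by blast
  have step: "L i \<le> L (i + 1)" for i using L[of i] ge[of i] by linarith
  have mono: "L i \<le> L j" if "i \<le> j" for i j
    using mono_int_stepI[of L] step that by (simp add: mono_def)
  have D: "L (i + int m) - L i = L (int m) - L 0" for i
  proof (induction i rule: int_induct[where k = 0])
    case (step1 i)
    then show ?case using L[of "i + int m"] L[of i] per[of i] by (simp add: add.commute add.left_commute)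
  next
    case (step2 i)
    then show ?case using L[of "i - 1 + int m"] L[of "i - 1"] per[of "i - 1"] by (simp add: add.commute add.left_commute)
  qed simp
  \<comment> \<open>The sum of \<open>a i - 2\<close> over one period, positive thanks to the entry
    at least 3.\<close>
  define n where "n = nat (L (int m) - L 0)"
  obtain i0 where "a i0 \<ge> 3" using big by blast
  then have "L i0 < L (i0 + int m)" using L[of i0] mono[of "i0 + 1" "i0 + int m"] m by linarith
  then have n: "n > 0" and perL: "L (i + int m) = L i + int n" for i
    using D[of i0] D[of i] by (auto simp: n_def)
  \<comment> \<open>The function \<open>L i * m - i * n\<close> is periodic; scaling by
    \<open>m\<close> avoids fractions.\<close>
  have perk: "L (i + k * int m) = L i + k * int n" for i k
  proof -
    have "L (i + k * int m) * int m = (L i + k * int n) * int m"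
      using periodic_int[of "\<lambda>i. L i * int m - i * int n" "int m" i k] perL by (simp add: algebra_simps)
    then show ?thesis using m by simp
  qed
  have lo: "\<exists>i. L i < j" for j
  proof -
    define k where "k = - (\<bar>j\<bar> + \<bar>L 0\<bar> + 1)"
    have "k * int n \<le> k * 1" using n by (intro mult_left_mono_neg) (auto simp: k_def)
    then have "L 0 + k * int n < j" using k_def by linarith
    then show ?thesis using perk[of 0 k] by metis
  qed
  have hi: "\<exists>i. j \<le> L i" for j
  proof -
    define k where "k = \<bar>j\<bar> + \<bar>L 0\<bar>"
    have "k * 1 \<le> k * int n" using n by (intro mult_left_mono) (auto simp: k_def)
    then have "j \<le> L 0 + k * int n" using k_def by linarith
    then show ?thesis using perk[of 0 k] by metis
  qed
  obtain L' where L': "\<And>j. L' j \<le> L' (j + 1)" "\<And>u v. zigzag L (flip u) (flip v) = zigzag L' u v"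
    "\<And>i j. i \<le> L' j \<longleftrightarrow> L i < j"
    using zigzag_dual[of L] step lo hi by metis
  \<comment> \<open>The witness satisfies \<open>L (L' j) < j \<le> L (L' j + 1)\<close>.\<close>
  have "\<exists>i. L i \<le> j \<and> j \<le> L (i + 1)" for j
    using L'(3)[of "L' j" j] L'(3)[of "L' j + 1" j] by (intro exI[of _ "L' j"]) auto
  then have "cover_triangulation m n (zigzag L)"
    using cover_triangulation_zigzag m n step perL by blast
  moreover have "int (valency (zigzag L) (Outer i)) = a i" for i
    using valency_zigzag_Outer[of L i] step L[of i] by simp
  moreover have inner: "int (valency (zigzag L) (Inner j)) = 2 + L' (j + 1) - L' j" for j
  proof -
    have "valency (zigzag L) (Inner j) = valency (zigzag L') (Outer j)"
      using valency_flip[of "zigzag L" "Outer j"] L'(2) by simp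
    then show ?thesis using valency_zigzag_Outer[of L' j] L'(1) by simp
  qed
  moreover have "valency (zigzag L) (Inner j) \<ge> 2" for j
    using inner[of j] L'(1)[of j] by linarith
  moreover have "\<exists>j. valency (zigzag L) (Inner j) \<ge> 3"
  proof (rule ccontr)
    assume "\<not> ?thesis"
    then have "L' (j + 1) = L' j" for j
    proof -
      have "valency (zigzag L) (Inner j) < 3" using \<open>\<not> _\<close> by (metis not_le)
      then show ?thesis using inner[of j] L'(1)[of j] by linarith
    qed
    then have const: "L' j = L' 0" for j
      using periodic_int[of L' 1 0 j] by simp
    \<comment> \<open>The argument is the first index j with \<open>L (L' 0 + 1) < j\<close>, where
      \<open>L'\<close> must exceed \<open>L' 0\<close>.\<close>
    have "L' 0 + 1 \<le> L' (L (L' 0 + 1) + 1)"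
      unfolding L'(3) by simp
    then show False using const[of "L (L' 0 + 1) + 1"] by simp
  qed
  ultimately show ?thesis using that step by blast
qed

text \<open>Every round glues an ear next to \<open>Inner 0\<close> and so raises its valency.
  Carrying a supersolution along is what keeps the inner row the quiddity row of an infinite frieze
  although it now contains ones.\<close>

lemma cover_triangulation_iterated_ear:
  assumes "cover_triangulation m n E" and fin: "\<And>j. finite (corner_pairs E (Inner j))"
    and sup: "supersolution (\<lambda>j. int (valency E (Inner j))) x"
  shows "\<exists>E' x'. cover_triangulation m (n + k) E' \<and> (\<forall>i. valency E' (Outer i) = valency E (Outer i)) \<and>
    (\<forall>j. finite (corner_pairs E' (Inner j))) \<and> supersolution (\<lambda>j. int (valency E' (Inner j))) x' \<and>
    valency E' (Inner 0) \<ge> k"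
proof (induction k)
  case 0
  then show ?case using assms by auto
next
  case (Suc k)
  then obtain E' x where ct: "cover_triangulation m (n + k) E'" and O: "\<And>i. valency E' (Outer i) = valency E (Outer i)"
    and fin: "\<And>j. finite (corner_pairs E' (Inner j))"
    and sup: "supersolution (\<lambda>j. int (valency E' (Inner j))) x" and k: "valency E' (Inner 0) \<ge> k"
    by blast
  let ?N = "n + k" and ?E = "ear (n + k) E'"
  note N = cover_triangulationD(2)[OF ct]
  have sym: "\<And>u v. E' u v \<Longrightarrow> E' v u" using cover_triangulationD(3)[OF ct] .
  have irr: "\<not> E' u u" for u using cover_triangulationD(5)[OF ct, of u u] by (cases u) auto
  have ctE: "cover_triangulation m (n + Suc k) ?E" using cover_triangulation_ear[OF N ct] by simp
  have OE: "valency ?E (Outer i) = valency E (Outer i)" for i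
    using valency_ear_Outer[OF N] O by simp
  have val: "valency ?E (Inner (insert_index ?N j)) = valency E' (Inner j)
      + (if j mod int ?N = 0 then 1 else 0) + (if (j + 1) mod int ?N = 0 then 1 else 0)" for j
    using valency_ear_Inner(1)[OF N sym irr fin] .
  have tip: "valency ?E (Inner (tip ?N q)) = 1" for q
    using valency_ear_tip[OF N irr] .
  have finE: "finite (corner_pairs ?E (Inner v))" for v
    using insert_index_or_tip[OF N, of v] valency_ear_Inner(2)[OF N sym irr fin] corner_pairs_ear_tip[OF N, of E', OF irr]
    by (metis finite.emptyI finite_insert)
  \<comment> \<open>A tip has valency 1, so its value must be at least the sum of its neighbours'
    values, and equality is chosen. At an old vertex beside the tip this raises the neighbour sum by
    \<open>x j\<close>, just what the additional corner contributes on the right.\<close>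
  define x' where "x' v = (if v \<in> range (insert_index ?N) then x (inv (insert_index ?N) v)
      else x (v div (int ?N + 1) * int ?N + int ?N - 1) + x (v div (int ?N + 1) * int ?N + int ?N))" for v
  have inj: "inj (insert_index ?N)" using insert_index_eq[OF N] by (simp add: inj_def)
  have x'_insert_index: "x' (insert_index ?N j) = x j" for j
    using inj by (simp add: x'_def)
  have x'_tip: "x' (tip ?N q) = x (q * int ?N + int ?N - 1) + x (q * int ?N + int ?N)" for q
  proof -
    have "tip ?N q \<notin> range (insert_index ?N)" using tip_not_insert_index[OF N] by blast
    moreover have "tip ?N q div (int ?N + 1) = q" by (simp add: tip_def)
    ultimately show ?thesis by (simp only: x'_def if_False)
  qed
  have up: "x' (insert_index ?N j + 1) = x (j + 1) + (if (j + 1) mod int ?N = 0 then x j else 0)" for j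
  proof (cases "(j + 1) mod int ?N = 0")
    case True
    then have "j + 1 = ((j + 1) div int ?N) * int ?N" using div_mult_mod_eq[of "j + 1" "int ?N"] by simp
    then obtain q where "j = q * int ?N + int ?N - 1"
      by (metis add_diff_cancel_right' diff_add_cancel left_diff_distrib mult_1)
    then show ?thesis
      using True tip_insert_index(1)[OF N, of q, symmetric] x'_tip[of q] by simp
  next
    case False
    then show ?thesis using insert_index_Suc[OF N, of j] x'_insert_index[of "j + 1"] by simp
  qed
  have down: "x' (insert_index ?N j - 1) = x (j - 1) + (if j mod int ?N = 0 then x j else 0)" for j
  proof (cases "j mod int ?N = 0")
    case True
    then have "insert_index ?N j - 1 = insert_index ?N (j - 1) + 1" using insert_index_Suc[OF N, of "j - 1"] by simp
    then show ?thesis by (simp only: up) (use True in simp)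
  next
    case False
    then have "insert_index ?N j - 1 = insert_index ?N (j - 1)" using insert_index_Suc[OF N, of "j - 1"] by simp
    then show ?thesis using x'_insert_index[of "j - 1"] False by simp
  qed
  have pos: "x j > 0" and le: "x (j - 1) + x (j + 1) \<le> int (valency E' (Inner j)) * x j" for j
    using sup unfolding supersolution_def by blast+
  have "supersolution (\<lambda>j. int (valency ?E (Inner j))) x'"
    unfolding supersolution_def
  proof (intro conjI allI)
    fix v
    consider (insert_index) j where "v = insert_index ?N j" | (tip) q where "v = tip ?N q" using insert_index_or_tip[OF N] by blast
    then have "x' v > 0 \<and> x' (v - 1) + x' (v + 1) \<le> int (valency ?E (Inner v)) * x' v"
    proof cases
      case insert_index
      then show ?thesis
        using pos[of j] le[of j] by (simp add: up down val x'_insert_index distrib_right)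
    next
      case tip': tip
      have "x' (v - 1) + x' (v + 1) = x' v"
        unfolding tip' tip_insert_index[OF N] x'_insert_index x'_tip by simp
      then show ?thesis
        unfolding tip' tip x'_tip using pos by (simp add: add_pos_pos)
    qed
    then show "x' v > 0" "x' (v - 1) + x' (v + 1) \<le> int (valency ?E (Inner v)) * x' v" by blast+
  qed
  \<comment> \<open>Index 0 opens a block and is fixed by \<open>insert_index\<close>, so it gains a
    corner each time.\<close>
  moreover have "valency ?E (Inner 0) \<ge> Suc k"
    using val[of 0] k by (simp add: insert_index_def)
  ultimately show ?case using ctE OE finE by blast
qed

section \<open>Uniqueness of the skeletal partner and the infinite family\<close>

lemma finite_frieze_values:
  assumes "periodic_frieze F"
  shows "finite (range (\<lambda>i. F i 2))"
proof -
  obtain p where p: "p > 0" "\<And>i. F (i + p) 2 = F i 2"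
    using assms unfolding periodic_frieze_def by blast
  have "F i 2 \<in> (\<lambda>i. F i 2) ` {0..<p}" for i
  proof -
    have "F i 2 = F (i mod p + i div p * p) 2" by simp
    also have "\<dots> = F (i mod p) 2"
      using periodic_int[of "\<lambda>i. F i 2" p "i mod p" "i div p"] p(2) by simp
    finally show ?thesis using p(1) by auto
  qed
  then have "range (\<lambda>i. F i 2) \<subseteq> (\<lambda>i. F i 2) ` {0..<p}" by blast
  then show ?thesis by (rule finite_subset) simp
qed

theorem theoremA:
  fixes F1 F1s :: frieze
  assumes "infinite_frieze F1" and "periodic_frieze F1"
    and "reduced_frieze F1 F1s" and "skeletal_frieze F1s"
  shows "(\<exists>F2s. skeletal_frieze F2s \<and> annulus_pair F1s F2s \<and>
            (\<forall>G. skeletal_frieze G \<and> annulus_pair F1s G \<longrightarrow> G \<in> translates F2s)) \<and>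
         infinite (translates ` {F2. infinite_frieze F2 \<and> periodic_frieze F2 \<and> annulus_pair F1s F2})"
proof -
  have F1s: "infinite_frieze F1s" and ge: "\<And>i. F1s i 2 \<ge> 2" and big: "\<exists>i. F1s i 2 \<ge> 3"
    using assms(4) unfolding skeletal_frieze_iff by blast+
  obtain p where p: "p > 0" "\<And>i. F1s (i + p) 2 = F1s i 2"
    using assms(4) unfolding skeletal_frieze_iff periodic_frieze_def by blast
  obtain n L where ct: "cover_triangulation (nat p) n (zigzag L)" and L: "\<And>i. L i \<le> L (i + 1)"
    and outer: "\<And>i. int (valency (zigzag L) (Outer i)) = F1s i 2"
    and inner: "\<And>j. valency (zigzag L) (Inner j) \<ge> 2" "\<exists>j. valency (zigzag L) (Inner j) \<ge> 3"
    using skeletal_zigzag[of "nat p" "\<lambda>i. F1s i 2"] p ge big by auto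
  let ?b = "\<lambda>E j. int (valency E (Inner j))"
  \<comment> \<open>With the constant 1 the condition reads \<open>2 \<le> b j\<close>.\<close>
  have sup: "supersolution (?b (zigzag L)) (\<lambda>_. 1)"
    using inner(1) by (auto simp: supersolution_def)
  have periodic: "periodic_frieze (continuant (?b E))" if "cover_triangulation (nat p) n E" for E n
  proof -
    have "?b E (i + int n) = ?b E i" for i
      using cover_triangulation_valency_shift[OF that, of 1 "Inner i"] by simp
    then show ?thesis
      unfolding periodic_frieze_def using cover_triangulationD(2)[OF that] by (intro exI[of _ "int n"]) simp
  qed
  have pair: "annulus_pair F1s (continuant (?b E))"
    if "cover_triangulation (nat p) n E" "\<And>i. int (valency E (Outer i)) = F1s i 2" "supersolution (?b E) x" for E n x
    unfolding annulus_pair_iff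
  proof (intro conjI exI)
    show "cover_triangulation (nat p) n E" by fact
    show "\<forall>i. F1s i 2 = int (valency E (Outer (i + 0)))" using that(2) by simp
    show "\<forall>i. continuant (?b E) i 2 = int (valency E (Inner (i + 0)))" by simp
  qed (use F1s infinite_frieze_continuant[OF that(3)] in auto)
  define F2s where "F2s = continuant (?b (zigzag L))"
  have F2s: "skeletal_frieze F2s"
    unfolding skeletal_frieze_iff F2s_def
    using infinite_frieze_continuant[OF sup] periodic[OF ct] inner by (auto intro: exI)
  have unique: "G \<in> translates F2s" if G: "skeletal_frieze G" "annulus_pair F1s G" for G
  proof -
    have G': "infinite_frieze G" "\<And>i. G i 2 \<ge> 2"
      using G(1) unfolding skeletal_frieze_iff by blast+
    obtain m' n' E s t where E: "cover_triangulation m' n' E" and s: "\<And>i. F1s i 2 = int (valency E (Outer (i + s)))"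
      and t: "\<And>i. G i 2 = int (valency E (Inner (i + t)))"
      using G(2) unfolding annulus_pair_iff by blast
    have "valency E u \<ge> 2" for u
    proof (cases u)
      case (Outer i)
      then show ?thesis using s[of "i - s"] ge[of "i - s"] by simp
    next
      case (Inner j)
      then show ?thesis using t[of "j - t"] G'(2)[of "j - t"] by simp
    qed
    then obtain K where K: "\<And>i. K i \<le> K (i + 1)" "E = zigzag K"
      using cover_triangulation_imp_zigzag[OF E] by blast
    \<comment> \<open>Both increments equal the quiddity of \<open>F1s\<close> at i minus 2. Hence
      \<open>K\<close>, shifted by \<open>s\<close>, differs from \<open>L\<close> by a constant,
      and the two triangulations are translates of each other.\<close>
    have "K (i + 1 + s) - L (i + 1) = K (i + s) - L i" for i
      using valency_zigzag_Outer[of K "i + s"] valency_zigzag_Outer[of L i] K L outer[of i] s[of i]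
      by (simp add: add.commute add.left_commute)
    then have eq: "K (i + s) = L i + (K s - L 0)" for i
      using periodic_int[of "\<lambda>i. K (i + s) - L i" 1 0 i] by simp
    define e where "e = K s - L 0"
    have "E (translate s e u) (translate s e v) \<longleftrightarrow> zigzag L u v" for u v
      unfolding K(2) using eq[folded e_def] eq[of "_ + 1", folded e_def]
      by (cases u; cases v) (auto simp: add.commute add.left_commute)
    then have "valency (zigzag L) u = valency E (translate s e u)" for u
      using valency_translate[of E s e u] by simp
    then have "G i 2 = F2s (i + (t - e)) 2" for i
      using t[of i] by (simp add: F2s_def)
    then have "\<forall>i k. G i k = F2s (i + (t - e)) k"
      using infinite_frieze_unique[of F2s G] F2s G'(1) unfolding skeletal_frieze_iff by blast
    then show ?thesis unfolding translates_def by blast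
  qed
  let ?S = "{F2. infinite_frieze F2 \<and> periodic_frieze F2 \<and> annulus_pair F1s F2}"
  have "infinite (translates ` ?S)"
  proof
    assume fin: "finite (translates ` ?S)"
    \<comment> \<open>As the classes contain all translates, position 0 sees every quiddity value
      occurring in them.\<close>
    define V where "V = (\<Union>A\<in>translates ` ?S. (\<lambda>F. F 0 2) ` A)"
    have "finite V"
      unfolding V_def
    proof (rule finite_UN_I[OF fin])
      fix A assume "A \<in> translates ` ?S"
      then obtain F where F: "periodic_frieze F" "A = translates F" by blast
      then have "(\<lambda>F. F 0 2) ` A \<subseteq> range (\<lambda>i. F i 2)" by (auto simp: translates_def)
      then show "finite ((\<lambda>F. F 0 2) ` A)" using finite_frieze_values[OF F(1)] finite_subset by blast
    qed
    then obtain B where B: "\<And>v. v \<in> V \<Longrightarrow> v \<le> B"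
      using bdd_above_finite[of V] unfolding bdd_above_def by blast
    \<comment> \<open>An infinite set has \<open>card\<close> 0, so valency at least 2 already gives
      finiteness.\<close>
    have finc: "finite (corner_pairs (zigzag L) (Inner j))" for j
      using inner(1)[of j] unfolding valency_def by (metis card.infinite not_numeral_le_zero)
    obtain E x where E: "cover_triangulation (nat p) (n + nat (B + 1)) E" "\<And>i. valency E (Outer i) = valency (zigzag L) (Outer i)"
      "supersolution (?b E) x" "valency E (Inner 0) \<ge> nat (B + 1)"
      using cover_triangulation_iterated_ear[OF ct finc sup, of "nat (B + 1)"] by blast
    let ?F = "continuant (?b E)"
    have "?F \<in> ?S"
      using infinite_frieze_continuant[OF E(3)] periodic[OF E(1)] pair[OF E(1) _ E(3)] E(2) outer by simp
    moreover have "?F \<in> translates ?F" by (auto simp: translates_def intro: exI[of _ 0])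
    ultimately have "?F 0 2 \<in> V" unfolding V_def by blast
    then have "?F 0 2 \<le> B" by (rule B)
    then show False using E(4) by simp
  qed
  moreover have "annulus_pair F1s F2s"
    unfolding F2s_def using pair[OF ct outer sup] .
  ultimately show ?thesis using F2s unique by blast
qed

end
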